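(* Let $(A,\omega)$ be a well-becoming pair, with a decomposition $\Gamma=H_1(A,\mathbb Z)=\Gamma_1\oplus\Gamma_2$ as in the definition of well-becoming. Let $B_I=(\Sigma_{\mathbb R}/\Sigma,I)$ be the complex torus with $\Sigma=\Gamma_1^*\oplus\Gamma_2\subset\Gamma\oplus\Gamma^*$ and $I$ the restriction of $I_\omega$ to the ($I_\omega$-invariant) subspace $\Sigma_{\mathbb R}$. Then $(A,\omega)$ has a mirror symmetric weak pair of the form $(B_I,\theta)$. Moreover, the pair $(B_I,\theta)$ is well-becoming too.
   Context: A complex torus is $A=(V/\Gamma,J)$ with $\Gamma=\Gamma_A=H_1(A,\mathbb Z)$ a lattice of rank $2\dim A$, $V=V_A=\Gamma\otimes\mathbb R$, and $J=J_A\in\mathrm{End}(V)$, $J^2=-1$. The dual torus is $\hat A=(V^*/\Gamma^*,\hat J)$, $(\hat Jw)(v)=w(-Jv)$. The Néron–Severi group $NS_A$ is identified (by first Chern class) with the group of integral skew-symmetric forms $c$ on $\Gamma$ with $c_{\mathbb R}$ $J$-invariant, and with a subgroup of $\mathrm{Hom}(A,\hat A)$ via $c\mapsto(v\mapsto c(v,\cdot))$. $NS_A(\mathbb R)=NS_A\otimes\mathbb R$, $NS_A(\mathbb C)=NS_A\otimes\mathbb C$, $NS_A(\mathbb R)^0\subset NS_A(\mathbb R)$ is the set of nondegenerate forms, and $NS_A(\mathbb C)^0=\{\varphi_1+i\varphi_2\in NS_A(\mathbb C):\varphi_1\in NS_A(\mathbb R),\ \varphi_2\in NS_A(\mathbb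 R)^0\}$. Put $\Lambda_A=\Gamma_A\oplus\Gamma_{\hat A}$ ($\Gamma_{\hat A}=\Gamma_A^*$) with $Q_A((a_1,b_1),(a_2,b_2))=b_1(a_2)+b_2(a_1)$; $J_{A\times\hat A}=(J,\hat J)$ acts on $V_A\oplus V_{\hat A}$. For $\omega=\varphi_1+i\varphi_2\in NS_A(\mathbb C)^0$ (with $\varphi_k:V_A\to V_{\hat A}$) put $$I_\omega=\begin{pmatrix}\varphi_2^{-1}\varphi_1&-\varphi_2^{-1}\\ \varphi_2+\varphi_1\varphi_2^{-1}\varphi_1&-\varphi_1\varphi_2^{-1}\end{pmatrix},$$ a complex structure on $V_A\oplus V_{\hat A}$. A weak pair $(A,\omega_A)$ is a complex torus $A$ with $\omega_A\in NS_A(\mathbb C)^0$. Weak pairs $(A,\omega_A)$, $(B,\omega_B)$ are mirror symmetric if there is an isomorphism $\alpha:\Lambda_A\to\Lambda_B$ identifying $Q_A$ with $Q_B$ such that $\alpha_{\mathbb R}J_{A\times\hat A}=I_{\omega_B}\alpha_{\mathbb R}$ and $\alpha_{\mathbb R}I_{\omega_A}=J_{B\times\hat B}\alpha_{\mathbb R}$. A weak pair $(A,\omega)$, $\omega=\varphi_1+i\varphi_2$, is well-becoming if there is a decomposition $\Gamma=H_1(A,\mathbb Z)=\Gamma_1\oplus\Gamma_2$ such that (1) the subspaces $\Gamma_{1\mathbb R},\Gamma_{2\mathbb R}$ are isotropic with respect to $\omega$ (i.e. for both $\varphi_1$ and $\varphi_2$); (2) writing $J=\begin{pmatrix}J_{11}&J_{12}\\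 J_{21}&J_{22}\end{pmatrix}$ with respect to this decomposition, the maps $J_{21}:\Gamma_{1\mathbb R}\to\Gamma_{2\mathbb R}$ and $J_{12}:\Gamma_{2\mathbb R}\to\Gamma_{1\mathbb R}$ are invertible. The decomposition gives $\Gamma\oplus\Gamma^*=\Gamma_1\oplus\Gamma_2\oplus\Gamma_1^*\oplus\Gamma_2^*$. *)

theory Defs
  imports
    "HOL-Analysis.Analysis"
    "HOL-Library.Function_Algebras"
    "HOL-Computational_Algebra.Group_Closure"
begin

text \<open>
  Functions into a real vector space form a real vector space pointwise, so that spaces of
  linear functionals and of bilinear forms are subsets of real vector spaces.
\<close>

instantiation "fun" :: (type, real_vector) real_vector
begin

definition scaleR_fun :: "real \<Rightarrow> ('a \<Rightarrow> 'b) \<Rightarrow> 'a \<Rightarrow> 'b" where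
  "scaleR_fun r f = (\<lambda>x. r *\<^sub>R f x)"

instance
  by standard (simp_all add: scaleR_fun_def plus_fun_def fun_eq_iff algebra_simps)

end

section \<open>Lattices, linear maps and duals\<close>

definition is_lattice :: "'a::real_vector set \<Rightarrow> bool" where
  "is_lattice L \<longleftrightarrow> (\<exists>B. finite B \<and> independent B \<and> L = group_closure B)"

definition add_subgroup :: "'a::ab_group_add set \<Rightarrow> bool" where
  "add_subgroup G \<longleftrightarrow> 0 \<in> G \<and> (\<forall>x\<in>G. \<forall>y\<in>G. x - y \<in> G)"

definition linear_on :: "'a::real_vector set \<Rightarrow> 'b::real_vector set \<Rightarrow> ('a \<Rightarrow> 'b) \<Rightarrow> bool" where
  "linear_on V W f \<longleftrightarrow> f ` V \<subseteq> W \<and>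
     (\<forall>x\<in>V. \<forall>y\<in>V. f (x + y) = f x + f y) \<and> (\<forall>r. \<forall>x\<in>V. f (r *\<^sub>R x) = r *\<^sub>R f x)"

text \<open>
  Functionals on a subspace \<open>V\<close> are represented by functions on the ambient type that vanish
  outside \<open>V\<close>; this makes the representation unique.
\<close>

definition dual_space :: "'a::real_vector set \<Rightarrow> ('a \<Rightarrow> real) set" where
  "dual_space V = {f. linear_on V UNIV f \<and> (\<forall>x. x \<notin> V \<longrightarrow> f x = 0)}"

definition dual_lattice :: "'a::real_vector set \<Rightarrow> ('a \<Rightarrow> real) set" where
  "dual_lattice L = {f \<in> dual_space (span L). \<forall>x\<in>L. f x \<in> \<int>}"

text \<open>The component in \<open>W\<close> of a vector of \<open>U \<oplus> W\<close>.\<close>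

definition proj_along :: "'a::real_vector set \<Rightarrow> 'a set \<Rightarrow> 'a \<Rightarrow> 'a" where
  "proj_along U W v = (THE w. w \<in> W \<and> v - w \<in> U)"


section \<open>Complex tori\<close>

text \<open>
  A torus \<open>(V/\<Gamma>, J)\<close> is given by a lattice \<open>\<Gamma>\<close> in a real vector space, which realises
  \<open>V = \<Gamma> \<otimes> \<real>\<close> as the real span of \<open>\<Gamma>\<close>. Only the values of \<open>J\<close> on \<open>V\<close> matter. The rank of
  \<open>\<Gamma>\<close> is even because \<open>J\<^sup>2 = -1\<close> on \<open>V\<close>.
\<close>

record 'a torus =
  Lat :: "'a set"
  Cpx :: "'a \<Rightarrow> 'a"

definition VS :: "'a::real_vector torus \<Rightarrow> 'a set" where
  "VS A = span (Lat A)"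

definition complex_torus :: "'a::real_vector torus \<Rightarrow> bool" where
  "complex_torus A \<longleftrightarrow> is_lattice (Lat A) \<and> linear_on (VS A) (VS A) (Cpx A) \<and>
     (\<forall>v\<in>VS A. Cpx A (Cpx A v) = - v)"

definition dual_torus :: "'a::real_vector torus \<Rightarrow> ('a \<Rightarrow> real) torus" where
  "dual_torus A = \<lparr>Lat = dual_lattice (Lat A),
     Cpx = (\<lambda>w v. if v \<in> VS A then w (- Cpx A v) else 0)\<rparr>"


section \<open>The Neron-Severi group\<close>

text \<open>
  A form \<open>c\<close> is curried, so \<open>c v\<close> is the functional \<open>c(v, \<cdot>)\<close> and the same object \<open>c\<close> is the map
  \<open>V \<rightarrow> V\<^sup>*\<close>. Integral forms on \<open>\<Gamma>\<close> are represented by their real bilinear extensions, again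
  normalised to be zero outside \<open>V \<times> V\<close>. Hence \<open>NS \<otimes> \<real>\<close> is the real span of \<open>NS\<close>.
\<close>

definition NS :: "'a::real_vector torus \<Rightarrow> ('a \<Rightarrow> 'a \<Rightarrow> real) set" where
  "NS A = {c. linear_on (VS A) (dual_space (VS A)) c \<and> (\<forall>v. v \<notin> VS A \<longrightarrow> c v = 0) \<and>
     (\<forall>v\<in>VS A. \<forall>w\<in>VS A. c v w = - c w v) \<and>
     (\<forall>v\<in>Lat A. \<forall>w\<in>Lat A. c v w \<in> \<int>) \<and>
     (\<forall>v\<in>VS A. \<forall>w\<in>VS A. c (Cpx A v) (Cpx A w) = c v w)}"

definition NS_real :: "'a::real_vector torus \<Rightarrow> ('a \<Rightarrow> 'a \<Rightarrow> real) set" where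
  "NS_real A = span (NS A)"

definition NS_real0 :: "'a::real_vector torus \<Rightarrow> ('a \<Rightarrow> 'a \<Rightarrow> real) set" where
  "NS_real0 A = {c \<in> NS_real A. \<forall>v\<in>VS A. (\<forall>w\<in>VS A. c v w = 0) \<longrightarrow> v = 0}"

text \<open>Elements \<open>\<phi>\<^sub>1 + i\<phi>\<^sub>2\<close> of \<open>NS \<otimes> \<complex>\<close> are complex-valued forms.\<close>

definition re_form :: "('a \<Rightarrow> 'a \<Rightarrow> complex) \<Rightarrow> 'a \<Rightarrow> 'a \<Rightarrow> real" where
  "re_form \<omega> v w = Re (\<omega> v w)"

definition im_form :: "('a \<Rightarrow> 'a \<Rightarrow> complex) \<Rightarrow> 'a \<Rightarrow> 'a \<Rightarrow> real" where
  "im_form \<omega> v w = Im (\<omega> v w)"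

definition NS_complex0 :: "'a::real_vector torus \<Rightarrow> ('a \<Rightarrow> 'a \<Rightarrow> complex) set" where
  "NS_complex0 A = {\<omega>. re_form \<omega> \<in> NS_real A \<and> im_form \<omega> \<in> NS_real0 A}"


section \<open>Weak pairs and mirror symmetry\<close>

definition weak_pair :: "'a::real_vector torus \<Rightarrow> ('a \<Rightarrow> 'a \<Rightarrow> complex) \<Rightarrow> bool" where
  "weak_pair A \<omega> \<longleftrightarrow> complex_torus A \<and> \<omega> \<in> NS_complex0 A"

definition Lam :: "'a::real_vector torus \<Rightarrow> ('a \<times> ('a \<Rightarrow> real)) set" where
  "Lam A = Lat A \<times> Lat (dual_torus A)"

definition Lam_form :: "'a \<times> ('a \<Rightarrow> real) \<Rightarrow> 'a \<times> ('a \<Rightarrow> real) \<Rightarrow> real" where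
  "Lam_form x y = snd x (fst y) + snd y (fst x)"

definition J_prod :: "'a::real_vector torus \<Rightarrow> 'a \<times> ('a \<Rightarrow> real) \<Rightarrow> 'a \<times> ('a \<Rightarrow> real)" where
  "J_prod A = map_prod (Cpx A) (Cpx (dual_torus A))"

definition I_op :: "'a::real_vector torus \<Rightarrow> ('a \<Rightarrow> 'a \<Rightarrow> complex) \<Rightarrow>
    'a \<times> ('a \<Rightarrow> real) \<Rightarrow> 'a \<times> ('a \<Rightarrow> real)" where
  "I_op A \<omega> = (\<lambda>(v, f).
     let \<phi>1 = re_form \<omega>; \<phi>2 = im_form \<omega>; \<phi>2inv = inv_into (VS A) \<phi>2 in
     (\<phi>2inv (\<phi>1 v) - \<phi>2inv f,
      \<phi>2 v + \<phi>1 (\<phi>2inv (\<phi>1 v)) - \<phi>1 (\<phi>2inv f)))"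

text \<open>
  The function \<open>\<alpha>\<close> below is the real-linear extension of the lattice isomorphism to
  \<open>\<Lambda> \<otimes> \<real>\<close>, realised as the span of \<open>\<Lambda>\<close>; the isomorphism itself is its restriction to \<open>\<Lambda>\<close>.
\<close>

definition mirror_symmetric :: "'a::real_vector torus \<Rightarrow> ('a \<Rightarrow> 'a \<Rightarrow> complex) \<Rightarrow>
    'b::real_vector torus \<Rightarrow> ('b \<Rightarrow> 'b \<Rightarrow> complex) \<Rightarrow> bool" where
  "mirror_symmetric A \<omega>A B \<omega>B \<longleftrightarrow> weak_pair A \<omega>A \<and> weak_pair B \<omega>B \<and>
     (\<exists>\<alpha>. linear_on (span (Lam A)) (span (Lam B)) \<alpha> \<and> bij_betw \<alpha> (Lam A) (Lam B) \<and>
       (\<forall>x\<in>Lam A. \<forall>y\<in>Lam A. Lam_form (\<alpha> x) (\<alpha> y) = Lam_form x y) \<and>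
       (\<forall>x\<in>span (Lam A). \<alpha> (J_prod A x) = I_op B \<omega>B (\<alpha> x)) \<and>
       (\<forall>x\<in>span (Lam A). \<alpha> (I_op A \<omega>A x) = J_prod B (\<alpha> x)))"


section \<open>Well-becoming pairs\<close>

definition wb_decomposition :: "'a::real_vector torus \<Rightarrow> ('a \<Rightarrow> 'a \<Rightarrow> complex) \<Rightarrow>
    'a set \<Rightarrow> 'a set \<Rightarrow> bool" where
  "wb_decomposition A \<omega> \<Gamma>1 \<Gamma>2 \<longleftrightarrow>
     add_subgroup \<Gamma>1 \<and> add_subgroup \<Gamma>2 \<and>
     Lat A = {x + y |x y. x \<in> \<Gamma>1 \<and> y \<in> \<Gamma>2} \<and> \<Gamma>1 \<inter> \<Gamma>2 = {0} \<and>
     (\<forall>v\<in>span \<Gamma>1. \<forall>w\<in>span \<Gamma>1. \<omega> v w = 0) \<and>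
     (\<forall>v\<in>span \<Gamma>2. \<forall>w\<in>span \<Gamma>2. \<omega> v w = 0) \<and>
     bij_betw (\<lambda>v. proj_along (span \<Gamma>1) (span \<Gamma>2) (Cpx A v)) (span \<Gamma>1) (span \<Gamma>2) \<and>
     bij_betw (\<lambda>v. proj_along (span \<Gamma>2) (span \<Gamma>1) (Cpx A v)) (span \<Gamma>2) (span \<Gamma>1)"

definition well_becoming :: "'a::real_vector torus \<Rightarrow> ('a \<Rightarrow> 'a \<Rightarrow> complex) \<Rightarrow> bool" where
  "well_becoming A \<omega> \<longleftrightarrow> weak_pair A \<omega> \<and> (\<exists>\<Gamma>1 \<Gamma>2. wb_decomposition A \<omega> \<Gamma>1 \<Gamma>2)"

text \<open>
  For a lattice \<open>\<Gamma> = \<Gamma>\<^sub>1 \<oplus> \<Gamma>\<^sub>2\<close>, the inclusion \<open>\<Gamma>\<^sub>1\<^sup>* \<subseteq> \<Gamma>\<^sup>* = \<Gamma>\<^sub>1\<^sup>* \<oplus> \<Gamma>\<^sub>2\<^sup>*\<close> extends a functional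
  by zero on \<open>\<Gamma>\<^sub>2\<close>, that is, composes it with the projection to \<open>\<Gamma>\<^sub>1\<close>.
\<close>

definition extend_dual :: "'a::real_vector torus \<Rightarrow> 'a set \<Rightarrow> 'a set \<Rightarrow> ('a \<Rightarrow> real) \<Rightarrow>
    'a \<Rightarrow> real" where
  "extend_dual A \<Gamma>1 \<Gamma>2 f =
     (\<lambda>v. if v \<in> VS A then f (proj_along (span \<Gamma>2) (span \<Gamma>1) v) else 0)"

definition Sigma_lat :: "'a::real_vector torus \<Rightarrow> 'a set \<Rightarrow> 'a set \<Rightarrow>
    ('a \<times> ('a \<Rightarrow> real)) set" where
  "Sigma_lat A \<Gamma>1 \<Gamma>2 = \<Gamma>2 \<times> extend_dual A \<Gamma>1 \<Gamma>2 ` dual_lattice \<Gamma>1"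

definition B_torus :: "'a::real_vector torus \<Rightarrow> ('a \<Rightarrow> 'a \<Rightarrow> complex) \<Rightarrow> 'a set \<Rightarrow> 'a set \<Rightarrow>
    ('a \<times> ('a \<Rightarrow> real)) torus" where
  "B_torus A \<omega> \<Gamma>1 \<Gamma>2 = \<lparr>Lat = Sigma_lat A \<Gamma>1 \<Gamma>2,
     Cpx = restrict (I_op A \<omega>) (span (Sigma_lat A \<Gamma>1 \<Gamma>2))\<rparr>"

end

theory Submission
  imports Defs
begin

text \<open>
  A form for which \<open>\<Gamma>1\<close> and \<open>\<Gamma>2\<close> are isotropic is the same as a map \<open>V2 \<rightarrow> V1\<^sup>*\<close>. Under this
  identification \<open>I\<^sub>\<omega> (v, g) = (a, b)\<close> on \<open>V2 \<oplus> V1\<^sup>*\<close> means \<open>(\<phi>\<^sub>1 + i \<phi>\<^sub>2) (v + i a) = g + i b\<close>, so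
  that \<open>\<phi>\<^sub>1 + i \<phi>\<^sub>2\<close> is a period matrix of the torus \<open>B\<^sub>I\<close>. In the same way \<open>J\<close> is encoded by a
  period matrix \<open>\<sigma> = J\<^sub>1\<^sub>1 J\<^sub>2\<^sub>1\<^sup>-\<^sup>1 - i J\<^sub>2\<^sub>1\<^sup>-\<^sup>1 : V2 \<rightarrow> V1 \<otimes> \<complex>\<close>: the complex isomorphism of \<open>(V, J)\<close> with
  \<open>V1 \<otimes> \<complex>\<close> that is the identity on \<open>V1\<close> equals \<open>- \<sigma>\<close> on \<open>V2\<close>. Mirror symmetry exchanges the two
  matrices. The mirror form is \<open>((v, g), (w, h)) \<mapsto> h (\<sigma> v) - g (\<sigma> w)\<close>, and the isomorphism regroups
  the four summands of \<open>\<Gamma>1 \<oplus> \<Gamma>2 \<oplus> \<Gamma>1\<^sup>* \<oplus> \<Gamma>2\<^sup>*\<close>; that it intertwines the complex structures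
  (\<open>mirror_map_J\<close>, \<open>mirror_map_I\<close>) comes down to \<open>J\<^sup>2 = -1\<close> and to the isotropy of the summands.

  The mirror form has to lie in the real span of the integral invariant forms, and not merely be
  invariant. An isotropic form \<open>c\<close> is \<open>J\<close>-invariant only if \<open>c v (\<sigma> w) = c w (\<sigma> v)\<close> for all
  \<open>v, w \<in> V2\<close>, and a map \<open>d : V2 \<rightarrow> V1\<close> gives an \<open>I\<^sub>\<omega>\<close>-invariant form on the new torus as soon as
  \<open>c v (d w) = c w (d v)\<close> for \<open>c = \<phi>\<^sub>1, \<phi>\<^sub>2\<close>. This relation is bilinear in \<open>c\<close> and \<open>d\<close> with integral
  coefficients. Writing a real vector with coefficients that are linearly independent over \<open>\<int>\<close>
  (\<open>span_int_independent_combination\<close>) turns integral linear relations for the vector into the same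
  relations for integral vectors that span it. It follows that \<open>\<phi>\<^sub>1\<close> and \<open>\<phi>\<^sub>2\<close> are real combinations
  of integral isotropic forms (\<open>iso_forms_span\<close>), and that \<open>Re \<sigma>\<close> and \<open>Im \<sigma>\<close> are real combinations
  of integral maps compatible with all integral isotropic forms (\<open>compat_homs_span\<close>).

  The evident decomposition \<open>\<Gamma>1\<^sup>* \<oplus> \<Gamma>2\<close> of the new lattice need not satisfy the invertibility
  conditions: the block of \<open>I\<^sub>\<omega>\<close> from \<open>V2\<close> to \<open>V1\<^sup>*\<close> is \<open>\<phi>\<^sub>2 + \<phi>\<^sub>1 \<phi>\<^sub>2\<^sup>-\<^sup>1 \<phi>\<^sub>1\<close>, which vanishes when
  \<open>(\<phi>\<^sub>2\<^sup>-\<^sup>1 \<phi>\<^sub>1)\<^sup>2 = -1\<close>. The graph of an integral isotropic form \<open>c : \<Gamma>2 \<rightarrow> \<Gamma>1\<^sup>*\<close> is another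
  isotropic complement of \<open>\<Gamma>1\<^sup>*\<close>, and passing to it replaces \<open>\<phi>\<^sub>1\<close> by \<open>\<phi>\<^sub>1 - c\<close>. If \<open>\<phi>\<^sub>1 - c\<close> is
  close to a large multiple of \<open>\<phi>\<^sub>2\<close>, the block is invertible (\<open>shearing_form_exists\<close>).
\<close>

section \<open>Integral relations between real numbers\<close>

definition int_independent :: "real set \<Rightarrow> bool" where
  "int_independent R \<longleftrightarrow> (\<forall>n. (\<Sum>r\<in>R. of_int (n r) * r) = 0 \<longrightarrow> (\<forall>r\<in>R. n r = (0::int)))"

text \<open>
  The form in which independence is used: for an integral linear equation evaluated on a vector
  with independent coefficients, \<open>k r\<close> is the value of the equation on the part with coefficient \<open>r\<close>.
\<close>

lemma int_independentD:
  assumes "int_independent R" "\<And>r. r \<in> R \<Longrightarrow> k r \<in> \<int>" "(\<Sum>r\<in>R. k r * r) = 0" "r \<in> R"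
  shows "k r = 0"
proof -
  have k: "k r = of_int \<lfloor>k r\<rfloor>" if "r \<in> R" for r
    using assms(2)[OF that] by (metis Ints_cases floor_of_int)
  have "(\<Sum>r\<in>R. of_int \<lfloor>k r\<rfloor> * r) = 0"
    using assms(3) k by (metis (no_types, lifting) sum.cong)
  then have "\<lfloor>k r\<rfloor> = 0"
    using assms(1,4) unfolding int_independent_def by (elim allE[of _ "\<lambda>r. \<lfloor>k r\<rfloor>"]) simp
  with k[OF assms(4)] show ?thesis by simp
qed

lemma int_independent_scale:
  assumes "int_independent R" "m \<noteq> (0::real)"
  shows "int_independent ((\<lambda>r. r / m) ` R)"
  unfolding int_independent_def
proof (intro allI impI)
  fix n :: "real \<Rightarrow> int"
  have inj: "inj_on (\<lambda>r. r / m) R" using assms(2) by (auto simp: inj_on_def)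
  assume "(\<Sum>r\<in>(\<lambda>r. r / m) ` R. of_int (n r) * r) = 0"
  then have "(\<Sum>r\<in>R. of_int (n (r / m)) * (r / m)) = 0"
    by (simp add: sum.reindex[OF inj])
  then have "(\<Sum>r\<in>R. of_int (n (r / m)) * r) / m = 0"
    by (simp add: sum_divide_distrib)
  then have "(\<Sum>r\<in>R. of_int (n (r / m)) * r) = 0"
    using assms(2) by simp
  then have "\<forall>r\<in>R. n (r / m) = 0"
    using assms(1) unfolding int_independent_def by (elim allE[of _ "\<lambda>r. n (r / m)"]) simp
  then show "\<forall>r\<in>(\<lambda>r. r / m) ` R. n r = 0" by auto
qed

text \<open>
  A finitely generated group of real numbers is free. Whenever a new generator \<open>x\<close> satisfies
  \<open>m x = \<Sum> n\<^sub>r r\<close> with \<open>m \<noteq> 0\<close>, dividing the old basis by \<open>m\<close> makes room for it.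
\<close>

lemma int_independent_coordinates:
  fixes x :: "'i \<Rightarrow> real"
  assumes "finite I"
  shows "\<exists>R A. finite R \<and> int_independent R \<and>
    (\<forall>i\<in>I. x i = (\<Sum>r\<in>R. of_int (A i r) * r))"
  using assms
proof (induction I)
  case empty
  have "int_independent {}" by (simp add: int_independent_def)
  then show ?case by (intro exI[of _ "{}"]) simp
next
  case (insert j I)
  then obtain R A where R: "finite R" "int_independent R"
    and A: "\<And>i. i \<in> I \<Longrightarrow> x i = (\<Sum>r\<in>R. of_int (A i r) * r)" by blast
  show ?case
  proof (cases "\<exists>m n. m \<noteq> (0::int) \<and> of_int m * x j = (\<Sum>r\<in>R. of_int (n r) * r)")
    case True
    then obtain m and n :: "real \<Rightarrow> int" where m: "m \<noteq> 0"
      and n: "of_int m * x j = (\<Sum>r\<in>R. of_int (n r) * r)" by blast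
    define S where "S = (\<lambda>r. r / of_int m) ` R"
    have inj: "inj_on (\<lambda>r. r / of_int m) R" using m by (auto simp: inj_on_def)
    define B where "B i s = (if i = j then n (of_int m * s) else m * A i (of_int m * s))" for i s
    have "x i = (\<Sum>s\<in>S. of_int (B i s) * s)" if "i \<in> insert j I" for i
    proof (cases "i = j")
      case True
      then have "(\<Sum>s\<in>S. of_int (B i s) * s) = (\<Sum>r\<in>R. of_int (n r) * (r / of_int m))"
        using m by (simp add: S_def sum.reindex[OF inj] B_def)
      also have "\<dots> = (\<Sum>r\<in>R. of_int (n r) * r) / of_int m"
        by (simp add: sum_divide_distrib)
      also have "\<dots> = x i" using m True by (simp add: n[symmetric])
      finally show ?thesis by simp
    next
      case False
      then have "(\<Sum>s\<in>S. of_int (B i s) * s) = (\<Sum>r\<in>R. of_int (A i r) * r)"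
        using m by (simp add: S_def sum.reindex[OF inj] B_def)
      with A[of i] that False show ?thesis by simp
    qed
    moreover have "int_independent S"
      unfolding S_def using int_independent_scale[OF R(2)] m by simp
    moreover have "finite S" using R by (simp add: S_def)
    ultimately show ?thesis by blast
  next
    case False
    have notin: "x j \<notin> R"
    proof
      assume j: "x j \<in> R"
      have "(\<Sum>r\<in>R. of_int (if r = x j then 1 else 0) * r) = (\<Sum>r\<in>R. if r = x j then r else 0)"
        by (rule sum.cong) auto
      then have "of_int 1 * x j = (\<Sum>r\<in>R. of_int (if r = x j then 1 else 0) * r)"
        using j R by simp
      with False show False by (metis one_neq_zero)
    qed
    have "int_independent (insert (x j) R)"
      unfolding int_independent_def
    proof (intro allI impI)
      fix n :: "real \<Rightarrow> int"
      assume "(\<Sum>r\<in>insert (x j) R. of_int (n r) * r) = 0"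
      then have eq: "of_int (n (x j)) * x j + (\<Sum>r\<in>R. of_int (n r) * r) = 0"
        using R notin by simp
      then have "of_int (n (x j)) * x j = (\<Sum>r\<in>R. of_int (- n r) * r)"
        by (simp add: sum_negf)
      with False have "n (x j) = 0" by metis
      with eq have "\<forall>r\<in>R. n r = 0"
        using R(2) unfolding int_independent_def by simp
      with \<open>n (x j) = 0\<close> show "\<forall>r\<in>insert (x j) R. n r = 0" by simp
    qed
    moreover define B where
      "B i r = (if i = j then (if r = x j then 1 else 0) else if r = x j then 0 else A i r)" for i r
    have "x i = (\<Sum>r\<in>insert (x j) R. of_int (B i r) * r)" if "i \<in> insert j I" for i
    proof (cases "i = j")
      case True
      have "(\<Sum>r\<in>R. of_int (B i r) * r) = 0"
        using notin True by (intro sum.neutral) (auto simp: B_def)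
      then show ?thesis using R notin True by (simp add: B_def)
    next
      case False
      have "(\<Sum>r\<in>R. of_int (B i r) * r) = (\<Sum>r\<in>R. of_int (A i r) * r)"
        using notin False by (intro sum.cong) (auto simp: B_def)
      then show ?thesis using R notin False A[of i] that by (simp add: B_def)
    qed
    ultimately show ?thesis using R(1) by blast
  qed
qed

section \<open>Lattices\<close>

lemma group_closure_subset_span: "group_closure B \<subseteq> span (B :: 'a::real_vector set)"
proof
  fix x assume "x \<in> group_closure B"
  then show "x \<in> span B"
    by induction (auto intro: span_base span_diff span_zero)
qed

lemma span_group_closure: "span (group_closure B) = span (B :: 'a::real_vector set)"
proof
  show "span (group_closure B) \<subseteq> span B"
    by (metis group_closure_subset_span span_mono span_span)
  show "span B \<subseteq> span (group_closure B)"
    by (intro span_mono) (auto intro: group_closure.base)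
qed

lemma add_subgroup_group_closure: "add_subgroup (group_closure B)"
  by (simp add: add_subgroup_def group_closure.diff)

lemma add_subgroup_minus: "add_subgroup G \<Longrightarrow> x \<in> G \<Longrightarrow> - x \<in> G"
  unfolding add_subgroup_def by (metis diff_0)

lemma add_subgroup_add: "add_subgroup G \<Longrightarrow> x \<in> G \<Longrightarrow> y \<in> G \<Longrightarrow> x + y \<in> G"
  using add_subgroup_minus[of G y] unfolding add_subgroup_def
  by (metis diff_minus_eq_add)

lemma add_subgroup_sum:
  "add_subgroup G \<Longrightarrow> (\<And>i. i \<in> I \<Longrightarrow> f i \<in> G) \<Longrightarrow> sum f I \<in> G"
  by (induction I rule: infinite_finite_induct)
    (auto intro: add_subgroup_add simp: add_subgroup_def)

lemma add_subgroup_scale: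
  fixes G :: "'a::real_vector set"
  assumes "add_subgroup G" "x \<in> G"
  shows "of_int n *\<^sub>R x \<in> G"
proof -
  have nat: "of_nat k *\<^sub>R x \<in> G" for k
    using assms by (induction k) (auto simp: algebra_simps add_subgroup_def intro: add_subgroup_add)
  show ?thesis
  proof (cases "n \<ge> 0")
    case True
    then show ?thesis using nat[of "nat n"] by simp
  next
    case False
    then show ?thesis
      using add_subgroup_minus[OF assms(1) nat[of "nat (- n)"]] by simp
  qed
qed

lemma add_subgroup_scale_Ints:
  fixes G :: "'a::real_vector set"
  assumes "add_subgroup G" "x \<in> G" "r \<in> \<int>"
  shows "r *\<^sub>R x \<in> G"
  using assms add_subgroup_scale by (metis Ints_cases)

lemma group_closure_least: "add_subgroup G \<Longrightarrow> B \<subseteq> G \<Longrightarrow> group_closure B \<subseteq> G"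
proof
  fix x assume "add_subgroup G" "B \<subseteq> G" "x \<in> group_closure B"
  from this(3,1,2) show "x \<in> G"
    by induction (auto simp: add_subgroup_def)
qed

lemma sum_representation_finite:
  assumes "finite B" "independent B" "x \<in> span B"
  shows "(\<Sum>b\<in>B. representation B x b *\<^sub>R b) = x"
  using real_vector.sum_representation_eq[OF assms(2,3,1)] by simp

lemma group_closure_eq_integral_coordinates:
  fixes B :: "'a::real_vector set"
  assumes "finite B" "independent B"
  shows "group_closure B = {x \<in> span B. \<forall>b. representation B x b \<in> \<int>}"
proof
  have "add_subgroup {x \<in> span B. \<forall>b. representation B x b \<in> \<int>}"
    using assms(2)
    by (auto simp: add_subgroup_def span_zero span_diff real_vector.representation_zero
        real_vector.representation_diff)
  moreover have "B \<subseteq> {x \<in> span B. \<forall>b. representation B x b \<in> \<int>}"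
    using assms(2) by (auto simp: span_base real_vector.representation_basis)
  ultimately show "group_closure B \<subseteq> {x \<in> span B. \<forall>b. representation B x b \<in> \<int>}"
    by (rule group_closure_least)
  show "{x \<in> span B. \<forall>b. representation B x b \<in> \<int>} \<subseteq> group_closure B"
  proof
    fix x assume x: "x \<in> {x \<in> span B. \<forall>b. representation B x b \<in> \<int>}"
    have "(\<Sum>b\<in>B. representation B x b *\<^sub>R b) \<in> group_closure B"
      using x by (intro add_subgroup_sum add_subgroup_scale_Ints add_subgroup_group_closure)
        (auto intro: group_closure.base)
    then show "x \<in> group_closure B"
      using x sum_representation_finite[OF assms, of x] by simp
  qed
qed

lemma group_closure_insert:
  "x \<in> group_closure (insert b B) \<Longrightarrow>
    \<exists>n. \<exists>y\<in>group_closure B. x = of_int n *\<^sub>R b + (y :: 'a::real_vector)"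
proof (induction rule: group_closure.induct)
  case (base s)
  consider "s = b" | "s \<in> insert 0 B" using base by blast
  then show ?case
  proof cases
    case 1
    then show ?thesis by (intro exI[of _ 1] bexI[of _ 0]) auto
  next
    case 2
    then show ?thesis by (intro exI[of _ 0] bexI[of _ s]) (auto intro: group_closure.base)
  qed
next
  case (diff s t)
  then obtain n y m z where "y \<in> group_closure B" "z \<in> group_closure B"
    and "s = of_int n *\<^sub>R b + y" "t = of_int m *\<^sub>R b + z" by blast
  then show ?case
    by (intro exI[of _ "n - m"] bexI[of _ "y - z"]) (auto simp: algebra_simps intro: group_closure.diff)
qed

lemma group_closure_mono: "B \<subseteq> C \<Longrightarrow> group_closure B \<subseteq> group_closure C"
  by (rule group_closure_least[OF add_subgroup_group_closure]) (auto intro: group_closure.base)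

lemma add_subgroup_Int: "add_subgroup G \<Longrightarrow> add_subgroup H \<Longrightarrow> add_subgroup (G \<inter> H)"
  by (auto simp: add_subgroup_def)

text \<open>
  The coefficients at \<open>b\<close> of the elements of \<open>G\<close> form a subgroup \<open>d\<int>\<close> of \<open>\<int>\<close>. An element of
  \<open>G\<close> with coefficient \<open>d\<close> completes a basis of the part of \<open>G\<close> with coefficient \<open>0\<close>.
\<close>

lemma subgroup_of_lattice_basis:
  fixes B :: "'a::real_vector set"
  assumes "finite B" "independent B" "add_subgroup G" "G \<subseteq> group_closure B"
  shows "\<exists>C. finite C \<and> independent C \<and> G = group_closure C"
  using assms
proof (induction B arbitrary: G)
  case empty
  then have "G = group_closure {}" by (auto simp: add_subgroup_def)
  then show ?case using real_vector.independent_empty by blast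
next
  case (insert b B G)
  have indB: "independent B" and b: "b \<notin> span B"
    using insert.prems insert.hyps by (auto simp: real_vector.independent_insert)
  define H where "H = G \<inter> group_closure B"
  have H: "add_subgroup H" "H \<subseteq> group_closure B"
    unfolding H_def using insert.prems add_subgroup_Int add_subgroup_group_closure by auto
  obtain C where C: "finite C" "independent C" "H = group_closure C"
    using insert.IH[OF indB H] by blast
  show ?case
  proof (cases "G = H")
    case True
    with C show ?thesis by blast
  next
    case False
    define N where "N = {n::nat. n > 0 \<and> (\<exists>y\<in>group_closure B. of_nat n *\<^sub>R b + y \<in> G)}"
    from False obtain x where x: "x \<in> G" "x \<notin> group_closure B"
      unfolding H_def by blast
    with insert.prems obtain n y where y: "y \<in> group_closure B" "x = of_int n *\<^sub>R b + y"
      using group_closure_insert by blast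
    have "n \<noteq> 0" using x y by auto
    have "N \<noteq> {}"
    proof (cases "n > 0")
      case True
      then have "nat n \<in> N" using x y by (auto simp: N_def intro!: bexI[of _ y])
      then show ?thesis by blast
    next
      case False
      have "- x \<in> G" using x insert.prems add_subgroup_minus by blast
      then have "of_nat (nat (- n)) *\<^sub>R b + - y \<in> G"
        using False y by simp
      with False \<open>n \<noteq> 0\<close> y have "nat (- n) \<in> N"
        unfolding N_def by (intro CollectI conjI bexI[of _ "- y"]) auto
      then show ?thesis by blast
    qed
    define d where "d = (LEAST n. n \<in> N)"
    have dN: "d \<in> N" using \<open>N \<noteq> {}\<close> unfolding d_def by (metis LeastI ex_in_conv)
    have dmin: "d \<le> n" if "n \<in> N" for n using that unfolding d_def by (rule Least_le)
    from dN obtain w where d0: "d > 0" and w: "w \<in> group_closure B" "of_nat d *\<^sub>R b + w \<in> G"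
      unfolding N_def by blast
    define g where "g = of_nat d *\<^sub>R b + w"
    have gG: "g \<in> G" using w g_def by simp
    have wspan: "w \<in> span B" using w group_closure_subset_span by blast
    have gspan: "g \<notin> span B"
    proof
      assume "g \<in> span B"
      then have "of_nat d *\<^sub>R b \<in> span B"
        using wspan span_diff[of g B w] by (simp add: g_def)
      then have "(1 / of_nat d) *\<^sub>R of_nat d *\<^sub>R b \<in> span B" by (rule span_scale)
      then have "b \<in> span B" using d0 by simp
      with b show False by blast
    qed
    have CB: "span C \<subseteq> span B"
      by (metis C(3) H(2) group_closure_subset_span span_group_closure span_mono subset_trans span_span)
    have indC: "independent (insert g C)"
      using C gspan CB by (auto simp: real_vector.independent_insert)
    have "G \<subseteq> group_closure (insert g C)"
    proof
      fix x assume xG: "x \<in> G"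
      with insert.prems obtain n y where y: "y \<in> group_closure B" "x = of_int n *\<^sub>R b + y"
        using group_closure_insert by blast
      define k where "k = n div int d"
      define r where "r = n mod int d"
      have n: "n = k * int d + r" and r: "0 \<le> r" "r < int d"
        using d0 by (auto simp: k_def r_def)
      define z where "z = x - of_int k *\<^sub>R g"
      have zG: "z \<in> G"
        using xG gG insert.prems add_subgroup_scale[of G g k] unfolding z_def add_subgroup_def by blast
      have yw: "y - of_int k *\<^sub>R w \<in> group_closure B"
        by (intro group_closure.diff y add_subgroup_scale add_subgroup_group_closure w)
      have z: "z = of_int r *\<^sub>R b + (y - of_int k *\<^sub>R w)"
        by (simp add: z_def y g_def n algebra_simps)
      have "r = 0"
      proof (rule ccontr)
        assume "r \<noteq> 0"
        with r zG z yw have "nat r \<in> N"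
          by (auto simp: N_def intro!: bexI[of _ "y - of_int k *\<^sub>R w"])
        then have "d \<le> nat r" by (rule dmin)
        with r show False by simp
      qed
      with z yw zG have "z \<in> H" by (simp add: H_def)
      then have "z \<in> group_closure (insert g C)"
        using C group_closure_mono[of C "insert g C"] by blast
      moreover have "of_int k *\<^sub>R g \<in> group_closure (insert g C)"
        by (intro add_subgroup_scale add_subgroup_group_closure group_closure.base) auto
      ultimately show "x \<in> group_closure (insert g C)"
        using add_subgroup_add[OF add_subgroup_group_closure] unfolding z_def
        by (metis diff_add_cancel)
    qed
    moreover have "group_closure (insert g C) \<subseteq> G"
    proof (rule group_closure_least)
      have "C \<subseteq> H" using C by (auto intro: group_closure.base)
      then show "insert g C \<subseteq> G" using gG by (auto simp: H_def)
    qed (use insert.prems in auto)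
    ultimately show ?thesis using indC C by blast
  qed
qed

lemma is_lattice_subgroup:
  assumes "is_lattice L" "add_subgroup G" "G \<subseteq> L"
  shows "is_lattice G"
  using assms subgroup_of_lattice_basis unfolding is_lattice_def by metis

lemma is_lattice_add_subgroup: "is_lattice L \<Longrightarrow> add_subgroup L"
  unfolding is_lattice_def using add_subgroup_group_closure by blast

text \<open>A homomorphism out of a lattice extends linearly because a basis may be sent anywhere.\<close>

lemma lattice_hom_linear_extension:
  fixes L :: "'a::real_vector set" and h :: "'a \<Rightarrow> 'b::real_vector"
  assumes "is_lattice L" "\<And>x y. x \<in> L \<Longrightarrow> y \<in> L \<Longrightarrow> h (x - y) = h x - h y"
  shows "\<exists>f. linear f \<and> (\<forall>x\<in>L. f x = h x) \<and> range f \<subseteq> span (h ` L)"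
proof -
  obtain B where B: "finite B" "independent B" "L = group_closure B"
    using assms(1) is_lattice_def by blast
  obtain f where f: "linear f" "\<And>x. x \<in> B \<Longrightarrow> f x = h x" "range f = span (h ` B)"
    using real_vector.linear_independent_extend_subspace linear_independent_extend_subspace[OF B(2), of h]
    by metis
  have "h (0 - 0) = h 0 - h 0"
    by (rule assms(2)) (auto simp: B(3))
  then have h0: "h 0 = 0" by simp
  have "f x = h x" if "x \<in> group_closure B" for x
    using that
  proof induction
    case (base s)
    then show ?case using f h0 linear_0 by auto
  next
    case (diff s t)
    then show ?case using assms(2)[of s t] f(1) by (simp add: B(3) linear_diff)
  qed
  moreover have "span (h ` B) \<subseteq> span (h ` L)"
    by (intro span_mono image_mono) (auto simp: B(3) intro: group_closure.base)
  ultimately show ?thesis using f B(3) by blast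
qed

lemma linear_on_add: "linear_on V W f \<Longrightarrow> x \<in> V \<Longrightarrow> y \<in> V \<Longrightarrow> f (x + y) = f x + f y"
  by (simp add: linear_on_def)

lemma linear_on_scale: "linear_on V W f \<Longrightarrow> x \<in> V \<Longrightarrow> f (r *\<^sub>R x) = r *\<^sub>R f x"
  by (simp add: linear_on_def)

lemma linear_on_mem: "linear_on V W f \<Longrightarrow> x \<in> V \<Longrightarrow> f x \<in> W"
  by (auto simp: linear_on_def)

lemma linear_onI:
  assumes "\<And>x. x \<in> V \<Longrightarrow> f x \<in> W"
    and "\<And>x y. x \<in> V \<Longrightarrow> y \<in> V \<Longrightarrow> f (x + y) = f x + f y"
    and "\<And>r x. x \<in> V \<Longrightarrow> f (r *\<^sub>R x) = r *\<^sub>R f x"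
  shows "linear_on V W f"
  using assms by (auto simp: linear_on_def)

lemma linear_on_span_extension:
  fixes f :: "'a::real_vector \<Rightarrow> 'b::real_vector"
  assumes "finite B" "independent B" "linear_on (span B) W f"
  shows "\<exists>g. linear g \<and> (\<forall>x\<in>span B. g x = f x)"
proof -
  obtain g where g: "linear g" "\<And>x. x \<in> B \<Longrightarrow> g x = f x"
    using linear_independent_extend[OF assms(2), of f] by blast
  have "x \<in> span B \<and> g x = f x" if "x \<in> span B" for x
    using that
  proof (induction rule: span_induct_alt)
    case base
    have "f (0 *\<^sub>R 0) = 0 *\<^sub>R f 0"
      by (rule linear_on_scale[OF assms(3) span_zero])
    then show ?case using linear_0[OF g(1)] by (simp add: span_zero)
  next
    case (step c x y)
    have x: "x \<in> span B" using step(1) by (rule span_base)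
    have y: "y \<in> span B" "g y = f y" using step(2) by auto
    have "f (c *\<^sub>R x + y) = c *\<^sub>R f x + f y"
      using linear_on_add[OF assms(3) span_scale[OF x] y(1)] linear_on_scale[OF assms(3) x] by simp
    then show ?case
      using g y x step(1) by (simp add: linear_add linear_scale span_add span_scale)
  qed
  with g show ?thesis by blast
qed

text \<open>
  Dimension count: an injective map into a space that is not larger is onto, because the image
  of a basis cannot be enlarged to a longer independent set.
\<close>

lemma injective_linear_on_surj:
  fixes f :: "'a::real_vector \<Rightarrow> 'b::real_vector"
  assumes C: "finite C" "independent C" and D: "finite D" and le: "card D \<le> card C"
    and f: "linear_on (span C) (span D) f"
    and inj: "\<And>x. x \<in> span C \<Longrightarrow> f x = 0 \<Longrightarrow> x = 0"
  shows "bij_betw f (span C) (span D)"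
proof -
  obtain g where g: "linear g" and gf: "\<And>x. x \<in> span C \<Longrightarrow> g x = f x"
    using linear_on_span_extension[OF C f] by blast
  have injg: "inj_on g (span C)"
    using inj gf linear_inj_on_iff_eq_0[OF g, of "span C"] by (auto simp: subspace_span)
  have ind: "independent (g ` C)"
    using linear_independent_injective_image[OF g C(2) injg] .
  have sub: "g ` span C \<subseteq> span D"
    using linear_on_mem[OF f] gf by (auto simp: image_subset_iff)
  have "span D \<subseteq> g ` span C"
  proof
    fix y assume y: "y \<in> span D"
    show "y \<in> g ` span C"
    proof (rule ccontr)
      assume "y \<notin> g ` span C"
      then have notin: "y \<notin> span (g ` C)" by (simp add: linear_span_image[OF g])
      then have "independent (insert y (g ` C))"
        using ind by (simp add: real_vector.independent_insert)
      moreover have "insert y (g ` C) \<subseteq> span D"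
        using y sub span_superset[of C] by blast
      ultimately have "card (insert y (g ` C)) \<le> card D"
        using real_vector.independent_span_bound[OF D] by blast
      moreover have "y \<notin> g ` C" using notin span_base[of y "g ` C"] by blast
      moreover have "card (g ` C) = card C"
        by (intro card_image inj_on_subset[OF injg] span_superset)
      ultimately show False using le C by simp
    qed
  qed
  with sub injg have "bij_betw g (span C) (span D)" unfolding bij_betw_def by blast
  moreover have "bij_betw g (span C) (span D) \<longleftrightarrow> bij_betw f (span C) (span D)"
    by (rule bij_betw_cong) (rule gf)
  ultimately show ?thesis by simp
qed

section \<open>Functionals\<close>

lemma dual_space_add: "f \<in> dual_space V \<Longrightarrow> x \<in> V \<Longrightarrow> y \<in> V \<Longrightarrow> f (x + y) = f x + f y"
  by (simp add: dual_space_def linear_on_def)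

lemma dual_space_scale: "f \<in> dual_space V \<Longrightarrow> x \<in> V \<Longrightarrow> f (r *\<^sub>R x) = r * f x"
  by (simp add: dual_space_def linear_on_def)

lemma dual_space_outside: "f \<in> dual_space V \<Longrightarrow> x \<notin> V \<Longrightarrow> f x = 0"
  by (simp add: dual_space_def)

lemma dual_space_zero: "f \<in> dual_space V \<Longrightarrow> f 0 = 0"
  using dual_space_scale[of f V 0 0] dual_space_outside[of f V 0] by auto

lemma dual_space_minus: "f \<in> dual_space V \<Longrightarrow> x \<in> V \<Longrightarrow> f (- x) = - f x"
  using dual_space_scale[of f V x "- 1"] by simp

lemma dual_space_diff:
  "f \<in> dual_space V \<Longrightarrow> subspace V \<Longrightarrow> x \<in> V \<Longrightarrow> y \<in> V \<Longrightarrow> f (x - y) = f x - f y"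
  using dual_space_add[of f V x "- y"] dual_space_minus[of f V y] subspace_neg[of V y] by simp

lemma dual_space_sum:
  assumes "f \<in> dual_space V" "subspace V" "\<And>i. i \<in> I \<Longrightarrow> g i \<in> V"
  shows "f (\<Sum>i\<in>I. g i) = (\<Sum>i\<in>I. f (g i))"
  using assms(3)
  by (induction I rule: infinite_finite_induct)
    (auto simp: dual_space_zero[OF assms(1)] dual_space_add[OF assms(1)] subspace_sum[OF assms(2)])

lemma dual_spaceI:
  assumes "\<And>x y. x \<in> V \<Longrightarrow> y \<in> V \<Longrightarrow> f (x + y) = f x + f y"
    and "\<And>r x. x \<in> V \<Longrightarrow> f (r *\<^sub>R x) = r * f x"
    and "\<And>x. x \<notin> V \<Longrightarrow> f x = 0"
  shows "f \<in> dual_space V"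
  using assms by (simp add: dual_space_def linear_on_def)

lemma subspace_dual_space: "subspace (dual_space V)"
  by (rule subspaceI)
    (auto intro!: dual_spaceI simp: dual_space_add dual_space_scale dual_space_outside
      scaleR_fun_def algebra_simps)

lemma dual_space_eqI:
  "f \<in> dual_space V \<Longrightarrow> g \<in> dual_space V \<Longrightarrow> (\<And>x. x \<in> V \<Longrightarrow> f x = g x) \<Longrightarrow> f = g"
  using dual_space_outside by (metis ext)

lemma dual_space_vanish_span:
  assumes "f \<in> dual_space V" "subspace V" "M \<subseteq> V" "\<And>x. x \<in> M \<Longrightarrow> f x = 0" "x \<in> span M"
  shows "f x = 0"
proof -
  from assms(5) have "x \<in> V \<and> f x = 0"
  proof (induction rule: span_induct_alt)
    case base
    show ?case using dual_space_zero[OF assms(1)] subspace_0[OF assms(2)] by simp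
  next
    case (step c x y)
    have x: "x \<in> V" "c *\<^sub>R x \<in> V" using step(1) assms(2,3) subspace_scale by auto
    have y: "y \<in> V" "f y = 0" using step(2) by auto
    show ?case
      using dual_space_add[OF assms(1) x(2) y(1)] dual_space_scale[OF assms(1) x(1), of c]
        assms(4)[OF step(1)] y subspace_add[OF assms(2) x(2) y(1)] by simp
  qed
  then show ?thesis by blast
qed

text \<open>
  The dual of a direct summand \<open>V1\<close> of \<open>V = V1 \<oplus> V2\<close> is represented by the functionals on \<open>V\<close> that
  vanish on \<open>V2\<close>, in accordance with the inclusion \<open>\<Gamma>1\<^sup>* \<subseteq> \<Gamma>\<^sup>*\<close>.
\<close>

definition annih :: "'a::real_vector set \<Rightarrow> 'a set \<Rightarrow> ('a \<Rightarrow> real) set" where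
  "annih V W = {f \<in> dual_space V. \<forall>x\<in>W. f x = 0}"

definition annih_lattice :: "'a::real_vector set \<Rightarrow> 'a set \<Rightarrow> ('a \<Rightarrow> real) set" where
  "annih_lattice L M = {f \<in> dual_lattice L. \<forall>x\<in>M. f x = 0}"

lemma subspace_annih: "subspace (annih V W)"
  using subspace_dual_space[of V]
  by (auto simp: annih_def subspace_def scaleR_fun_def)

lemma annihD: "f \<in> annih V W \<Longrightarrow> f \<in> dual_space V" "f \<in> annih V W \<Longrightarrow> x \<in> W \<Longrightarrow> f x = 0"
  by (auto simp: annih_def)

lemma annihI: "f \<in> dual_space V \<Longrightarrow> (\<And>x. x \<in> W \<Longrightarrow> f x = 0) \<Longrightarrow> f \<in> annih V W"
  by (auto simp: annih_def)

lemma sum_fun_apply: "(\<Sum>i\<in>I. g i) x = (\<Sum>i\<in>I. g i x :: 'b::comm_monoid_add)"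
  by (induction I rule: infinite_finite_induct) auto

section \<open>Splittings of a lattice\<close>

locale split_lattice =
  fixes L L1 L2 :: "'a::real_vector set"
  assumes lattice: "is_lattice L"
    and sub1: "add_subgroup L1" and sub2: "add_subgroup L2"
    and L_sum: "L = {x + y |x y. x \<in> L1 \<and> y \<in> L2}"
    and inter: "L1 \<inter> L2 = {0}"

lemma (in split_lattice) split_lattice_swap: "split_lattice L L2 L1"
proof
  show "L = {x + y |x y. x \<in> L2 \<and> y \<in> L1}"
    unfolding L_sum by (auto, metis add.commute, metis add.commute)
qed (use lattice sub1 sub2 inter in auto)

text \<open>
  A projection that is linear on the whole ambient space, so that linearity can be used without
  membership conditions. Outside of \<open>span U + span W\<close> its values are arbitrary.
\<close>

definition split_proj :: "'a::real_vector set \<Rightarrow> 'a set \<Rightarrow> 'a \<Rightarrow> 'a" where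
  "split_proj U W = (SOME P. linear P \<and> range P \<subseteq> span U \<and>
     (\<forall>x\<in>span U. P x = x) \<and> (\<forall>x\<in>span W. P x = 0))"

context split_lattice
begin

lemma L1_subset: "L1 \<subseteq> L"
  using sub2 unfolding L_sum add_subgroup_def by force

lemma L2_subset: "L2 \<subseteq> L"
  using sub1 unfolding L_sum add_subgroup_def by force

lemma lattice1: "is_lattice L1"
  using is_lattice_subgroup lattice sub1 L1_subset by blast

lemma lattice2: "is_lattice L2"
  using is_lattice_subgroup lattice sub2 L2_subset by blast

text \<open>
  The projection of \<open>L\<close> to \<open>L1\<close> is a homomorphism of lattices, so it extends to the real spans.
  This is what makes the sum of the real spans direct.
\<close>

lemma split_proj_exists:
  "\<exists>P. linear P \<and> range P \<subseteq> span L1 \<and> (\<forall>x\<in>span L1. P x = x) \<and> (\<forall>x\<in>span L2. P x = 0)"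
proof -
  define h where "h x = (THE u. u \<in> L1 \<and> x - u \<in> L2)" for x
  have h: "h (u + v) = u" if "u \<in> L1" "v \<in> L2" for u v
    unfolding h_def
  proof (rule the_equality)
    show "u \<in> L1 \<and> u + v - u \<in> L2" using that by simp
    fix w assume w: "w \<in> L1 \<and> u + v - w \<in> L2"
    have "(u + v - w) - v \<in> L2" using w that sub2 unfolding add_subgroup_def by blast
    moreover have "u - w \<in> L1" using w that sub1 unfolding add_subgroup_def by blast
    ultimately have "u - w \<in> L1 \<inter> L2" by simp
    then show "w = u" using inter by auto
  qed
  have "h (x - y) = h x - h y" if "x \<in> L" "y \<in> L" for x y
  proof -
    from that obtain u v u' v' where "x = u + v" "u \<in> L1" "v \<in> L2" "y = u' + v'" "u' \<in> L1" "v' \<in> L2"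
      unfolding L_sum by blast
    moreover then have "u - u' \<in> L1" "v - v' \<in> L2"
      using sub1 sub2 unfolding add_subgroup_def by auto
    moreover have "x - y = (u - u') + (v - v')" using calculation by simp
    ultimately show ?thesis using h by metis
  qed
  then obtain P where P: "linear P" "\<And>x. x \<in> L \<Longrightarrow> P x = h x" "range P \<subseteq> span (h ` L)"
    using lattice_hom_linear_extension[OF lattice, of h] by blast
  have zero: "0 \<in> L1" "0 \<in> L2" using sub1 sub2 by (auto simp: add_subgroup_def)
  have P1: "P x = x" if "x \<in> span L1" for x
  proof (rule linear_eq_on_span[OF P(1) linear_ident _ that])
    fix x assume "x \<in> L1"
    then show "P x = x" using P(2)[of x] h[of x 0] zero L1_subset by auto
  qed
  have P2: "P x = 0" if "x \<in> span L2" for x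
  proof (rule linear_eq_on_span[OF P(1) _ _ that])
    show "linear (\<lambda>x. 0)" by (simp add: linear_iff)
    fix x assume "x \<in> L2"
    then show "P x = 0" using P(2)[of x] h[of 0 x] zero L2_subset by auto
  qed
  have "h ` L \<subseteq> L1" using h unfolding L_sum by auto
  then have "range P \<subseteq> span L1" using P(3) span_mono by blast
  with P(1) P1 P2 show ?thesis by blast
qed

abbreviation "pr1 \<equiv> split_proj L1 L2"

abbreviation "pr2 \<equiv> split_proj L2 L1"

lemma pr1:
  "linear pr1" "pr1 x \<in> span L1"
  "x \<in> span L1 \<Longrightarrow> pr1 x = x" "x \<in> span L2 \<Longrightarrow> pr1 x = 0"
  using someI_ex[OF split_proj_exists] unfolding split_proj_def[symmetric] by auto

lemma pr2:
  "linear pr2" "pr2 x \<in> span L2"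
  "x \<in> span L2 \<Longrightarrow> pr2 x = x" "x \<in> span L1 \<Longrightarrow> pr2 x = 0"
  using split_lattice.pr1[OF split_lattice_swap] by auto

lemma span1: "x \<in> span L1 \<Longrightarrow> x \<in> span L"
  using span_mono[OF L1_subset] by blast

lemma span2: "x \<in> span L2 \<Longrightarrow> x \<in> span L"
  using span_mono[OF L2_subset] by blast

lemma pr_add: assumes "x \<in> span L" shows "pr1 x + pr2 x = x"
proof (rule linear_eq_on_span[OF _ linear_ident _ assms])
  show "linear (\<lambda>x. pr1 x + pr2 x)" using pr1(1) pr2(1) by (rule linear_compose_add)
  fix x assume "x \<in> L"
  then obtain u v where "x = u + v" "u \<in> L1" "v \<in> L2" unfolding L_sum by blast
  then show "pr1 x + pr2 x = x"
    by (simp add: linear_add[OF pr1(1)] linear_add[OF pr2(1)] pr1 pr2 span_base)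
qed

lemma pr1_lattice: "x \<in> L \<Longrightarrow> pr1 x \<in> L1"
  unfolding L_sum using pr1(3,4) by (auto simp: linear_add[OF pr1(1)] span_base)

lemma pr2_lattice: "x \<in> L \<Longrightarrow> pr2 x \<in> L2"
  using split_lattice.pr1_lattice[OF split_lattice_swap] .

lemma span_inter: "x \<in> span L1 \<Longrightarrow> x \<in> span L2 \<Longrightarrow> x = 0"
  using pr1(3,4) by fastforce

lemma proj_along_unique:
  assumes "w \<in> span L1" "x - w \<in> span L2"
  shows "proj_along (span L2) (span L1) x = w"
  unfolding proj_along_def
proof (rule the_equality)
  fix w' assume w': "w' \<in> span L1 \<and> x - w' \<in> span L2"
  have "w - w' \<in> span L1" using w' assms span_diff by blast
  moreover have "(x - w') - (x - w) \<in> span L2" using w' assms span_diff by blast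
  ultimately have "w - w' = 0" by (intro span_inter) simp_all
  then show "w' = w" by simp
qed (use assms in auto)

lemma proj_along1: "x \<in> span L \<Longrightarrow> proj_along (span L2) (span L1) x = pr1 x"
  using pr_add[of x] by (intro proj_along_unique pr1) (metis add_diff_cancel_left' pr2(2))

lemma proj_along2: "x \<in> span L \<Longrightarrow> proj_along (span L1) (span L2) x = pr2 x"
  using split_lattice.proj_along1[OF split_lattice_swap] .

lemma annih_pr1: "f \<in> annih (span L) (span L2) \<Longrightarrow> x \<in> span L \<Longrightarrow> f (pr1 x) = f x"
  using pr_add[of x] dual_space_add[OF annihD(1), of f "span L" "span L2" "pr1 x" "pr2 x"]
    annihD(2)[of f "span L" "span L2" "pr2 x"] pr1(2)[of x] pr2(2)[of x] span1 span2 by auto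

lemma compose_pr1_annih:
  assumes "f \<in> dual_space (span L)"
  shows "(\<lambda>x. if x \<in> span L then f (pr1 x) else 0) \<in> annih (span L) (span L2)"
  using span1 pr1(2)
  by (intro annihI dual_spaceI)
    (auto simp: span_add span_scale linear_add[OF pr1(1)] linear_scale[OF pr1(1)]
      dual_space_add[OF assms] dual_space_scale[OF assms] pr1(4) dual_space_zero[OF assms])

lemma annih_lattice_subset: "annih_lattice L L2 \<subseteq> annih (span L) (span L2)"
  using dual_space_vanish_span[of _ "span L" L2] L2_subset span_superset[of L]
  by (auto simp: annih_lattice_def dual_lattice_def intro!: annihI)

text \<open>
  A basis of \<open>L1\<close> has a dual basis consisting of functionals that vanish on \<open>L2\<close>. It is a
  basis over the integers of \<open>annih_lattice L L2\<close> and over the reals of its span.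
\<close>

lemma dual_basis:
  obtains B d where "finite B" "independent B" "L1 = group_closure B"
    "\<And>b. b \<in> B \<Longrightarrow> d b \<in> annih_lattice L L2"
    "\<And>f. f \<in> annih (span L) (span L2) \<Longrightarrow> f = (\<Sum>b\<in>B. f b *\<^sub>R d b)"
    "\<And>b c. b \<in> B \<Longrightarrow> c \<in> B \<Longrightarrow> d b c = (if c = b then 1 else 0)"
proof -
  obtain B where B: "finite B" "independent B" "L1 = group_closure B"
    using lattice1 is_lattice_def by blast
  have sB: "span L1 = span B" by (simp add: B(3) span_group_closure)
  have BL1: "b \<in> L1" if "b \<in> B" for b using that B(3) group_closure.base by blast
  define d where "d b x = (if x \<in> span L then representation B (pr1 x) b else 0)" for b x
  have sp: "pr1 x \<in> span B" for x using pr1(2)[of x] by (simp add: sB)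
  have dV: "d b \<in> dual_space (span L)" for b
    unfolding d_def
    by (intro dual_spaceI)
      (auto simp: linear_add[OF pr1(1)] linear_scale[OF pr1(1)] span_add span_scale
        real_vector.representation_add[OF B(2) sp sp] real_vector.representation_scale[OF B(2) sp])
  have dint: "d b x \<in> \<int>" if "x \<in> L" for b x
    using pr1_lattice[OF that] group_closure_eq_integral_coordinates[OF B(1,2)] B(3)
    by (auto simp: d_def)
  have d0: "d b x = 0" if "x \<in> L2" for b x
    using that pr1(4)[of x] span_base[of x L2]
    by (auto simp: d_def real_vector.representation_zero)
  have dc: "d b c = (if c = b then 1 else 0)" if "b \<in> B" "c \<in> B" for b c
  proof -
    have "c \<in> span L1" using BL1[OF that(2)] by (rule span_base)
    then have "d b c = representation B c b" using pr1(3)[of c] span1[of c] by (simp add: d_def)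
    then show ?thesis by (auto simp: real_vector.representation_basis[OF B(2) that(2)])
  qed
  have f: "f = (\<Sum>b\<in>B. f b *\<^sub>R d b)" if "f \<in> annih (span L) (span L2)" for f
  proof (rule dual_space_eqI)
    show "f \<in> dual_space (span L)" using that annihD by blast
    show "(\<Sum>b\<in>B. f b *\<^sub>R d b) \<in> dual_space (span L)"
      using dV by (intro subspace_sum[OF subspace_dual_space] subspace_scale[OF subspace_dual_space])
    fix x assume x: "x \<in> span L"
    have BV: "b \<in> span L" if "b \<in> B" for b using BL1[OF that] L1_subset span_base by blast
    have "f x = f (\<Sum>b\<in>B. representation B (pr1 x) b *\<^sub>R b)"
      using annih_pr1[OF that x] sum_representation_finite[OF B(1,2) sp] by simp
    also have "\<dots> = (\<Sum>b\<in>B. representation B (pr1 x) b * f b)"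
      using BV by (subst dual_space_sum[OF annihD(1)[OF that]])
        (auto intro!: sum.cong span_scale simp: dual_space_scale[OF annihD(1)[OF that]])
    also have "\<dots> = (\<Sum>b\<in>B. f b *\<^sub>R d b) x"
      using x by (simp add: sum_fun_apply scaleR_fun_def d_def mult.commute)
    finally show "f x = (\<Sum>b\<in>B. f b *\<^sub>R d b) x" .
  qed
  show ?thesis
    using that[OF B, of d] dV dint d0 dc f by (simp add: annih_lattice_def dual_lattice_def)
qed

lemma add_subgroup_annih_lattice: "add_subgroup (annih_lattice L L2)"
proof -
  have "0 \<in> annih_lattice L L2"
    using subspace_0[OF subspace_dual_space]
    by (auto simp: annih_lattice_def dual_lattice_def)
  moreover have "f - g \<in> annih_lattice L L2"
    if "f \<in> annih_lattice L L2" "g \<in> annih_lattice L L2" for f g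
    using that subspace_diff[OF subspace_dual_space, of f "span L" g]
    by (auto simp: annih_lattice_def dual_lattice_def)
  ultimately show ?thesis by (simp add: add_subgroup_def)
qed

lemma annih_lattice_basis:
  obtains B D where "finite B" "independent B" "L1 = group_closure B"
    "finite D" "independent D" "annih_lattice L L2 = group_closure D"
    "annih (span L) (span L2) = span D" "card D = card B"
proof -
  obtain B d where B: "finite B" "independent B" "L1 = group_closure B"
    and d: "\<And>b. b \<in> B \<Longrightarrow> d b \<in> annih_lattice L L2"
    and f: "\<And>f. f \<in> annih (span L) (span L2) \<Longrightarrow> f = (\<Sum>b\<in>B. f b *\<^sub>R d b)"
    and dc: "\<And>b c. b \<in> B \<Longrightarrow> c \<in> B \<Longrightarrow> d b c = (if c = b then 1 else 0)"
    by (rule dual_basis) (rule that)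
  have inj: "inj_on d B"
  proof (rule inj_onI)
    fix b c assume "b \<in> B" "c \<in> B" "d b = d c"
    then show "b = c" using dc[of b b] dc[of c b] by (metis zero_neq_one)
  qed
  have ind: "independent (d ` B)"
  proof (rule real_vector.independent_if_scalars_zero)
    show "finite (d ` B)" using B by simp
    fix g x assume s: "(\<Sum>x\<in>d ` B. g x *\<^sub>R x) = 0" and x: "x \<in> d ` B"
    from x obtain c where c: "c \<in> B" "x = d c" by blast
    have "0 = (\<Sum>b\<in>B. g (d b) *\<^sub>R d b) c"
      using s by (simp add: sum.reindex[OF inj])
    also have "\<dots> = (\<Sum>b\<in>B. if b = c then g (d b) else 0)"
      using dc c by (simp add: sum_fun_apply scaleR_fun_def) (auto intro!: sum.cong)
    finally show "g x = 0" using c B by simp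
  qed
  have sub: "d ` B \<subseteq> annih_lattice L L2" using d by blast
  have "span (d ` B) \<subseteq> annih (span L) (span L2)"
    using sub annih_lattice_subset subspace_annih by (intro span_minimal) auto
  moreover have "annih (span L) (span L2) \<subseteq> span (d ` B)"
  proof
    fix f assume "f \<in> annih (span L) (span L2)"
    then have "f = (\<Sum>b\<in>B. f b *\<^sub>R d b)" by (rule f)
    also have "\<dots> \<in> span (d ` B)" by (intro span_sum span_scale span_base) auto
    finally show "f \<in> span (d ` B)" .
  qed
  moreover have "group_closure (d ` B) \<subseteq> annih_lattice L L2"
    using sub add_subgroup_annih_lattice by (intro group_closure_least)
  moreover have "annih_lattice L L2 \<subseteq> group_closure (d ` B)"
  proof
    fix g assume g: "g \<in> annih_lattice L L2"
    have int: "g b \<in> \<int>" if "b \<in> B" for b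
      using g that L1_subset B(3) group_closure.base[of b B]
      by (auto simp: annih_lattice_def dual_lattice_def)
    have "g = (\<Sum>b\<in>B. g b *\<^sub>R d b)" using g annih_lattice_subset f by blast
    also have "\<dots> \<in> group_closure (d ` B)"
      using int by (intro add_subgroup_sum add_subgroup_scale_Ints add_subgroup_group_closure)
        (auto intro: group_closure.base)
    finally show "g \<in> group_closure (d ` B)" .
  qed
  ultimately show ?thesis
    using that[OF B, of "d ` B"] B ind inj by (simp add: card_image subset_antisym)
qed

lemma is_lattice_annih_lattice: "is_lattice (annih_lattice L L2)"
  using annih_lattice_basis is_lattice_def by metis

lemma span_annih_lattice: "span (annih_lattice L L2) = annih (span L) (span L2)"
  using annih_lattice_basis span_group_closure by metis

lemma annih_separates:
  assumes "x \<in> span L1" "\<And>f. f \<in> annih (span L) (span L2) \<Longrightarrow> f x = 0"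
  shows "x = 0"
proof -
  obtain B d where B: "finite B" "independent B" "L1 = group_closure B"
    and d: "\<And>b. b \<in> B \<Longrightarrow> d b \<in> annih_lattice L L2"
    and dc: "\<And>b c. b \<in> B \<Longrightarrow> c \<in> B \<Longrightarrow> d b c = (if c = b then 1 else 0)"
    using dual_basis by metis
  have "x \<in> span B" using assms(1) B(3) span_group_closure by metis
  then have x: "x = (\<Sum>b\<in>B. representation B x b *\<^sub>R b)"
    using sum_representation_finite[OF B(1,2)] by simp
  have BV: "b \<in> span L" if "b \<in> B" for b
    using that B(3) group_closure.base[of b B] L1_subset span_base by blast
  have "representation B x c = 0" if c: "c \<in> B" for c
  proof -
    have dV: "d c \<in> dual_space (span L)" using d[OF c] annih_lattice_subset annihD by blast
    have "0 = d c (\<Sum>b\<in>B. representation B x b *\<^sub>R b)"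
      using assms(2)[of "d c"] d[OF c] annih_lattice_subset x by auto
    also have "\<dots> = (\<Sum>b\<in>B. representation B x b * d c b)"
      using BV by (subst dual_space_sum[OF dV]) (auto intro!: sum.cong span_scale simp: dual_space_scale[OF dV])
    also have "\<dots> = (\<Sum>b\<in>B. if b = c then representation B x b else 0)"
      using dc c by (intro sum.cong) auto
    finally show ?thesis using B c by simp
  qed
  then show ?thesis using x by simp
qed

text \<open>
  Reflexivity of \<open>L1\<close>: the coordinates of \<open>u\<close> are the values of \<open>F\<close> on a dual basis.
\<close>

lemma annih_reflexive:
  assumes F: "linear_on (annih (span L) (span L2)) UNIV F"
    and int: "\<And>f. f \<in> annih_lattice L L2 \<Longrightarrow> F f \<in> (\<int> :: real set)"
  shows "\<exists>u\<in>L1. \<forall>f\<in>annih (span L) (span L2). F f = f u"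
proof -
  obtain B d where B: "finite B" "independent B" "L1 = group_closure B"
    and d: "\<And>b. b \<in> B \<Longrightarrow> d b \<in> annih_lattice L L2"
    and f: "\<And>f. f \<in> annih (span L) (span L2) \<Longrightarrow> f = (\<Sum>b\<in>B. f b *\<^sub>R d b)"
    using dual_basis by metis
  define u where "u = (\<Sum>b\<in>B. F (d b) *\<^sub>R b)"
  have "u \<in> group_closure B"
    unfolding u_def using int d
    by (intro add_subgroup_sum add_subgroup_scale_Ints add_subgroup_group_closure)
      (auto intro: group_closure.base)
  moreover have "F g = g u" if g: "g \<in> annih (span L) (span L2)" for g
  proof -
    have BV: "b \<in> span L" if "b \<in> B" for b
      using that B(3) group_closure.base[of b B] L1_subset span_base by blast
    have dA: "d b \<in> annih (span L) (span L2)" if "b \<in> B" for b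
      using d[OF that] annih_lattice_subset by blast
    have F0: "F 0 = 0"
      using linear_on_scale[OF F subspace_0[OF subspace_annih], of 0] by simp
    have Fsum: "F (\<Sum>b\<in>C. k b *\<^sub>R d b) = (\<Sum>b\<in>C. k b * F (d b))" if "C \<subseteq> B" for C k
      using finite_subset[OF that B(1)] that
    proof (induction C rule: finite_induct)
      case (insert c C)
      have "(\<Sum>b\<in>C. k b *\<^sub>R d b) \<in> annih (span L) (span L2)"
        using insert dA by (intro subspace_sum[OF subspace_annih] subspace_scale[OF subspace_annih]) auto
      moreover have "k c *\<^sub>R d c \<in> annih (span L) (span L2)"
        using insert dA by (intro subspace_scale[OF subspace_annih]) auto
      ultimately have "F (k c *\<^sub>R d c + (\<Sum>b\<in>C. k b *\<^sub>R d b)) =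
          F (k c *\<^sub>R d c) + F (\<Sum>b\<in>C. k b *\<^sub>R d b)"
        by (intro linear_on_add[OF F])
      moreover have "F (k c *\<^sub>R d c) = k c * F (d c)"
        using insert dA[of c] linear_on_scale[OF F, of "d c" "k c"] by simp
      moreover have "(\<Sum>b\<in>insert c C. k b *\<^sub>R d b) = k c *\<^sub>R d c + (\<Sum>b\<in>C. k b *\<^sub>R d b)"
        using insert by (intro sum.insert)
      moreover have "(\<Sum>b\<in>insert c C. k b * F (d b)) = k c * F (d c) + (\<Sum>b\<in>C. k b * F (d b))"
        using insert by (intro sum.insert)
      moreover have "F (\<Sum>b\<in>C. k b *\<^sub>R d b) = (\<Sum>b\<in>C. k b * F (d b))"
        using insert by simp
      ultimately show ?case by (simp only:)
    qed (use F0 in simp)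
    have "F g = F (\<Sum>b\<in>B. g b *\<^sub>R d b)" using f[OF g] by simp
    also have "\<dots> = (\<Sum>b\<in>B. g b * F (d b))" by (rule Fsum) simp
    also have "\<dots> = g u"
      unfolding u_def using BV
      by (subst dual_space_sum[OF annihD(1)[OF g]])
        (auto intro!: sum.cong span_scale simp: dual_space_scale[OF annihD(1)[OF g]])
    finally show ?thesis .
  qed
  ultimately show ?thesis using B(3) by blast
qed

end

text \<open>
  The splitting with trivial second summand makes the statements above available for the full
  dual of a lattice.
\<close>

lemma split_lattice_trivial: "is_lattice L \<Longrightarrow> split_lattice L L {0}"
  using is_lattice_add_subgroup[of L]
  by unfold_locales (auto simp: add_subgroup_def)

text \<open>
  Nondegeneracy is injectivity, and the dual lattice has the same rank.
\<close>

lemma nondegenerate_bij_dual: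
  assumes "is_lattice L" "linear_on (span L) (dual_space (span L)) c"
    and "\<And>x. x \<in> span L \<Longrightarrow> (\<And>y. y \<in> span L \<Longrightarrow> c x y = 0) \<Longrightarrow> x = 0"
  shows "bij_betw c (span L) (dual_space (span L))"
proof -
  interpret split_lattice L L "{0}" using split_lattice_trivial[OF assms(1)] .
  have ann: "annih (span L) (span {0}) = dual_space (span L)"
    using dual_space_zero by (auto simp: annih_def)
  obtain B D where B: "finite B" "independent B" "L = group_closure B"
    and D: "finite D" "annih (span L) (span {0}) = span D" "card D = card B"
    using annih_lattice_basis by metis
  have sp: "span L = span B" using B(3) span_group_closure by metis
  have sd: "dual_space (span B) = span D" using D(2) ann sp by simp
  have "bij_betw c (span B) (span D)"
  proof (rule injective_linear_on_surj[OF B(1,2) D(1)])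
    show "card D \<le> card B" using D(3) by simp
    show "linear_on (span B) (span D) c" using assms(2) by (simp add: sp sd)
    fix x assume x: "x \<in> span B" "c x = 0"
    show "x = 0"
      by (rule assms(3)) (use x sp in simp_all)
  qed
  then show ?thesis by (simp add: sp sd)
qed

section \<open>A perturbation bound\<close>

text \<open>
  Let \<open>S = N + \<Sum> t\<^sub>i R\<^sub>i\<close> with bounded coefficients \<open>t\<^sub>i\<close>. If \<open>v + S\<^sup>2 v = 0\<close>, then
  \<open>N\<^sup>2 |v| \<le> (1 + 2 N K + K\<^sup>2) |v|\<close> with \<open>K\<close> independent of \<open>N\<close>, and so \<open>v = 0\<close> when \<open>N\<close> is large.
\<close>

lemma one_plus_square_injective:
  fixes R :: "'i \<Rightarrow> 'a::real_vector \<Rightarrow> 'a"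
  assumes C: "finite C" "independent C" and I: "finite I"
    and R: "\<And>i. i \<in> I \<Longrightarrow> linear_on (span C) (span C) (R i)"
  shows "\<exists>N::nat. \<forall>t v w. (\<forall>i\<in>I. \<bar>t i\<bar> \<le> 1) \<longrightarrow> v \<in> span C \<longrightarrow>
    w = of_nat N *\<^sub>R v + (\<Sum>i\<in>I. t i *\<^sub>R R i v) \<longrightarrow>
    v + (of_nat N *\<^sub>R w + (\<Sum>i\<in>I. t i *\<^sub>R R i w)) = 0 \<longrightarrow> v = 0"
proof -
  define nrm where "nrm v = (\<Sum>b\<in>C. \<bar>representation C v b\<bar>)" for v
  have nrm_ge: "nrm v \<ge> 0" for v by (simp add: nrm_def sum_nonneg)
  have nrm_add: "nrm (x + y) \<le> nrm x + nrm y" if "x \<in> span C" "y \<in> span C" for x y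
    using that by (auto simp: nrm_def real_vector.representation_add[OF C(2)] sum.distrib[symmetric]
        intro!: sum_mono abs_triangle_ineq)
  have nrm_scale: "nrm (r *\<^sub>R x) = \<bar>r\<bar> * nrm x" if "x \<in> span C" for r x
    using that by (simp add: nrm_def real_vector.representation_scale[OF C(2)] abs_mult sum_distrib_left)
  have nrm_0: "nrm 0 = 0" by (simp add: nrm_def real_vector.representation_zero)
  have nrm_eq: "v = 0" if "v \<in> span C" "nrm v = 0" for v
  proof -
    have "representation C v b = 0" if "b \<in> C" for b
      using \<open>nrm v = 0\<close> C(1) that by (simp add: nrm_def sum_nonneg_eq_0_iff)
    then show ?thesis using sum_representation_finite[OF C that(1)] by simp
  qed
  have nrm_sum: "nrm (\<Sum>i\<in>F. f i) \<le> (\<Sum>i\<in>F. nrm (f i))" if "\<And>i. i \<in> F \<Longrightarrow> f i \<in> span C" for F and f :: "'j \<Rightarrow> 'a"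
    using that
  proof (induction F rule: infinite_finite_induct)
    case (insert x F)
    have "(\<Sum>i\<in>F. f i) \<in> span C" using insert by (intro span_sum) auto
    then show ?case using insert nrm_add[of "f x" "\<Sum>i\<in>F. f i"] by auto
  qed (auto simp: nrm_0)
  have bound: "\<exists>k\<ge>0. \<forall>v\<in>span C. nrm (R i v) \<le> k * nrm v" if i: "i \<in> I" for i
  proof -
    obtain g where g: "linear g" "\<And>x. x \<in> span C \<Longrightarrow> g x = R i x"
      using linear_on_span_extension[OF C R[OF i]] by blast
    have gC: "g b \<in> span C" if "b \<in> C" for b
      using linear_on_mem[OF R[OF i]] g span_base that by fastforce
    define k where "k = (\<Sum>b\<in>C. nrm (g b))"
    have k0: "k \<ge> 0" by (simp add: k_def sum_nonneg nrm_ge)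
    have "nrm (R i v) \<le> k * nrm v" if v: "v \<in> span C" for v
    proof -
      have "R i v = g (\<Sum>b\<in>C. representation C v b *\<^sub>R b)"
        using g v sum_representation_finite[OF C v] by simp
      also have "\<dots> = (\<Sum>b\<in>C. representation C v b *\<^sub>R g b)"
        by (simp add: linear_sum[OF g(1)] linear_scale[OF g(1)])
      finally have "nrm (R i v) \<le> (\<Sum>b\<in>C. nrm (representation C v b *\<^sub>R g b))"
        using nrm_sum[of C "\<lambda>b. representation C v b *\<^sub>R g b"] gC span_scale by auto
      also have "\<dots> = (\<Sum>b\<in>C. \<bar>representation C v b\<bar> * nrm (g b))"
        using gC by (intro sum.cong) (auto simp: nrm_scale)
      also have "\<dots> \<le> (\<Sum>b\<in>C. \<bar>representation C v b\<bar> * k)"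
      proof (intro sum_mono mult_left_mono)
        fix b assume "b \<in> C"
        then show "nrm (g b) \<le> k"
          unfolding k_def using C(1) by (intro member_le_sum) (auto simp: nrm_ge)
      qed auto
      also have "\<dots> = k * nrm v" by (simp add: nrm_def sum_distrib_left mult.commute)
      finally show ?thesis .
    qed
    with k0 show ?thesis by blast
  qed
  then obtain k where k: "\<And>i. i \<in> I \<Longrightarrow> k i \<ge> 0"
    "\<And>i v. i \<in> I \<Longrightarrow> v \<in> span C \<Longrightarrow> nrm (R i v) \<le> k i * nrm v"
    by metis
  define K where "K = (\<Sum>i\<in>I. k i)"
  have K0: "K \<ge> 0" using k by (simp add: K_def sum_nonneg)
  define N where "N = nat \<lceil>2 * K + K\<^sup>2 + 2\<rceil>"
  have N: "real N \<ge> 2 * K + K\<^sup>2 + 2" by (simp add: N_def) linarith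
  have "v = 0" if t: "\<And>i. i \<in> I \<Longrightarrow> \<bar>t i\<bar> \<le> 1" and v: "v \<in> span C"
    and w: "w = of_nat N *\<^sub>R v + (\<Sum>i\<in>I. t i *\<^sub>R R i v)"
    and eq: "v + (of_nat N *\<^sub>R w + (\<Sum>i\<in>I. t i *\<^sub>R R i w)) = 0" for t v w
  proof -
    define T where "T x = (\<Sum>i\<in>I. t i *\<^sub>R R i x)" for x
    have Tmem: "T x \<in> span C" if "x \<in> span C" for x
      unfolding T_def using linear_on_mem[OF R] that by (intro span_sum span_scale) auto
    have Tlin: "T (a *\<^sub>R x + y) = a *\<^sub>R T x + T y" if "x \<in> span C" "y \<in> span C" for a x y
      unfolding T_def using that
      by (simp add: linear_on_add[OF R] linear_on_scale[OF R] span_scale sum.distrib[symmetric]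
          scaleR_sum_right algebra_simps)
    have Tb: "nrm (T x) \<le> K * nrm x" if x: "x \<in> span C" for x
    proof -
      have "nrm (T x) \<le> (\<Sum>i\<in>I. nrm (t i *\<^sub>R R i x))"
        unfolding T_def using linear_on_mem[OF R x] by (intro nrm_sum span_scale) auto
      also have "\<dots> = (\<Sum>i\<in>I. \<bar>t i\<bar> * nrm (R i x))"
        using linear_on_mem[OF R x] by (intro sum.cong) (auto simp: nrm_scale)
      also have "\<dots> \<le> (\<Sum>i\<in>I. 1 * (k i * nrm x))"
        using t k(2)[OF _ x] by (intro sum_mono mult_mono) (auto simp: nrm_ge)
      also have "\<dots> = K * nrm x" by (simp add: K_def sum_distrib_right)
      finally show ?thesis .
    qed
    have Tv: "T v \<in> span C" "T (T v) \<in> span C" using Tmem v by auto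
    have "of_nat N *\<^sub>R w + T w = (real N)\<^sup>2 *\<^sub>R v + (2 * real N) *\<^sub>R T v + T (T v)"
      using Tlin[OF v Tv(1), of "real N"] w
      by (simp add: T_def[symmetric] algebra_simps power2_eq_square scaleR_2[symmetric])
    then have "(real N)\<^sup>2 *\<^sub>R v = - 1 *\<^sub>R (v + ((2 * real N) *\<^sub>R T v + T (T v)))"
      using eq by (simp add: T_def[symmetric] algebra_simps eq_neg_iff_add_eq_0)
    then have "nrm ((real N)\<^sup>2 *\<^sub>R v) = nrm (- 1 *\<^sub>R (v + ((2 * real N) *\<^sub>R T v + T (T v))))"
      by simp
    also have "\<dots> = nrm (v + ((2 * real N) *\<^sub>R T v + T (T v)))"
      using v Tv by (subst nrm_scale) (auto intro!: span_add span_scale)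
    also have "\<dots> \<le> nrm v + nrm ((2 * real N) *\<^sub>R T v + T (T v))"
      using v Tv by (intro nrm_add) (auto intro!: span_add span_scale)
    also have "\<dots> \<le> nrm v + (nrm ((2 * real N) *\<^sub>R T v) + nrm (T (T v)))"
      using v Tv by (intro add_left_mono nrm_add) (auto intro!: span_add span_scale)
    also have "\<dots> \<le> nrm v + (2 * real N * (K * nrm v) + K * (K * nrm v))"
    proof (intro add_left_mono add_mono)
      show "nrm ((2 * real N) *\<^sub>R T v) \<le> 2 * real N * (K * nrm v)"
        using nrm_scale[OF Tv(1)] Tb[OF v] by (simp add: mult_left_mono)
      show "nrm (T (T v)) \<le> K * (K * nrm v)"
        using Tb[OF Tv(1)] mult_left_mono[OF Tb[OF v] K0] by linarith
    qed
    finally have le: "(real N)\<^sup>2 * nrm v \<le> (1 + 2 * real N * K + K\<^sup>2) * nrm v"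
      using v by (simp add: nrm_scale algebra_simps power2_eq_square)
    have "real N * (2 * K + K\<^sup>2 + 2) \<le> real N * real N"
      using N by (intro mult_left_mono) auto
    moreover have "K\<^sup>2 + 2 \<le> real N * (K\<^sup>2 + 2)"
    proof -
      have "1 \<le> real N" using N K0 zero_le_power2[of K] by linarith
      from mult_right_mono[OF this, of "K\<^sup>2 + 2"] show ?thesis by simp
    qed
    ultimately have "1 + 2 * real N * K + K\<^sup>2 < (real N)\<^sup>2"
      by (simp add: power2_eq_square algebra_simps)
    then have "nrm v = 0"
      using le nrm_ge[of v] by (metis linorder_not_less mult_less_cancel_right_disj order_antisym_conv)
    then show "v = 0" by (rule nrm_eq[OF v])
  qed
  then show ?thesis by (intro exI[of _ N] allI impI) blast
qed

section \<open>Real forms and the operator of a weak pair\<close>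

text \<open>
  The conditions that define \<open>NS\<close>, apart from integrality. They are linear and so survive in the
  real span.
\<close>

definition real_forms :: "'a::real_vector torus \<Rightarrow> ('a \<Rightarrow> 'a \<Rightarrow> real) set" where
  "real_forms A = {c. linear_on (VS A) (dual_space (VS A)) c \<and> (\<forall>v. v \<notin> VS A \<longrightarrow> c v = 0) \<and>
     (\<forall>v\<in>VS A. \<forall>w\<in>VS A. c v w = - c w v) \<and>
     (\<forall>v\<in>VS A. \<forall>w\<in>VS A. c (Cpx A v) (Cpx A w) = c v w)}"

lemma NS_eq: "NS A = {c \<in> real_forms A. \<forall>v\<in>Lat A. \<forall>w\<in>Lat A. c v w \<in> \<int>}"
  unfolding NS_def real_forms_def by (intro equalityI subsetI; elim CollectE conjE; intro CollectI conjI; assumption)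

lemma real_formsD:
  assumes "c \<in> real_forms A"
  shows "linear_on (VS A) (dual_space (VS A)) c" "\<forall>v. v \<notin> VS A \<longrightarrow> c v = 0"
    "\<forall>v\<in>VS A. \<forall>w\<in>VS A. c v w = - c w v"
    "\<forall>v\<in>VS A. \<forall>w\<in>VS A. c (Cpx A v) (Cpx A w) = c v w"
  using assms unfolding real_forms_def by blast+

lemma real_formsI:
  assumes "\<And>v. v \<in> VS A \<Longrightarrow> c v \<in> dual_space (VS A)"
    and "\<And>v w. v \<in> VS A \<Longrightarrow> w \<in> VS A \<Longrightarrow> c (v + w) = c v + c w"
    and "\<And>r v. v \<in> VS A \<Longrightarrow> c (r *\<^sub>R v) = r *\<^sub>R c v"
    and "\<And>v. v \<notin> VS A \<Longrightarrow> c v = 0"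
    and "\<And>v w. v \<in> VS A \<Longrightarrow> w \<in> VS A \<Longrightarrow> c v w = - c w v"
    and "\<And>v w. v \<in> VS A \<Longrightarrow> w \<in> VS A \<Longrightarrow> c (Cpx A v) (Cpx A w) = c v w"
  shows "c \<in> real_forms A"
  unfolding real_forms_def
  by (intro CollectI conjI ballI allI impI linear_onI) (fact assms)+

lemma scaleR_fun_apply: "(r *\<^sub>R f) x = r *\<^sub>R f x"
  by (simp add: scaleR_fun_def)

lemma form_mem: "c \<in> real_forms A \<Longrightarrow> v \<in> VS A \<Longrightarrow> c v \<in> dual_space (VS A)"
  by (rule linear_on_mem[OF real_formsD(1)])

lemma form_add: "c \<in> real_forms A \<Longrightarrow> v \<in> VS A \<Longrightarrow> w \<in> VS A \<Longrightarrow> c (v + w) = c v + c w"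
  by (rule linear_on_add[OF real_formsD(1)])

lemma form_scale: "c \<in> real_forms A \<Longrightarrow> v \<in> VS A \<Longrightarrow> c (r *\<^sub>R v) = r *\<^sub>R c v"
  by (rule linear_on_scale[OF real_formsD(1)])

lemma form_minus: "c \<in> real_forms A \<Longrightarrow> v \<in> VS A \<Longrightarrow> c (- v) = - c v"
  using form_scale[of c A v "- 1"] by simp

lemma form_diff: "c \<in> real_forms A \<Longrightarrow> v \<in> VS A \<Longrightarrow> w \<in> VS A \<Longrightarrow> c (v - w) = c v - c w"
  using form_add[of c A v "- w"] form_minus[of c A w] span_neg[of w "Lat A"]
  by (simp add: VS_def)

lemma form_0: "c \<in> real_forms A \<Longrightarrow> c 0 = 0"
  using form_scale[of c A 0 0] by (simp add: VS_def span_zero)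

lemma form_outside: "c \<in> real_forms A \<Longrightarrow> v \<notin> VS A \<Longrightarrow> c v = 0"
  by (rule real_formsD(2)[rule_format])

lemma form_add2: "c \<in> real_forms A \<Longrightarrow> x \<in> VS A \<Longrightarrow> v \<in> VS A \<Longrightarrow> w \<in> VS A \<Longrightarrow> c x (v + w) = c x v + c x w"
  by (rule dual_space_add[OF form_mem])

lemma form_minus2: "c \<in> real_forms A \<Longrightarrow> x \<in> VS A \<Longrightarrow> v \<in> VS A \<Longrightarrow> c x (- v) = - c x v"
  by (rule dual_space_minus[OF form_mem])

lemma form_skew: "c \<in> real_forms A \<Longrightarrow> v \<in> VS A \<Longrightarrow> w \<in> VS A \<Longrightarrow> c v w = - c w v"
  by (rule real_formsD(3)[rule_format])

lemma form_J: "c \<in> real_forms A \<Longrightarrow> v \<in> VS A \<Longrightarrow> w \<in> VS A \<Longrightarrow> c (Cpx A v) (Cpx A w) = c v w"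
  by (rule real_formsD(4)[rule_format])

lemma subspace_real_forms: "subspace (real_forms A)"
proof (rule subspaceI)
  show "0 \<in> real_forms A"
    using subspace_0[OF subspace_dual_space]
    by (intro real_formsI) (auto simp: fun_eq_iff scaleR_fun_apply)
next
  fix c d assume c: "c \<in> real_forms A" and d: "d \<in> real_forms A"
  show "c + d \<in> real_forms A"
  proof (rule real_formsI)
    fix v w assume "v \<in> VS A" "w \<in> VS A"
    with form_skew[OF c this] form_skew[OF d this] show "(c + d) v w = - (c + d) w v" by simp
  qed (use c d in \<open>simp_all add: fun_eq_iff form_add form_scale form_J form_outside scaleR_right_distrib
      form_mem subspace_add[OF subspace_dual_space]\<close>)
next
  fix r c assume c: "c \<in> real_forms A"
  show "r *\<^sub>R c \<in> real_forms A"
  proof (rule real_formsI)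
    fix v w assume "v \<in> VS A" "w \<in> VS A"
    with form_skew[OF c this] show "(r *\<^sub>R c) v w = - (r *\<^sub>R c) w v"
      by (simp add: scaleR_fun_apply)
  next
    fix v w assume vw: "v \<in> VS A" "w \<in> VS A"
    then show "(r *\<^sub>R c) (v + w) = (r *\<^sub>R c) v + (r *\<^sub>R c) w"
      by (simp only: scaleR_fun_apply form_add[OF c] scaleR_right_distrib)
  next
    fix s v assume v: "v \<in> VS A"
    then show "(r *\<^sub>R c) (s *\<^sub>R v) = s *\<^sub>R (r *\<^sub>R c) v"
      by (simp only: scaleR_fun_apply form_scale[OF c] scaleR_left_commute)
  next
    fix v assume "v \<in> VS A"
    then show "(r *\<^sub>R c) v \<in> dual_space (VS A)"
      by (simp only: scaleR_fun_apply form_mem[OF c] subspace_scale[OF subspace_dual_space])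
  next
    fix v assume v: "v \<notin> VS A"
    have "(r *\<^sub>R c) v = r *\<^sub>R c v" by (rule scaleR_fun_apply)
    also have "\<dots> = r *\<^sub>R 0" by (rule arg_cong[OF form_outside[OF c v]])
    also have "\<dots> = 0" by (rule scaleR_zero_right)
    finally show "(r *\<^sub>R c) v = 0" .
  next
    fix v w assume "v \<in> VS A" "w \<in> VS A"
    then show "(r *\<^sub>R c) (Cpx A v) (Cpx A w) = (r *\<^sub>R c) v w"
      by (simp only: scaleR_fun_apply form_J[OF c])
  qed
qed

lemma NS_real_subset: "NS_real A \<subseteq> real_forms A"
  unfolding NS_real_def by (intro span_minimal subspace_real_forms) (auto simp: NS_eq)

lemma form_sum:
  assumes c: "c \<in> real_forms A" and g: "\<And>i. i \<in> I \<Longrightarrow> g i \<in> VS A"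
  shows "c (\<Sum>i\<in>I. g i) = (\<Sum>i\<in>I. c (g i))"
  using g
proof (induction I rule: infinite_finite_induct)
  case (insert i I)
  have "(\<Sum>i\<in>I. g i) \<in> VS A" unfolding VS_def
    using insert by (intro span_sum) (auto simp: VS_def)
  then have "c (g i + (\<Sum>i\<in>I. g i)) = c (g i) + c (\<Sum>i\<in>I. g i)"
    using insert by (intro form_add[OF c]) auto
  moreover have "c (\<Sum>i\<in>I. g i) = (\<Sum>i\<in>I. c (g i))" using insert by blast
  moreover have "(\<Sum>i\<in>insert i I. g i) = g i + (\<Sum>i\<in>I. g i)"
    and "(\<Sum>i\<in>insert i I. c (g i)) = c (g i) + (\<Sum>i\<in>I. c (g i))"
    by (rule sum.insert[OF insert(1,2)])+
  ultimately show ?case by (simp only:)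
qed (simp_all add: form_0[OF c])

text \<open>
  Isotropy of a lattice passes to its real span, one argument at a time.
\<close>

lemma form_vanish_span:
  assumes c: "c \<in> real_forms A" and M: "M \<subseteq> VS A" "\<And>v w. v \<in> M \<Longrightarrow> w \<in> M \<Longrightarrow> c v w = 0"
    and v: "v \<in> span M" and w: "w \<in> span M"
  shows "c v w = 0"
proof -
  have sub: "subspace (VS A)" by (simp add: VS_def subspace_span)
  have sM: "span M \<subseteq> VS A" using M(1) sub by (rule span_minimal)
  have MV: "x \<in> VS A" if "x \<in> M" for x using M(1) that by blast
  have vV: "v \<in> VS A" using sM v by blast
  have 1: "c x v = 0" if "x \<in> M" for x
    by (rule dual_space_vanish_span[OF form_mem[OF c MV[OF that]] sub M(1) _ v]) (rule M(2)[OF that])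
  show ?thesis
  proof (rule dual_space_vanish_span[OF form_mem[OF c vV] sub M(1) _ w])
    fix y assume y: "y \<in> M"
    show "c v y = 0" unfolding form_skew[OF c vV MV[OF y]] 1[OF y] by simp
  qed
qed

lemma weak_pair_forms:
  assumes "weak_pair T \<theta>"
  shows "re_form \<theta> \<in> real_forms T" "im_form \<theta> \<in> real_forms T"
    "bij_betw (im_form \<theta>) (VS T) (dual_space (VS T))"
proof -
  have th: "\<theta> \<in> NS_complex0 T" and T: "is_lattice (Lat T)"
    using assms by (auto simp: weak_pair_def complex_torus_def)
  show "re_form \<theta> \<in> real_forms T" and im: "im_form \<theta> \<in> real_forms T"
    using th NS_real_subset by (auto simp: NS_complex0_def NS_real0_def)
  show "bij_betw (im_form \<theta>) (VS T) (dual_space (VS T))"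
    unfolding VS_def
  proof (rule nondegenerate_bij_dual[OF T])
    show "linear_on (span (Lat T)) (dual_space (span (Lat T))) (im_form \<theta>)"
      using real_formsD(1)[OF im] by (simp add: VS_def)
    fix x assume "x \<in> span (Lat T)" "\<And>y. y \<in> span (Lat T) \<Longrightarrow> im_form \<theta> x y = 0"
    then show "x = 0"
      using th by (auto simp: NS_complex0_def NS_real0_def VS_def)
  qed
qed

text \<open>
  In these terms \<open>I\<^sub>\<omega>\<close> maps \<open>(v, f)\<close> to the pair \<open>(a, b)\<close> with
  \<open>(\<phi>\<^sub>1 + i \<phi>\<^sub>2) (v + i a) = f + i b\<close>, which avoids the inverse of \<open>\<phi>\<^sub>2\<close>.
\<close>

lemma I_op_eqI:
  assumes wp: "weak_pair T \<theta>" and v: "v \<in> VS T" and f: "f \<in> dual_space (VS T)" and a: "a \<in> VS T"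
    and im: "im_form \<theta> a = re_form \<theta> v - f" and b: "b = im_form \<theta> v + re_form \<theta> a"
  shows "I_op T \<theta> (v, f) = (a, b)"
proof -
  note forms = weak_pair_forms[OF wp]
  let ?p = "re_form \<theta>" and ?q = "im_form \<theta>" and ?inv = "inv_into (VS T) (im_form \<theta>)"
  have inv: "?inv g \<in> VS T" "?q (?inv g) = g" if "g \<in> dual_space (VS T)" for g
    using that forms(3) bij_betw_imp_surj_on[OF forms(3)] by (auto intro: inv_into_into f_inv_into_f)
  have pv: "?p v \<in> dual_space (VS T)" using form_mem[OF forms(1) v] .
  have mem: "?inv (?p v) - ?inv f \<in> VS T"
    using inv(1)[OF pv] inv(1)[OF f] by (simp add: VS_def span_diff)
  have "?q (?inv (?p v) - ?inv f) = ?q a"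
    using inv[OF pv] inv[OF f] im by (simp only: form_diff[OF forms(2)])
  then have eq: "?inv (?p v) - ?inv f = a"
    using mem a forms(3) by (auto simp: bij_betw_def inj_on_def)
  have "?p (?inv (?p v)) - ?p (?inv f) = ?p a"
    using form_diff[OF forms(1) inv(1)[OF pv] inv(1)[OF f]] eq by simp
  then have "?q v + ?p (?inv (?p v)) - ?p (?inv f) = ?q v + ?p a"
    by (simp only: add_diff_eq[symmetric])
  then show ?thesis unfolding I_op_def Let_def prod.case b eq by (simp only: eq)
qed

lemma I_op_obtain:
  assumes wp: "weak_pair T \<theta>" and v: "v \<in> VS T" and f: "f \<in> dual_space (VS T)"
  obtains a b where "I_op T \<theta> (v, f) = (a, b)" "a \<in> VS T" "b \<in> dual_space (VS T)"
    "im_form \<theta> a = re_form \<theta> v - f" "b = im_form \<theta> v + re_form \<theta> a"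
proof -
  note forms = weak_pair_forms[OF wp]
  have "re_form \<theta> v - f \<in> dual_space (VS T)"
    using form_mem[OF forms(1) v] f subspace_dual_space by (intro subspace_diff)
  then obtain a where a: "a \<in> VS T" "im_form \<theta> a = re_form \<theta> v - f"
    using forms(3) unfolding bij_betw_def by (metis imageE)
  have "im_form \<theta> v + re_form \<theta> a \<in> dual_space (VS T)"
    using form_mem[OF forms(1) a(1)] form_mem[OF forms(2) v] subspace_dual_space
    by (intro subspace_add)
  with that[OF I_op_eqI[OF wp v f a refl] a(1) _ a(2) refl] show ?thesis .
qed

section \<open>Integral combinations\<close>

text \<open>
  A real combination of elements of a group can be rewritten with coefficients that are linearly
  independent over the integers. An integral linear equation that holds for the combination then
  holds for each group element in it.
\<close>

lemma span_int_independent_combination: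
  assumes G: "add_subgroup G" and c: "c \<in> span G"
  obtains R C where "finite R" "int_independent R" "\<And>r. r \<in> R \<Longrightarrow> C r \<in> G"
    "c = (\<Sum>r\<in>R. r *\<^sub>R C r)"
proof -
  from c obtain S u where S: "finite S" "S \<subseteq> G" "c = (\<Sum>a\<in>S. u a *\<^sub>R a)"
    unfolding real_vector.span_explicit by blast
  obtain R A where R: "finite R" "int_independent R"
    and u: "\<And>a. a \<in> S \<Longrightarrow> u a = (\<Sum>r\<in>R. of_int (A a r) * r)"
    using int_independent_coordinates[OF S(1), of u] by blast
  define C where "C r = (\<Sum>a\<in>S. real_of_int (A a r) *\<^sub>R a)" for r
  have "C r \<in> G" if "r \<in> R" for r
    unfolding C_def using S(2) by (intro add_subgroup_sum[OF G] add_subgroup_scale[OF G]) auto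
  moreover have "c = (\<Sum>r\<in>R. r *\<^sub>R C r)"
  proof -
    have "c = (\<Sum>a\<in>S. \<Sum>r\<in>R. (of_int (A a r) * r) *\<^sub>R a)"
      unfolding S(3) using u by (intro sum.cong) (auto simp: scaleR_sum_left)
    also have "\<dots> = (\<Sum>r\<in>R. \<Sum>a\<in>S. (of_int (A a r) * r) *\<^sub>R a)" by (rule sum.swap)
    also have "\<dots> = (\<Sum>r\<in>R. r *\<^sub>R C r)"
      by (simp add: C_def scaleR_sum_right mult.commute)
    finally show ?thesis .
  qed
  ultimately show ?thesis by (rule that[OF R])
qed

lemma span_common_finite:
  assumes "x \<in> span G" "y \<in> span G"
  obtains S u w where "finite S" "S \<subseteq> G" "x = (\<Sum>a\<in>S. u a *\<^sub>R a)" "y = (\<Sum>a\<in>S. w a *\<^sub>R a)"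
proof -
  obtain S u where S: "finite S" "S \<subseteq> G" "x = (\<Sum>a\<in>S. u a *\<^sub>R a)"
    using assms(1) unfolding real_vector.span_explicit by blast
  obtain T w where T: "finite T" "T \<subseteq> G" "y = (\<Sum>a\<in>T. w a *\<^sub>R a)"
    using assms(2) unfolding real_vector.span_explicit by blast
  have "finite (S \<union> T)" "S \<union> T \<subseteq> G" using S T by auto
  moreover have "x = (\<Sum>a\<in>S \<union> T. (if a \<in> S then u a else 0) *\<^sub>R a)"
    unfolding S(3) using S(1) T(1) by (intro sum.mono_neutral_cong_left) auto
  moreover have "y = (\<Sum>a\<in>S \<union> T. (if a \<in> T then w a else 0) *\<^sub>R a)"
    unfolding T(3) using S(1) T(1) by (intro sum.mono_neutral_cong_left) auto
  ultimately show ?thesis by (rule that)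
qed

lemma add_subgroup_NS: "add_subgroup (NS A)"
  using subspace_diff[OF subspace_real_forms, of _ A] subspace_0[OF subspace_real_forms, of A]
  by (auto simp: NS_eq add_subgroup_def)

section \<open>Products of lattices\<close>

text \<open>
  The bases of the factors, placed in the two coordinates, form a basis of the product.
\<close>

lemma is_lattice_Times:
  fixes L :: "'a::real_vector set" and M :: "'b::real_vector set"
  assumes "is_lattice L" "is_lattice M"
  shows "is_lattice (L \<times> M)"
proof -
  obtain B where B: "finite B" "independent B" "L = group_closure B"
    using assms(1) is_lattice_def by blast
  obtain C where C: "finite C" "independent C" "M = group_closure C"
    using assms(2) is_lattice_def by blast
  define D where "D = (\<lambda>b. (b, 0)) ` B \<union> (\<lambda>c. (0, c)) ` C"
  have inj: "inj_on (\<lambda>b. (b, 0::'b)) B" "inj_on (\<lambda>c. (0::'a, c)) C" by (auto simp: inj_on_def)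
  have 0: "0 \<notin> B" "0 \<notin> C" using B C real_vector.dependent_zero by blast+
  have disj: "(\<lambda>b. (b, 0)) ` B \<inter> (\<lambda>c. (0, c)) ` C = {}" using 0 by auto
  have fin: "finite D" using B C by (simp add: D_def)
  have ind: "independent D"
  proof (rule real_vector.independent_if_scalars_zero[OF fin])
    fix g x assume s: "(\<Sum>x\<in>D. g x *\<^sub>R x) = 0" and x: "x \<in> D"
    have "(\<Sum>x\<in>D. g x *\<^sub>R x) = (\<Sum>b\<in>B. g (b, 0) *\<^sub>R (b, 0)) + (\<Sum>c\<in>C. g (0, c) *\<^sub>R (0, c))"
      unfolding D_def using B C disj
      by (subst sum.union_disjoint) (auto simp: sum.reindex[OF inj(1)] sum.reindex[OF inj(2)])
    also have "\<dots> = (\<Sum>b\<in>B. g (b, 0) *\<^sub>R b, \<Sum>c\<in>C. g (0, c) *\<^sub>R c)"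
      by (simp add: prod_eq_iff fst_sum snd_sum)
    finally have s1: "(\<Sum>b\<in>B. g (b, 0) *\<^sub>R b) = 0" and s2: "(\<Sum>c\<in>C. g (0, c) *\<^sub>R c) = 0"
      using s by (simp_all add: zero_prod_def)
    have "g (b, 0) = 0" if "b \<in> B" for b
      by (rule real_vector.independentD[OF B(2,1) order_refl s1 that])
    moreover have "g (0, c) = 0" if "c \<in> C" for c
      by (rule real_vector.independentD[OF C(2,1) order_refl s2 that])
    ultimately show "g x = 0" using x by (auto simp: D_def)
  qed
  have "group_closure D \<subseteq> L \<times> M"
  proof (rule group_closure_least)
    show "add_subgroup (L \<times> M)"
      using assms[THEN is_lattice_add_subgroup] by (auto simp: add_subgroup_def zero_prod_def)
    show "D \<subseteq> L \<times> M" using B C by (auto simp: D_def intro: group_closure.base)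
  qed
  moreover have "L \<times> M \<subseteq> group_closure D"
  proof
    have l: "(x, 0) \<in> group_closure D" if "x \<in> group_closure B" for x
      using that
    proof induction
      case (base s)
      then show ?case by (intro group_closure.base) (auto simp: D_def zero_prod_def)
    next
      case (diff s t)
      then have "(s, 0) - (t, 0) \<in> group_closure D" by (intro group_closure.diff)
      then show ?case by simp
    qed
    have m: "(0, x) \<in> group_closure D" if "x \<in> group_closure C" for x
      using that
    proof induction
      case (base s)
      then show ?case by (intro group_closure.base) (auto simp: D_def zero_prod_def)
    next
      case (diff s t)
      then have "(0, s) - (0, t) \<in> group_closure D" by (intro group_closure.diff)
      then show ?case by simp
    qed
    fix x assume "x \<in> L \<times> M"
    then have "(fst x, 0) + (0, snd x) \<in> group_closure D"
      using l m B C by (intro group_closure_add) auto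
    then show "x \<in> group_closure D" by simp
  qed
  ultimately show ?thesis using fin ind unfolding is_lattice_def by blast
qed

lemma span_Times:
  fixes S :: "'a::real_vector set" and T :: "'b::real_vector set"
  assumes "0 \<in> S" "0 \<in> T"
  shows "span (S \<times> T) = span S \<times> span T"
proof
  show "span (S \<times> T) \<subseteq> span S \<times> span T"
    by (intro span_minimal subspace_Times subspace_span) (auto intro: span_base)
  have s: "(x, 0) \<in> span (S \<times> T)" if "x \<in> span S" for x
  proof -
    have "linear (\<lambda>x. (x, 0::'b))" by (simp add: linear_iff)
    then have "(\<lambda>x. (x, 0::'b)) ` span S = span ((\<lambda>x. (x, 0)) ` S)"
      by (rule linear_span_image[symmetric])
    also have "\<dots> \<subseteq> span (S \<times> T)" using assms by (intro span_mono) auto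
    finally show ?thesis using that by blast
  qed
  have t: "(0, x) \<in> span (S \<times> T)" if "x \<in> span T" for x
  proof -
    have "linear (\<lambda>x. (0::'a, x))" by (simp add: linear_iff)
    then have "(\<lambda>x. (0::'a, x)) ` span T = span ((\<lambda>x. (0, x)) ` T)"
      by (rule linear_span_image[symmetric])
    also have "\<dots> \<subseteq> span (S \<times> T)" using assms by (intro span_mono) auto
    finally show ?thesis using that by blast
  qed
  show "span S \<times> span T \<subseteq> span (S \<times> T)"
  proof
    fix x assume "x \<in> span S \<times> span T"
    then have "(fst x, 0) + (0, snd x) \<in> span (S \<times> T)"
      using s t by (intro span_add) auto
    then show "x \<in> span (S \<times> T)" by simp
  qed
qed

section \<open>The torus attached to a decomposition\<close>

locale wb_pair =
  fixes A :: "'a::real_vector torus" and \<omega> :: "'a \<Rightarrow> 'a \<Rightarrow> complex" and \<Gamma>1 \<Gamma>2 :: "'a set"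
  assumes weak: "weak_pair A \<omega>" and dec: "wb_decomposition A \<omega> \<Gamma>1 \<Gamma>2"

sublocale wb_pair \<subseteq> split_lattice "Lat A" \<Gamma>1 \<Gamma>2
  using weak dec
  by unfold_locales (auto simp: weak_pair_def complex_torus_def wb_decomposition_def)

context wb_pair
begin

abbreviation "V \<equiv> VS A"
abbreviation "V1 \<equiv> span \<Gamma>1"
abbreviation "V2 \<equiv> span \<Gamma>2"
abbreviation "V1_dual \<equiv> annih V V2"
abbreviation "L1_dual \<equiv> annih_lattice (Lat A) \<Gamma>2"
abbreviation "J \<equiv> Cpx A"
abbreviation "p \<equiv> re_form \<omega>"
abbreviation "q \<equiv> im_form \<omega>"
abbreviation "B \<equiv> B_torus A \<omega> \<Gamma>1 \<Gamma>2"

lemmas V1_V = span1[folded VS_def]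
lemmas V2_V = span2[folded VS_def]
lemmas pr_sum = pr_add[folded VS_def]
lemmas annih_pr1_V = annih_pr1[folded VS_def]
lemmas compose_pr1_V = compose_pr1_annih[folded VS_def]
lemmas L1_dual_subset = annih_lattice_subset[folded VS_def]
lemmas span_L1_dual = span_annih_lattice[folded VS_def]
lemmas V1_separated = annih_separates[folded VS_def]
lemmas V1_reflexive = annih_reflexive[folded VS_def]
lemmas proj_along_V1 = proj_along1[folded VS_def]
lemmas proj_along_V2 = proj_along2[folded VS_def]

lemma Lat_V: "x \<in> Lat A \<Longrightarrow> x \<in> V"
  by (simp add: VS_def span_base)

lemma V_add: "x \<in> V \<Longrightarrow> y \<in> V \<Longrightarrow> x + y \<in> V"
  by (simp add: VS_def span_add)

lemma V_minus: "x \<in> V \<Longrightarrow> - x \<in> V"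
  by (simp add: VS_def span_neg)

lemma V_scale: "x \<in> V \<Longrightarrow> r *\<^sub>R x \<in> V"
  by (simp add: VS_def span_scale)

lemma pr_V: "pr1 x \<in> V" "pr2 x \<in> V"
  using pr1(2) pr2(2) V1_V V2_V by auto

lemma J_on: "linear_on V V J" and J_J: "x \<in> V \<Longrightarrow> J (J x) = - x"
  using weak by (auto simp: weak_pair_def complex_torus_def)

lemma J_mem: "x \<in> V \<Longrightarrow> J x \<in> V"
  by (rule linear_on_mem[OF J_on])

lemma J_add: "x \<in> V \<Longrightarrow> y \<in> V \<Longrightarrow> J (x + y) = J x + J y"
  by (rule linear_on_add[OF J_on])

lemma J_scale: "x \<in> V \<Longrightarrow> J (r *\<^sub>R x) = r *\<^sub>R J x"
  by (rule linear_on_scale[OF J_on])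

lemma J_minus: "x \<in> V \<Longrightarrow> J (- x) = - J x"
  using J_scale[of x "- 1"] by simp

lemma J_diff: "x \<in> V \<Longrightarrow> y \<in> V \<Longrightarrow> J (x - y) = J x - J y"
  using J_add[of x "- y"] J_minus[of y] V_minus[of y] by simp

definition iso_forms :: "('a \<Rightarrow> 'a \<Rightarrow> real) set" where
  "iso_forms = {c \<in> real_forms A. (\<forall>v\<in>V1. \<forall>w\<in>V1. c v w = 0) \<and> (\<forall>v\<in>V2. \<forall>w\<in>V2. c v w = 0)}"

definition iso_NS :: "('a \<Rightarrow> 'a \<Rightarrow> real) set" where
  "iso_NS = iso_forms \<inter> NS A"

lemma iso_form: "c \<in> iso_forms \<Longrightarrow> c \<in> real_forms A"
  by (simp add: iso_forms_def)

lemma iso1: "c \<in> iso_forms \<Longrightarrow> v \<in> V1 \<Longrightarrow> w \<in> V1 \<Longrightarrow> c v w = 0"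
  by (simp add: iso_forms_def)

lemma iso2: "c \<in> iso_forms \<Longrightarrow> v \<in> V2 \<Longrightarrow> w \<in> V2 \<Longrightarrow> c v w = 0"
  by (simp add: iso_forms_def)

lemma subspace_iso_forms: "subspace iso_forms"
  using subspace_real_forms[of A]
  by (auto simp: iso_forms_def subspace_def scaleR_fun_apply)

lemma pq_iso: "p \<in> iso_forms" "q \<in> iso_forms"
  using weak_pair_forms(1,2)[OF weak] dec
  by (auto simp: iso_forms_def wb_decomposition_def re_form_def im_form_def)

text \<open>
  Isotropy of the summands is a system of integral linear equations for \<open>c\<close>. If the coefficients in
  \<open>c = \<Sum> r C\<^sub>r\<close> are independent over the integers, every \<open>C\<^sub>r\<close> satisfies these equations.
\<close>

lemma iso_forms_span:
  assumes c: "c \<in> iso_forms" "c \<in> NS_real A"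
  shows "c \<in> span iso_NS"
proof -
  obtain R C where R: "finite R" "int_independent R" and C: "\<And>r. r \<in> R \<Longrightarrow> C r \<in> NS A"
    and c_eq: "c = (\<Sum>r\<in>R. r *\<^sub>R C r)"
    using c(2) unfolding NS_real_def
    by (rule span_int_independent_combination[OF add_subgroup_NS]) (rule that)
  have Cf: "C r \<in> real_forms A" if "r \<in> R" for r using C[OF that] by (simp add: NS_eq)
  have c_app: "c v w = (\<Sum>r\<in>R. C r v w * r)" for v w
    unfolding c_eq by (simp add: sum_fun_apply scaleR_fun_apply mult.commute)
  have zero: "C r v w = 0" if r: "r \<in> R" and vw: "v \<in> Lat A" "w \<in> Lat A" "c v w = 0" for r v w
  proof (rule int_independentD[OF R(2) _ _ r])
    show "C r v w \<in> \<int>" if "r \<in> R" for r using C[OF that] vw by (simp add: NS_eq)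
    show "(\<Sum>r\<in>R. C r v w * r) = 0" using vw(3) c_app by simp
  qed
  have "C r \<in> iso_NS" if r: "r \<in> R" for r
  proof -
    have "C r v w = 0" if "v \<in> V1" "w \<in> V1" for v w
    proof (rule form_vanish_span[OF Cf[OF r] _ _ that])
      show "\<Gamma>1 \<subseteq> V" using L1_subset Lat_V by blast
      show "C r x y = 0" if "x \<in> \<Gamma>1" "y \<in> \<Gamma>1" for x y
        using zero[OF r, of x y] iso1[OF c(1), of x y] L1_subset span_base that by blast
    qed
    moreover have "C r v w = 0" if "v \<in> V2" "w \<in> V2" for v w
    proof (rule form_vanish_span[OF Cf[OF r] _ _ that])
      show "\<Gamma>2 \<subseteq> V" using L2_subset Lat_V by blast
      show "C r x y = 0" if "x \<in> \<Gamma>2" "y \<in> \<Gamma>2" for x y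
        using zero[OF r, of x y] iso2[OF c(1), of x y] L2_subset span_base that by blast
    qed
    ultimately show ?thesis using C[OF r] Cf[OF r] by (simp add: iso_NS_def iso_forms_def)
  qed
  then show ?thesis unfolding c_eq by (intro span_sum span_scale span_base)
qed

lemma pq_span: "p \<in> span iso_NS" "q \<in> span iso_NS"
  by (rule iso_forms_span[OF pq_iso(1)], use weak in \<open>simp add: weak_pair_def NS_complex0_def\<close>)
    (rule iso_forms_span[OF pq_iso(2)], use weak in \<open>simp add: weak_pair_def NS_complex0_def NS_real0_def\<close>)

lemma iso_annih: "c \<in> iso_forms \<Longrightarrow> v \<in> V2 \<Longrightarrow> c v \<in> V1_dual"
  using form_mem[OF iso_form V2_V] iso2 by (simp add: annih_def)

lemma iso_NS_annih:
  assumes c: "c \<in> iso_NS" and v: "v \<in> \<Gamma>2"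
  shows "c v \<in> L1_dual"
proof -
  have c': "c \<in> iso_forms" "c \<in> NS A" using c by (auto simp: iso_NS_def)
  have vL: "v \<in> Lat A" using v L2_subset by blast
  have "c v x = 0" if "x \<in> \<Gamma>2" for x
    by (intro iso2[OF c'(1)] span_base v that)
  moreover have "c v x \<in> \<int>" if "x \<in> Lat A" for x
    using c'(2) vL that by (simp add: NS_eq)
  ultimately show ?thesis
    using form_mem[OF iso_form[OF c'(1)] Lat_V[OF vL]]
    by (simp add: annih_lattice_def dual_lattice_def VS_def)
qed

lemma q_bij: "bij_betw q V (dual_space V)"
  using weak_pair_forms(3)[OF weak] .

lemma q_inj: "x \<in> V \<Longrightarrow> y \<in> V \<Longrightarrow> q x = q y \<Longrightarrow> x = y"
  using q_bij by (auto simp: bij_betw_def inj_on_def)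

text \<open>
  The component of \<open>a\<close> in \<open>V1\<close> pairs trivially with \<open>V1\<close> by isotropy and with \<open>V2\<close> by the assumption
  on \<open>q a\<close>, hence vanishes. So \<open>q\<close> identifies \<open>V2\<close> with the dual of \<open>V1\<close>, which is what makes
  \<open>V2 \<oplus> V1\<^sup>*\<close> invariant under \<open>I\<^sub>\<omega>\<close>.
\<close>

lemma q_V2:
  assumes a: "a \<in> V" and qa: "q a \<in> V1_dual"
  shows "a \<in> V2"
proof -
  have f: "q \<in> real_forms A" using pq_iso iso_form by blast
  have "q (pr1 a) x = 0" if x: "x \<in> V" for x
  proof -
    have "q (pr1 a) x = q (pr1 a) (pr2 x)"
      using form_add2[OF f pr_V(1) pr_V(1) pr_V(2), of a x x] pr_sum[OF x]
        iso1[OF pq_iso(2) pr1(2) pr1(2)] by simp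
    also have "\<dots> = q a (pr2 x)"
      using form_add[OF f pr_V(1) pr_V(2), of a a] pr_sum[OF a] iso2[OF pq_iso(2) pr2(2) pr2(2), of a x]
      by simp
    also have "\<dots> = 0" using annihD(2)[OF qa pr2(2)] .
    finally show ?thesis .
  qed
  then have "q (pr1 a) = q 0"
    using form_0[OF f] form_mem[OF f pr_V(1)] subspace_0[OF subspace_dual_space]
    by (intro dual_space_eqI[of _ V]) auto
  then have "pr1 a = 0" using q_inj[OF pr_V(1), of 0 a] by (simp add: VS_def span_zero)
  then show ?thesis using pr_sum[OF a] pr2(2)[of a] by simp
qed

subsection \<open>The lattice and the complex structure\<close>

text \<open>
  Extension by zero on \<open>\<Gamma>2\<close> is composition with the projection to \<open>\<Gamma>1\<close>. Its inverse restricts a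
  functional to \<open>V1\<close>.
\<close>

lemma Sigma_lat_eq: "Sigma_lat A \<Gamma>1 \<Gamma>2 = \<Gamma>2 \<times> L1_dual"
proof -
  have ext: "extend_dual A \<Gamma>1 \<Gamma>2 f = (\<lambda>v. if v \<in> V then f (pr1 v) else 0)" for f
    by (auto simp: extend_dual_def fun_eq_iff proj_along_V1)
  have "extend_dual A \<Gamma>1 \<Gamma>2 f \<in> L1_dual" if f: "f \<in> dual_lattice \<Gamma>1" for f
  proof -
    have fV1: "f \<in> dual_space V1" using f by (simp add: dual_lattice_def)
    have "(\<lambda>v. if v \<in> V then f (pr1 v) else 0) \<in> dual_space V"
      by (intro dual_spaceI)
        (auto simp: V_add V_scale linear_add[OF pr1(1)] linear_scale[OF pr1(1)]
          dual_space_add[OF fV1] dual_space_scale[OF fV1] pr1(2))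
    then show ?thesis
      unfolding ext using f pr1_lattice pr1(4)[OF span_base] dual_space_zero[OF fV1]
      by (auto simp: annih_lattice_def dual_lattice_def VS_def)
  qed
  moreover have "g \<in> extend_dual A \<Gamma>1 \<Gamma>2 ` dual_lattice \<Gamma>1" if g: "g \<in> L1_dual" for g
  proof -
    have gV: "g \<in> dual_space V" and gA: "g \<in> V1_dual"
      using g L1_dual_subset by (auto dest: annihD)
    define f where "f v = (if v \<in> V1 then g v else 0)" for v
    have "f \<in> dual_lattice \<Gamma>1"
      unfolding dual_lattice_def f_def using g L1_subset
      by (auto intro!: dual_spaceI simp: span_add span_scale V1_V dual_space_add[OF gV]
        dual_space_scale[OF gV] annih_lattice_def dual_lattice_def)
    moreover have "extend_dual A \<Gamma>1 \<Gamma>2 f = g"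
      unfolding ext f_def using annih_pr1_V[OF gA] dual_space_outside[OF gV] pr1(2)
      by (auto simp: fun_eq_iff)
    ultimately show ?thesis by (metis imageI)
  qed
  ultimately show ?thesis unfolding Sigma_lat_def by blast
qed

lemma Lat_B: "Lat B = \<Gamma>2 \<times> L1_dual"
  by (simp add: B_torus_def Sigma_lat_eq)

lemma VS_B: "VS B = V2 \<times> V1_dual"
proof -
  have "0 \<in> \<Gamma>2" "0 \<in> L1_dual"
    using sub2 add_subgroup_annih_lattice by (auto simp: add_subgroup_def)
  then show ?thesis unfolding VS_def Lat_B by (simp add: span_Times span_annih_lattice)
qed

lemma Cpx_B: "x \<in> VS B \<Longrightarrow> Cpx B x = I_op A \<omega> x"
  by (simp add: B_torus_def VS_def)

lemma Cpx_B_eqI: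
  assumes "v \<in> V2" "g \<in> V1_dual" "a \<in> V2" "q a = p v - g" "b = q v + p a"
  shows "Cpx B (v, g) = (a, b)"
  using assms I_op_eqI[OF weak V2_V[OF assms(1)] annihD(1)[OF assms(2)] V2_V[OF assms(3)] assms(4,5)]
  by (simp add: Cpx_B VS_B)

lemma Cpx_B_obtain:
  assumes "v \<in> V2" "g \<in> V1_dual"
  obtains a b where "Cpx B (v, g) = (a, b)" "a \<in> V2" "b \<in> V1_dual"
    "q a = p v - g" "b = q v + p a"
proof -
  obtain a b where ab: "I_op A \<omega> (v, g) = (a, b)" "a \<in> V" "b \<in> dual_space V"
    "q a = p v - g" "b = q v + p a"
    using I_op_obtain[OF weak V2_V[OF assms(1)] annihD(1)[OF assms(2)]] .
  have "q a \<in> V1_dual"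
    unfolding ab(4) using iso_annih[OF pq_iso(1) assms(1)] assms(2) subspace_annih
    by (intro subspace_diff)
  then have a: "a \<in> V2" by (rule q_V2[OF ab(2)])
  have b: "b \<in> V1_dual"
    unfolding ab(5) using iso_annih[OF pq_iso(1) a] iso_annih[OF pq_iso(2) assms(1)] subspace_annih
    by (intro subspace_add)
  from that[OF Cpx_B_eqI[OF assms a ab(4) refl] a _ ab(4) refl] b ab(5) show ?thesis by simp
qed

text \<open>
  The pair \<open>(a, b)\<close> is determined linearly by \<open>(v, g)\<close>. Multiplying the equation
  \<open>(\<phi>\<^sub>1 + i \<phi>\<^sub>2) (v + i a) = g + i b\<close> by \<open>-i\<close> shows that \<open>(a, b)\<close> is sent to \<open>(- v, - g)\<close>.
\<close>

lemma complex_torus_B: "complex_torus B"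
  unfolding complex_torus_def
proof (intro conjI ballI)
  note f = iso_form[OF pq_iso(1)] iso_form[OF pq_iso(2)]
  show "is_lattice (Lat B)"
    unfolding Lat_B by (intro is_lattice_Times lattice2 is_lattice_annih_lattice)
  show "linear_on (VS B) (VS B) (Cpx B)"
  proof (rule linear_onI)
    fix x assume "x \<in> VS B"
    then obtain v g where x: "x = (v, g)" "v \<in> V2" "g \<in> V1_dual" unfolding VS_B by blast
    show "Cpx B x \<in> VS B" using Cpx_B_obtain[OF x(2,3)] x(1) unfolding VS_B by (metis SigmaI)
  next
    fix x y assume "x \<in> VS B" "y \<in> VS B"
    then obtain v g w h where x: "x = (v, g)" "v \<in> V2" "g \<in> V1_dual"
      and y: "y = (w, h)" "w \<in> V2" "h \<in> V1_dual" unfolding VS_B by blast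
    obtain a b where a: "Cpx B (v, g) = (a, b)" "a \<in> V2" "b \<in> V1_dual" "q a = p v - g" "b = q v + p a"
      using Cpx_B_obtain[OF x(2,3)] .
    obtain a' b' where a': "Cpx B (w, h) = (a', b')" "a' \<in> V2" "b' \<in> V1_dual" "q a' = p w - h"
      "b' = q w + p a'"
      using Cpx_B_obtain[OF y(2,3)] .
    have "Cpx B (v + w, g + h) = (a + a', b + b')"
    proof (rule Cpx_B_eqI)
      show "v + w \<in> V2" "a + a' \<in> V2" using x y a a' by (auto intro: span_add)
      show "g + h \<in> V1_dual" using x y by (intro subspace_add[OF subspace_annih])
      show "q (a + a') = p (v + w) - (g + h)"
        unfolding form_add[OF f(2) V2_V[OF a(2)] V2_V[OF a'(2)]] form_add[OF f(1) V2_V[OF x(2)] V2_V[OF y(2)]]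
          a(4) a'(4) by (rule add_diff_add[symmetric])
      show "b + b' = q (v + w) + p (a + a')"
        unfolding form_add[OF f(1) V2_V[OF a(2)] V2_V[OF a'(2)]] form_add[OF f(2) V2_V[OF x(2)] V2_V[OF y(2)]]
          a(5) a'(5) by (simp only: ac_simps)
    qed
    then show "Cpx B (x + y) = Cpx B x + Cpx B y" using x y a a' by simp
  next
    fix r x assume "x \<in> VS B"
    then obtain v g where x: "x = (v, g)" "v \<in> V2" "g \<in> V1_dual" unfolding VS_B by blast
    obtain a b where a: "Cpx B (v, g) = (a, b)" "a \<in> V2" "b \<in> V1_dual" "q a = p v - g" "b = q v + p a"
      using Cpx_B_obtain[OF x(2,3)] .
    have "Cpx B (r *\<^sub>R v, r *\<^sub>R g) = (r *\<^sub>R a, r *\<^sub>R b)"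
    proof (rule Cpx_B_eqI)
      show "r *\<^sub>R v \<in> V2" "r *\<^sub>R a \<in> V2" using x a by (auto intro: span_scale)
      show "r *\<^sub>R g \<in> V1_dual" using x by (intro subspace_scale[OF subspace_annih])
      show "q (r *\<^sub>R a) = p (r *\<^sub>R v) - r *\<^sub>R g"
        unfolding form_scale[OF f(2) V2_V[OF a(2)]] form_scale[OF f(1) V2_V[OF x(2)]]
          a(4) by (rule scaleR_right_diff_distrib)
      show "r *\<^sub>R b = q (r *\<^sub>R v) + p (r *\<^sub>R a)"
        unfolding form_scale[OF f(1) V2_V[OF a(2)]] form_scale[OF f(2) V2_V[OF x(2)]]
          a(5) by (rule scaleR_right_distrib)
    qed
    then show "Cpx B (r *\<^sub>R x) = r *\<^sub>R Cpx B x" using x a by simp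
  qed
  fix x assume "x \<in> VS B"
  then obtain v g where x: "x = (v, g)" "v \<in> V2" "g \<in> V1_dual" unfolding VS_B by blast
  obtain a b where a: "Cpx B (v, g) = (a, b)" "a \<in> V2" "b \<in> V1_dual" "q a = p v - g" "b = q v + p a"
    using Cpx_B_obtain[OF x(2,3)] .
  have "Cpx B (a, b) = (- v, - g)"
  proof (rule Cpx_B_eqI[OF a(2,3)])
    show "- v \<in> V2" using x by (simp add: span_neg)
    show "q (- v) = p a - b"
      unfolding form_minus[OF f(2) V2_V[OF x(2)]] a(5) by (simp only: diff_add_eq_diff_diff_swap) simp
    show "- g = q a + p (- v)"
      unfolding form_minus[OF f(1) V2_V[OF x(2)]] a(4) by simp
  qed
  then show "Cpx B (Cpx B x) = - x" using x a by simp
qed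

end

context wb_pair
begin

section \<open>Forms on the new torus\<close>

text \<open>
  Linear maps \<open>V2 \<rightarrow> V1\<close>, composed with the projection to \<open>V2\<close>. This makes them globally linear and
  makes equal maps equal as functions.
\<close>

definition homs :: "('a \<Rightarrow> 'a) set" where
  "homs = {d. linear d \<and> range d \<subseteq> V1 \<and> (\<forall>x. d (pr2 x) = d x)}"

definition int_homs :: "('a \<Rightarrow> 'a) set" where
  "int_homs = {d \<in> homs. d ` \<Gamma>2 \<subseteq> \<Gamma>1}"

text \<open>
  When \<open>d\<close> is the real or imaginary part of the period matrix of \<open>J\<close>, this expresses that the
  isotropic form \<open>c\<close> is \<open>J\<close>-invariant. For \<open>c = \<phi>\<^sub>1\<close> and \<open>c = \<phi>\<^sub>2\<close> together it makes the form of \<open>d\<close>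
  invariant under \<open>I\<^sub>\<omega>\<close>. This double role is the source of the mirror symmetry.
\<close>

definition compat :: "('a \<Rightarrow> 'a \<Rightarrow> real) \<Rightarrow> ('a \<Rightarrow> 'a) \<Rightarrow> bool" where
  "compat c d \<longleftrightarrow> (\<forall>v\<in>V2. \<forall>w\<in>V2. c v (d w) = c w (d v))"

text \<open>
  The forms on \<open>V2 \<oplus> V1\<^sup>*\<close> for which both summands are isotropic, parametrised by maps
  \<open>V2 \<rightarrow> V1\<close>.
\<close>

definition hom_form :: "('a \<Rightarrow> 'a) \<Rightarrow> 'a \<times> ('a \<Rightarrow> real) \<Rightarrow> 'a \<times> ('a \<Rightarrow> real) \<Rightarrow> real" where
  "hom_form d x y = (if x \<in> VS B \<and> y \<in> VS B then snd y (d (fst x)) - snd x (d (fst y)) else 0)"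

lemma homsD:
  assumes "d \<in> homs"
  shows "linear d" "d x \<in> V1" "d x \<in> V" "d (pr2 x) = d x"
  using assms V1_V by (auto simp: homs_def)

lemma subspace_homs: "subspace homs"
proof (rule subspaceI)
  show "0 \<in> homs" by (auto simp: homs_def linear_iff span_zero)
next
  fix c d assume "c \<in> homs" "d \<in> homs"
  then show "c + d \<in> homs"
    unfolding homs_def by (auto simp: linear_iff span_add algebra_simps image_subset_iff)
next
  fix r c assume "c \<in> homs"
  then show "r *\<^sub>R c \<in> homs"
    unfolding homs_def by (auto simp: linear_iff scaleR_fun_apply span_scale scaleR_right_distrib image_subset_iff)
qed

lemma add_subgroup_int_homs: "add_subgroup int_homs"
proof -
  have "0 \<in> \<Gamma>1" using sub1 by (simp add: add_subgroup_def)
  then have "0 \<in> int_homs" using subspace_0[OF subspace_homs] by (auto simp: int_homs_def)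
  moreover have "c - d \<in> int_homs" if "c \<in> int_homs" "d \<in> int_homs" for c d
  proof -
    have "c - d \<in> homs" using that subspace_diff[OF subspace_homs] by (auto simp: int_homs_def)
    moreover have "(c - d) x \<in> \<Gamma>1" if "x \<in> \<Gamma>2" for x
      using \<open>c \<in> int_homs\<close> \<open>d \<in> int_homs\<close> that sub1 by (auto simp: int_homs_def add_subgroup_def)
    ultimately show ?thesis by (auto simp: int_homs_def)
  qed
  ultimately show ?thesis by (simp add: add_subgroup_def)
qed

text \<open>
  The elementary matrices with respect to lattice bases are integral.
\<close>

lemma homs_span: assumes d: "d \<in> homs" shows "d \<in> span int_homs"
proof -
  obtain B1 where B1: "finite B1" "independent B1" "\<Gamma>1 = group_closure B1"
    using lattice1 is_lattice_def by blast
  obtain B2 where B2: "finite B2" "independent B2" "\<Gamma>2 = group_closure B2"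
    using lattice2 is_lattice_def by blast
  have sp: "V1 = span B1" "V2 = span B2" using B1 B2 span_group_closure by auto
  define E where "E j i x = representation B2 (pr2 x) j *\<^sub>R i" for j i x :: 'a
  have pr2B: "pr2 x \<in> span B2" for x using pr2(2) sp by auto
  have E: "E j i \<in> int_homs" if i: "i \<in> B1" for i j
  proof -
    have iG: "i \<in> \<Gamma>1" using i B1(3) by (auto intro: group_closure.base)
    have "linear (E j i)"
      by (simp add: linear_iff E_def linear_add[OF pr2(1)] linear_scale[OF pr2(1)]
        real_vector.representation_add[OF B2(2) pr2B pr2B]
        real_vector.representation_scale[OF B2(2) pr2B] scaleR_left_distrib)
    moreover have "E j i x \<in> V1" for x
      unfolding E_def using iG by (intro span_scale span_base)
    moreover have "E j i (pr2 x) = E j i x" for x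
      by (simp add: E_def pr2(3)[OF pr2(2)])
    moreover have "E j i x \<in> \<Gamma>1" if "x \<in> \<Gamma>2" for x
    proof -
      have "representation B2 (pr2 x) j \<in> \<int>"
        using that group_closure_eq_integral_coordinates[OF B2(1,2)] B2(3) pr2(3)[OF span_base[OF that]]
        by auto
      then show ?thesis unfolding E_def by (rule add_subgroup_scale_Ints[OF sub1 iG])
    qed
    ultimately show ?thesis by (auto simp: int_homs_def homs_def)
  qed
  have "d = (\<Sum>j\<in>B2. \<Sum>i\<in>B1. representation B1 (d j) i *\<^sub>R E j i)"
  proof
    fix x
    have "d x = d (\<Sum>j\<in>B2. representation B2 (pr2 x) j *\<^sub>R j)"
      using sum_representation_finite[OF B2(1,2) pr2B] homsD(4)[OF d] by simp
    also have "\<dots> = (\<Sum>j\<in>B2. representation B2 (pr2 x) j *\<^sub>R d j)"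
      by (simp add: linear_sum[OF homsD(1)[OF d]] linear_scale[OF homsD(1)[OF d]])
    also have "\<dots> = (\<Sum>j\<in>B2. representation B2 (pr2 x) j *\<^sub>R (\<Sum>i\<in>B1. representation B1 (d j) i *\<^sub>R i))"
      using sum_representation_finite[OF B1(1,2)] homsD(2)[OF d] sp by simp
    also have "\<dots> = (\<Sum>j\<in>B2. \<Sum>i\<in>B1. representation B1 (d j) i *\<^sub>R E j i) x"
      by (simp add: sum_fun_apply scaleR_fun_apply E_def scaleR_sum_right mult.commute)
    finally show "d x = (\<Sum>j\<in>B2. \<Sum>i\<in>B1. representation B1 (d j) i *\<^sub>R E j i) x" .
  qed
  also have "\<dots> \<in> span int_homs"
    using E by (intro span_sum span_scale span_base)
  finally show ?thesis .
qed

text \<open>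
  The difference of the two sides is a functional of each argument, so it vanishes on \<open>V2\<close> once it
  vanishes on \<open>\<Gamma>2\<close>.
\<close>

lemma compat_from_lattice:
  assumes c: "c \<in> iso_forms" and d: "d \<in> homs"
    and L: "\<And>v w. v \<in> \<Gamma>2 \<Longrightarrow> w \<in> \<Gamma>2 \<Longrightarrow> c v (d w) = c w (d v)"
  shows "compat c d"
proof -
  have cf: "c \<in> real_forms A" using c by (rule iso_form)
  have sub: "subspace V" by (simp add: VS_def subspace_span)
  have G2V: "\<Gamma>2 \<subseteq> V" using L2_subset Lat_V by blast
  have fd: "(\<lambda>x. if x \<in> V then c v (d x) - c x (d v) else 0) \<in> dual_space V" if v: "v \<in> V" for v
    by (rule dual_spaceI)
      (auto simp: V_add V_scale linear_add[OF homsD(1)[OF d]] linear_scale[OF homsD(1)[OF d]]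
        form_add2[OF cf v homsD(3)[OF d] homsD(3)[OF d]] form_add[OF cf] form_scale[OF cf] scaleR_fun_apply
        dual_space_scale[OF form_mem[OF cf v] homsD(3)[OF d]] algebra_simps)
  have 1: "c v (d w) = c w (d v)" if v: "v \<in> \<Gamma>2" and w: "w \<in> V2" for v w
  proof -
    have vV: "v \<in> V" using v G2V by blast
    have "(if w \<in> V then c v (d w) - c w (d v) else 0) = 0"
      by (rule dual_space_vanish_span[OF fd[OF vV] sub G2V _ w]) (use L[OF v] in auto)
    then show ?thesis using V2_V[OF w] by simp
  qed
  have "c v (d w) = c w (d v)" if v: "v \<in> V2" and w: "w \<in> V2" for v w
  proof -
    have "(if w \<in> V then c v (d w) - c w (d v) else 0) = 0"
      by (rule dual_space_vanish_span[OF fd[OF V2_V[OF v]] sub G2V _ w]) (use 1[OF _ v] in auto)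
    then show ?thesis using V2_V[OF w] by simp
  qed
  then show ?thesis by (simp add: compat_def)
qed

definition compat_int_homs :: "('a \<Rightarrow> 'a) set" where
  "compat_int_homs = {d \<in> int_homs. \<forall>c\<in>iso_NS. compat c d}"

text \<open>
  For integral \<open>c\<close>, compatibility with \<open>c\<close> is a system of integral linear equations for \<open>s\<close>. They
  hold for every \<open>D\<^sub>r\<close> in \<open>s = \<Sum> r D\<^sub>r\<close> if the coefficients are independent over the integers.
\<close>

lemma compat_homs_span:
  assumes s: "s \<in> homs" "\<And>c. c \<in> iso_NS \<Longrightarrow> compat c s"
  shows "s \<in> span compat_int_homs"
proof -
  obtain R D where R: "finite R" "int_independent R" and D: "\<And>r. r \<in> R \<Longrightarrow> D r \<in> int_homs"
    and s_eq: "s = (\<Sum>r\<in>R. r *\<^sub>R D r)"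
    using homs_span[OF s(1)]
    by (rule span_int_independent_combination[OF add_subgroup_int_homs]) (rule that)
  have Dh: "D r \<in> homs" if "r \<in> R" for r using D[OF that] by (simp add: int_homs_def)
  have "compat c (D r)" if c: "c \<in> iso_NS" and r: "r \<in> R" for c r
  proof (rule compat_from_lattice)
    show ci: "c \<in> iso_forms" using c by (simp add: iso_NS_def)
    show "D r \<in> homs" using Dh[OF r] .
    fix v w assume v: "v \<in> \<Gamma>2" and w: "w \<in> \<Gamma>2"
    have vV: "v \<in> V" "v \<in> V2" and wV: "w \<in> V" "w \<in> V2"
      using v w L2_subset Lat_V span_base by blast+
    have cs: "c x (s y) = (\<Sum>r\<in>R. c x (D r y) * r)" if x: "x \<in> V" for x y
    proof -
      have "c x (s y) = c x (\<Sum>r\<in>R. r *\<^sub>R D r y)"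
        unfolding s_eq by (simp add: sum_fun_apply scaleR_fun_apply)
      also have "\<dots> = (\<Sum>r\<in>R. c x (r *\<^sub>R D r y))"
        using homsD(3)[OF Dh] V_scale
        by (intro dual_space_sum[OF form_mem[OF iso_form[OF ci] x]]) (auto simp: VS_def subspace_span)
      also have "\<dots> = (\<Sum>r\<in>R. c x (D r y) * r)"
        using homsD(3)[OF Dh]
        by (intro sum.cong) (auto simp: dual_space_scale[OF form_mem[OF iso_form[OF ci] x]])
      finally show ?thesis .
    qed
    have "c v (D r w) - c w (D r v) = 0"
    proof (rule int_independentD[OF R(2) _ _ r])
      fix r' assume r': "r' \<in> R"
      have "D r' v \<in> Lat A" "D r' w \<in> Lat A" "v \<in> Lat A" "w \<in> Lat A"
        using D[OF r'] v w L1_subset L2_subset by (auto simp: int_homs_def)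
      then show "c v (D r' w) - c w (D r' v) \<in> \<int>"
        using c by (auto simp: iso_NS_def NS_eq)
    next
      have "c v (s w) = c w (s v)" using s(2)[OF c] vV wV by (simp add: compat_def)
      then show "(\<Sum>r\<in>R. (c v (D r w) - c w (D r v)) * r) = 0"
        using cs[OF vV(1), of w] cs[OF wV(1), of v] by (simp add: left_diff_distrib sum_subtractf)
    qed
    then show "c v (D r w) = c w (D r v)" by simp
  qed
  then have "D r \<in> compat_int_homs" if "r \<in> R" for r
    using D[OF that] that by (simp add: compat_int_homs_def)
  then show ?thesis unfolding s_eq by (intro span_sum span_scale span_base)
qed

lemma compat_span:
  assumes c: "c \<in> span iso_NS" and d: "\<And>c. c \<in> iso_NS \<Longrightarrow> compat c d"
  shows "compat c d"
proof -
  have "subspace {c. compat c d}"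
    by (auto simp: subspace_def compat_def scaleR_fun_apply)
  then have "span iso_NS \<subseteq> {c. compat c d}" using d by (intro span_minimal) auto
  with c show ?thesis by blast
qed

lemma compat_pq: assumes "d \<in> compat_int_homs" shows "compat p d" "compat q d"
  using assms pq_span by (auto simp: compat_int_homs_def intro: compat_span)

text \<open>
  For \<open>I\<^sub>\<omega> (v, g) = (a, b)\<close>, substituting \<open>g = \<phi>\<^sub>1 v - \<phi>\<^sub>2 a\<close> and \<open>b = \<phi>\<^sub>2 v + \<phi>\<^sub>1 a\<close> expresses both sides
  of the invariance through \<open>\<phi>\<^sub>1\<close> and \<open>\<phi>\<^sub>2\<close>. By compatibility the terms with \<open>\<phi>\<^sub>1\<close> cancel and the
  terms with \<open>\<phi>\<^sub>2\<close> agree.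
\<close>

lemma hom_form_real_forms:
  assumes d: "d \<in> homs" and cp: "compat p d" "compat q d"
  shows "hom_form d \<in> real_forms B"
proof (rule real_formsI)
  have B_sub: "subspace (VS B)" by (simp add: VS_def subspace_span)
  have B_add: "x + y \<in> VS B" if "x \<in> VS B" "y \<in> VS B" for x y
    using that by (rule subspace_add[OF B_sub])
  have B_scale: "r *\<^sub>R x \<in> VS B" if "x \<in> VS B" for r x
    using that by (rule subspace_scale[OF B_sub])
  have sndV: "snd x \<in> dual_space V" if "x \<in> VS B" for x
    using that by (auto simp: VS_B dest: annihD)
  note dd = homsD[OF d]
  fix x assume x: "x \<in> VS B"
  show "hom_form d x \<in> dual_space (VS B)"
    by (rule dual_spaceI)
      (use x in \<open>auto simp: hom_form_def B_add B_scale linear_add[OF dd(1)] linear_scale[OF dd(1)]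
        dual_space_add[OF sndV dd(3) dd(3)] dual_space_scale[OF sndV dd(3)] scaleR_fun_apply
        algebra_simps\<close>)
  show "hom_form d (r *\<^sub>R x) = r *\<^sub>R hom_form d x" for r
    by (rule ext) (use x in \<open>simp add: hom_form_def B_scale linear_scale[OF dd(1)]
        dual_space_scale[OF sndV dd(3)] scaleR_fun_apply right_diff_distrib\<close>)
  fix y assume y: "y \<in> VS B"
  show "hom_form d (x + y) = hom_form d x + hom_form d y"
    by (rule ext) (use x y in \<open>simp add: hom_form_def B_add linear_add[OF dd(1)]
        dual_space_add[OF sndV dd(3) dd(3)]\<close>)
  show "hom_form d x y = - hom_form d y x" by (auto simp: hom_form_def)
  obtain v g where xv: "x = (v, g)" "v \<in> V2" "g \<in> V1_dual" using x unfolding VS_B by blast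
  obtain w h where yw: "y = (w, h)" "w \<in> V2" "h \<in> V1_dual" using y unfolding VS_B by blast
  obtain a b where a: "Cpx B (v, g) = (a, b)" "a \<in> V2" "b \<in> V1_dual" "q a = p v - g" "b = q v + p a"
    using Cpx_B_obtain[OF xv(2,3)] .
  obtain a' b' where a': "Cpx B (w, h) = (a', b')" "a' \<in> V2" "b' \<in> V1_dual" "q a' = p w - h"
    "b' = q w + p a'"
    using Cpx_B_obtain[OF yw(2,3)] .
  have sym: "p u (d z) = p z (d u)" "q u (d z) = q z (d u)" if "u \<in> V2" "z \<in> V2" for u z
    using cp that by (auto simp: compat_def)
  have g: "g u = p v u - q a u" and h: "h u = p w u - q a' u" for u
    using a(4) a'(4) by simp_all
  have mem: "(a, b) \<in> VS B" "(a', b') \<in> VS B" using a a' by (auto simp: VS_B)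
  have "b' (d a) - b (d a') = h (d v) - g (d w)"
    unfolding a(5) a'(5) g h plus_fun_apply
    using sym[OF xv(2) yw(2)] sym[OF a(2) a'(2)] sym[OF xv(2) a'(2)] sym[OF yw(2) a(2)] by simp
  then show "hom_form d (Cpx B x) (Cpx B y) = hom_form d x y"
    using mem x y a(1) a'(1) xv(1) yw(1) by (simp add: hom_form_def)
qed (auto simp: hom_form_def fun_eq_iff)

lemma hom_form_NS: assumes d: "d \<in> compat_int_homs" shows "hom_form d \<in> NS B"
  unfolding NS_eq
proof (intro CollectI conjI ballI)
  have dh: "d \<in> homs" "d ` \<Gamma>2 \<subseteq> \<Gamma>1" using d by (auto simp: compat_int_homs_def int_homs_def)
  show "hom_form d \<in> real_forms B" by (rule hom_form_real_forms[OF dh(1) compat_pq[OF d]])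
  fix x y assume xy: "x \<in> Lat B" "y \<in> Lat B"
  have "f (d v) \<in> \<int>" if "v \<in> \<Gamma>2" "f \<in> L1_dual" for v f
    using that dh(2) L1_subset by (auto simp: annih_lattice_def dual_lattice_def)
  moreover have "x \<in> VS B" "y \<in> VS B" using xy by (auto simp: VS_def span_base)
  ultimately show "hom_form d x y \<in> \<int>" using xy by (auto simp: Lat_B hom_form_def)
qed

text \<open>
  The form depends linearly on the map, so this reduces to compatible integral maps.
\<close>

lemma hom_form_NS_real:
  assumes s: "s \<in> homs" "\<And>c. c \<in> iso_NS \<Longrightarrow> compat c s"
  shows "hom_form s \<in> NS_real B"
proof -
  define S where "S = {d \<in> homs. hom_form d \<in> NS_real B}"
  have sndV: "snd x \<in> dual_space V" if "x \<in> VS B" for x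
    using that by (auto simp: VS_B dest: annihD)
  have "subspace S"
  proof (rule subspaceI)
    have "hom_form 0 = 0"
      by (intro ext) (simp add: hom_form_def dual_space_zero[OF sndV])
    then show "0 \<in> S" using subspace_0[OF subspace_homs] by (simp add: S_def NS_real_def span_zero)
  next
    fix c d assume cd: "c \<in> S" "d \<in> S"
    then have h: "c \<in> homs" "d \<in> homs" by (auto simp: S_def)
    have "hom_form (c + d) = hom_form c + hom_form d"
      by (intro ext) (simp add: hom_form_def
          dual_space_add[OF sndV homsD(3)[OF h(1)] homsD(3)[OF h(2)]])
    then show "c + d \<in> S"
      using cd subspace_add[OF subspace_homs h] by (simp add: S_def NS_real_def span_add)
  next
    fix r c assume c: "c \<in> S"
    then have h: "c \<in> homs" by (auto simp: S_def)
    have "hom_form (r *\<^sub>R c) = r *\<^sub>R hom_form c"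
      by (intro ext) (simp add: hom_form_def scaleR_fun_apply right_diff_distrib
          dual_space_scale[OF sndV homsD(3)[OF h]])
    then show "r *\<^sub>R c \<in> S"
      using c subspace_scale[OF subspace_homs h] by (simp add: S_def NS_real_def span_scale)
  qed
  moreover have "compat_int_homs \<subseteq> S"
    using hom_form_NS by (auto simp: S_def NS_real_def span_base compat_int_homs_def int_homs_def)
  ultimately have "span compat_int_homs \<subseteq> S" by (intro span_minimal)
  then show ?thesis using compat_homs_span[OF s] by (auto simp: S_def)
qed

section \<open>The mirror form\<close>

definition J21_inv :: "'a \<Rightarrow> 'a" where
  "J21_inv = inv_into V1 (\<lambda>u. pr2 (J u))"

lemma J21_bij: "bij_betw (\<lambda>u. pr2 (J u)) V1 V2"
proof -
  have "bij_betw (\<lambda>u. proj_along V1 V2 (J u)) V1 V2"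
    using dec by (simp add: wb_decomposition_def)
  moreover have "proj_along V1 V2 (J u) = pr2 (J u)" if "u \<in> V1" for u
    by (intro proj_along_V2 J_mem V1_V that)
  ultimately show ?thesis by (simp cong: bij_betw_cong)
qed

lemma J21_inv_mem: "v \<in> V2 \<Longrightarrow> J21_inv v \<in> V1"
  unfolding J21_inv_def using J21_bij by (metis bij_betw_def inv_into_into)

lemma J21_J21_inv: "v \<in> V2 \<Longrightarrow> pr2 (J (J21_inv v)) = v"
  unfolding J21_inv_def using J21_bij by (metis bij_betw_inv_into_right)

lemma J21_inv_J21: "u \<in> V1 \<Longrightarrow> J21_inv (pr2 (J u)) = u"
  unfolding J21_inv_def using J21_bij by (metis bij_betw_inv_into_left)

lemma J21_inv_eqI: "u \<in> V1 \<Longrightarrow> pr2 (J u) = v \<Longrightarrow> J21_inv v = u"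
  using J21_inv_J21 by blast

lemma J21_inv_V: "v \<in> V2 \<Longrightarrow> J21_inv v \<in> V"
  by (rule V1_V[OF J21_inv_mem])

lemma J21_inv_add: "v \<in> V2 \<Longrightarrow> w \<in> V2 \<Longrightarrow> J21_inv (v + w) = J21_inv v + J21_inv w"
  by (rule J21_inv_eqI) (simp_all add: J21_inv_mem span_add J_add J21_inv_V linear_add[OF pr2(1)] J21_J21_inv)

lemma J21_inv_scale: "v \<in> V2 \<Longrightarrow> J21_inv (r *\<^sub>R v) = r *\<^sub>R J21_inv v"
  by (rule J21_inv_eqI) (simp_all add: J21_inv_mem span_scale J_scale J21_inv_V linear_scale[OF pr2(1)] J21_J21_inv)

lemma J_J21_inv: "v \<in> V2 \<Longrightarrow> J (J21_inv v) = pr1 (J (J21_inv v)) + v"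
  using pr_sum[OF J_mem[OF J21_inv_V]] J21_J21_inv by simp

text \<open>
  The real and imaginary parts of the period matrix \<open>\<sigma>\<close> of \<open>J\<close>.
\<close>

definition mirror_re :: "'a \<Rightarrow> 'a" where "mirror_re x = pr1 (J (J21_inv (pr2 x)))"

definition mirror_im :: "'a \<Rightarrow> 'a" where "mirror_im x = - J21_inv (pr2 x)"

lemma mirror_re_homs: "mirror_re \<in> homs"
  unfolding homs_def using pr1(2) pr2(2)
  by (auto simp: linear_iff mirror_re_def linear_add[OF pr2(1)] linear_scale[OF pr2(1)] J21_inv_add J21_inv_scale
      J_add J_scale J21_inv_V linear_add[OF pr1(1)] linear_scale[OF pr1(1)] pr2(3))

lemma mirror_im_homs: "mirror_im \<in> homs"
  unfolding homs_def using pr2(2)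
  by (auto simp: linear_iff mirror_im_def linear_add[OF pr2(1)] linear_scale[OF pr2(1)] J21_inv_add J21_inv_scale
      pr2(3) J21_inv_mem span_neg)

lemma iso_pr2:
  assumes c: "c \<in> iso_forms" and x: "x \<in> V" and u: "u \<in> V1"
  shows "c x u = c (pr2 x) u"
  using form_add[OF iso_form[OF c] pr_V(1) pr_V(2), of x x] pr_sum[OF x] iso1[OF c pr1(2) u, of x]
  by simp

lemma iso_pr1:
  assumes c: "c \<in> iso_forms" and x: "x \<in> V" and v: "v \<in> V2"
  shows "c x v = c (pr1 x) v"
  using form_add[OF iso_form[OF c] pr_V(1) pr_V(2), of x x] pr_sum[OF x] iso2[OF c pr2(2) v, of x]
  by simp

lemma iso_J_sym:
  assumes c: "c \<in> iso_forms" and x: "x \<in> V" and y: "y \<in> V"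
  shows "c (J x) y = c (J y) x"
proof -
  have f: "c \<in> real_forms A" by (rule iso_form[OF c])
  have "c (J x) y = c (J (J x)) (J y)" using form_J[OF f J_mem[OF x] y] by simp
  also have "\<dots> = - c x (J y)" using J_J[OF x] form_minus[OF f x] by simp
  also have "\<dots> = c (J y) x" using form_skew[OF f x J_mem[OF y]] by simp
  finally show ?thesis .
qed

text \<open>
  With \<open>v = J\<^sub>2\<^sub>1 x\<close>, \<open>w = J\<^sub>2\<^sub>1 y\<close> and isotropy of \<open>V1\<close>, both sides become values of the symmetric
  form \<open>(x, y) \<mapsto> c (J x) y\<close>.
\<close>

lemma compat_mirror_im: assumes c: "c \<in> iso_forms" shows "compat c mirror_im"
  unfolding compat_def
proof (intro ballI)
  fix v w assume v: "v \<in> V2" and w: "w \<in> V2"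
  have f: "c \<in> real_forms A" by (rule iso_form[OF c])
  have "c v (J21_inv w) = c (J (J21_inv v)) (J21_inv w)"
    using iso_pr2[OF c J_mem[OF J21_inv_V[OF v]] J21_inv_mem[OF w]] J21_J21_inv[OF v] by simp
  also have "\<dots> = c (J (J21_inv w)) (J21_inv v)" by (rule iso_J_sym[OF c J21_inv_V[OF v] J21_inv_V[OF w]])
  also have "\<dots> = c w (J21_inv v)"
    using iso_pr2[OF c J_mem[OF J21_inv_V[OF w]] J21_inv_mem[OF v]] J21_J21_inv[OF w] by simp
  finally show "c v (mirror_im w) = c w (mirror_im v)"
    using v w by (simp add: mirror_im_def pr2(3) form_minus2[OF f] V2_V J21_inv_V)
qed

text \<open>
  Expanding \<open>0 = c x y = c (J x) (J y)\<close> for \<open>x, y \<in> V1\<close> along the splitting leaves only the two mixed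
  terms.
\<close>

lemma compat_mirror_re: assumes c: "c \<in> iso_forms" shows "compat c mirror_re"
  unfolding compat_def
proof (intro ballI)
  fix v w assume v: "v \<in> V2" and w: "w \<in> V2"
  have f: "c \<in> real_forms A" by (rule iso_form[OF c])
  let ?x = "J21_inv v" and ?y = "J21_inv w"
  have x: "?x \<in> V" "J ?x \<in> V" and y: "?y \<in> V" "J ?y \<in> V" using v w J21_inv_V J_mem by auto
  have vV: "v \<in> V" "w \<in> V" using v w V2_V by auto
  have "0 = c ?x ?y" using iso1[OF c J21_inv_mem[OF v] J21_inv_mem[OF w]] by simp
  also have "\<dots> = c (J ?x) (J ?y)" using form_J[OF f x(1) y(1)] by simp
  also have "\<dots> = c (J ?x) (pr1 (J ?y) + w)" using J_J21_inv[OF w] by simp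
  also have "\<dots> = c (J ?x) (pr1 (J ?y)) + c (J ?x) w"
    by (rule form_add2[OF f x(2) pr_V(1) vV(2)])
  also have "c (J ?x) (pr1 (J ?y)) = c v (pr1 (J ?y))"
    using iso_pr2[OF c x(2) pr1(2), of "J ?y"] J21_J21_inv[OF v] by simp
  also have "c (J ?x) w = c (pr1 (J ?x)) w" by (rule iso_pr1[OF c x(2) w])
  also have "\<dots> = - c w (pr1 (J ?x))" by (rule form_skew[OF f pr_V(1) vV(2)])
  finally show "c v (mirror_re w) = c w (mirror_re v)" using v w by (simp add: mirror_re_def pr2(3))
qed

definition mirror_form :: "'a \<times> ('a \<Rightarrow> real) \<Rightarrow> 'a \<times> ('a \<Rightarrow> real) \<Rightarrow> complex" where
  "mirror_form x y = Complex (hom_form mirror_re x y) (hom_form mirror_im x y)"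

lemma re_mirror_form: "re_form mirror_form = hom_form mirror_re" and im_mirror_form: "im_form mirror_form = hom_form mirror_im"
  by (auto simp: fun_eq_iff re_form_def im_form_def mirror_form_def)

text \<open>
  The imaginary part is nondegenerate because \<open>J\<^sub>2\<^sub>1\<^sup>-\<^sup>1\<close> is bijective and \<open>V1\<close> is in duality with
  \<open>V1\<^sup>*\<close>.
\<close>

lemma weak_pair_B: "weak_pair B mirror_form"
proof -
  have ci: "c \<in> iso_forms" if "c \<in> iso_NS" for c using that by (simp add: iso_NS_def)
  have "hom_form mirror_re \<in> NS_real B" "hom_form mirror_im \<in> NS_real B"
    using compat_mirror_re compat_mirror_im ci mirror_re_homs mirror_im_homs by (auto intro!: hom_form_NS_real)
  moreover have "x = 0"
    if x: "x \<in> VS B" and zero: "\<And>y. y \<in> VS B \<Longrightarrow> hom_form mirror_im x y = 0" for x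
  proof -
    obtain v g where xv: "x = (v, g)" "v \<in> V2" "g \<in> V1_dual" using x unfolding VS_B by blast
    have "h (J21_inv v) = 0" if h: "h \<in> V1_dual" for h
    proof -
      have y: "(0, h) \<in> VS B" using h by (simp add: VS_B span_zero)
      have "hom_form mirror_im x (0, h) = h (mirror_im v) - g (mirror_im 0)" using x y xv by (simp add: hom_form_def)
      also have "\<dots> = - h (J21_inv v)"
        using xv J21_inv_V linear_0[OF homsD(1)[OF mirror_im_homs]] dual_space_zero[OF annihD(1)[OF xv(3)]]
        by (simp add: mirror_im_def pr2(3) dual_space_minus[OF annihD(1)[OF h]])
      finally show ?thesis using zero[OF y] by simp
    qed
    then have "J21_inv v = 0" using V1_separated[OF J21_inv_mem[OF xv(2)]] by blast
    then have v0: "v = 0"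
      using J21_J21_inv[OF xv(2)] J_scale[of 0 0] linear_0[OF pr2(1)] by (simp add: VS_def span_zero)
    have "g z = 0" if z: "z \<in> V" for z
    proof -
      let ?w = "pr2 (J (pr1 z))"
      have y: "(?w, 0) \<in> VS B" using subspace_0[OF subspace_annih] pr2(2) by (simp add: VS_B)
      have "hom_form mirror_im x (?w, 0) = - g (mirror_im ?w)" using x y xv by (simp add: hom_form_def)
      also have "mirror_im ?w = - pr1 z" by (simp add: mirror_im_def pr2(3)[OF pr2(2)] J21_inv_J21[OF pr1(2)])
      also have "- g (- pr1 z) = g (pr1 z)"
        using dual_space_minus[OF annihD(1)[OF xv(3)] pr_V(1)] by simp
      also have "\<dots> = g z" by (rule annih_pr1_V[OF xv(3) z])
      finally have "hom_form mirror_im x (?w, 0) = g z" .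
      then show ?thesis by (rule trans[OF sym zero[OF y]])
    qed
    then have "g = 0"
      using annihD(1)[OF xv(3)] subspace_0[OF subspace_dual_space]
      by (intro dual_space_eqI[of _ V]) auto
    with v0 xv show ?thesis by (simp add: zero_prod_def)
  qed
  ultimately show ?thesis
    using complex_torus_B
    by (auto simp: weak_pair_def NS_complex0_def NS_real0_def re_mirror_form im_mirror_form)
qed

end

context wb_pair
begin

section \<open>The mirror isomorphism\<close>

definition pull1 :: "('a \<Rightarrow> real) \<Rightarrow> 'a \<Rightarrow> real" where
  "pull1 f = (\<lambda>v. if v \<in> V then f (pr1 v) else 0)"

text \<open>
  The element \<open>(u, f)\<close> of \<open>V1 \<oplus> V2\<^sup>*\<close>, as a functional on \<open>V2 \<oplus> V1\<^sup>*\<close>. Only the values of \<open>f\<close> on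
  \<open>V2\<close> enter.
\<close>

definition pairing :: "'a \<Rightarrow> ('a \<Rightarrow> real) \<Rightarrow> 'a \<times> ('a \<Rightarrow> real) \<Rightarrow> real" where
  "pairing u f y = (if y \<in> VS B then snd y u + f (fst y) else 0)"

text \<open>
  The regrouping \<open>(V1 \<oplus> V2) \<oplus> (V1\<^sup>* \<oplus> V2\<^sup>*) = (V2 \<oplus> V1\<^sup>*) \<oplus> (V1 \<oplus> V2\<^sup>*)\<close>.
\<close>

definition mirror_map ::
  "'a \<times> ('a \<Rightarrow> real) \<Rightarrow> ('a \<times> ('a \<Rightarrow> real)) \<times> ('a \<times> ('a \<Rightarrow> real) \<Rightarrow> real)" where
  "mirror_map x = ((pr2 (fst x), pull1 (snd x)), pairing (pr1 (fst x)) (snd x))"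

lemma VS_B_D: "y \<in> VS B \<Longrightarrow> fst y \<in> V2" "y \<in> VS B \<Longrightarrow> snd y \<in> V1_dual"
  "y \<in> VS B \<Longrightarrow> fst y \<in> V" "y \<in> VS B \<Longrightarrow> snd y \<in> dual_space V"
  by (auto simp: VS_B V2_V dest: annihD)

lemma subspace_VS_B: "subspace (VS B)"
  by (simp add: VS_def subspace_span)

lemma pull1_annih: "f \<in> dual_space V \<Longrightarrow> pull1 f \<in> V1_dual"
  unfolding pull1_def by (rule compose_pr1_V)

lemma pull1_apply: "x \<in> V \<Longrightarrow> pull1 f x = f (pr1 x)"
  by (simp add: pull1_def)

lemma pairing_dual:
  assumes f: "f \<in> dual_space V" and u: "u \<in> V"
  shows "pairing u f \<in> dual_space (VS B)"
  by (rule dual_spaceI)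
    (simp_all add: pairing_def subspace_add[OF subspace_VS_B] subspace_scale[OF subspace_VS_B]
      dual_space_add[OF f VS_B_D(3) VS_B_D(3)] dual_space_scale[OF f VS_B_D(3)] scaleR_fun_apply algebra_simps)

lemma mirror_map_linear: "linear mirror_map"
proof -
  have 1: "pull1 (f + g) = pull1 f + pull1 g" "pull1 (r *\<^sub>R f) = r *\<^sub>R pull1 f" for f g r
    by (auto simp: fun_eq_iff pull1_def scaleR_fun_apply)
  have 2: "pairing (pr1 x + pr1 y) (f + g) = pairing (pr1 x) f + pairing (pr1 y) g" for x y f g
    by (rule ext) (simp add: pairing_def dual_space_add[OF VS_B_D(4) pr_V(1) pr_V(1)])
  have 3: "pairing (r *\<^sub>R pr1 x) (r *\<^sub>R f) = r *\<^sub>R pairing (pr1 x) f" for x r f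
    by (rule ext) (simp add: pairing_def dual_space_scale[OF VS_B_D(4) pr_V(1)] scaleR_fun_apply distrib_left)
  show ?thesis
  proof (rule linearI)
    show "mirror_map (x + y) = mirror_map x + mirror_map y" for x y
      unfolding mirror_map_def fst_add snd_add linear_add[OF pr1(1)] linear_add[OF pr2(1)] 1 2
      by simp
    show "mirror_map (r *\<^sub>R x) = r *\<^sub>R mirror_map x" for r x
      unfolding mirror_map_def fst_scaleR snd_scaleR linear_scale[OF pr1(1)] linear_scale[OF pr2(1)] 1 3
      by simp
  qed
qed

lemma Lam_A: "Lam A = Lat A \<times> dual_lattice (Lat A)"
  by (simp add: Lam_def dual_torus_def)

lemma Lam_B: "Lam B = Lat B \<times> dual_lattice (Lat B)"
  by (simp add: Lam_def dual_torus_def)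

lemma dual_lattice_dual_space: "f \<in> dual_lattice (Lat A) \<Longrightarrow> f \<in> dual_space V"
  by (simp add: dual_lattice_def VS_def)

lemma span_Lam_A: "x \<in> span (Lam A) \<Longrightarrow> fst x \<in> V \<and> snd x \<in> dual_space V"
proof -
  have "span (Lam A) \<subseteq> V \<times> dual_space V"
    unfolding Lam_A VS_def
    by (intro span_minimal subspace_Times subspace_span subspace_dual_space)
      (auto simp: span_base dual_lattice_def)
  then show "x \<in> span (Lam A) \<Longrightarrow> fst x \<in> V \<and> snd x \<in> dual_space V" by auto
qed

lemma mirror_map_Lam: assumes "x \<in> Lam A" shows "mirror_map x \<in> Lam B"
proof -
  have x: "fst x \<in> Lat A" "snd x \<in> dual_lattice (Lat A)" using assms by (auto simp: Lam_A)
  have f: "snd x \<in> dual_space V" using x(2) by (rule dual_lattice_dual_space)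
  have int: "snd x z \<in> \<int>" if "z \<in> Lat A" for z using x(2) that by (simp add: dual_lattice_def)
  have p1: "pr1 z \<in> Lat A" if "z \<in> Lat A" for z using pr1_lattice[OF that] L1_subset by blast
  have "pull1 (snd x) z = 0" if "z \<in> \<Gamma>2" for z
    by (rule annihD(2)[OF pull1_annih[OF f] span_base[OF that]])
  then have "pull1 (snd x) \<in> L1_dual"
    using annihD(1)[OF pull1_annih[OF f]] int[OF p1] Lat_V
    by (simp add: annih_lattice_def dual_lattice_def VS_def[symmetric] pull1_apply)
  moreover have "pairing (pr1 (fst x)) (snd x) \<in> dual_lattice (Lat B)"
    unfolding dual_lattice_def VS_def[symmetric]
  proof (intro CollectI conjI ballI)
    show "pairing (pr1 (fst x)) (snd x) \<in> dual_space (VS B)" by (rule pairing_dual[OF f pr_V(1)])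
    fix y assume y: "y \<in> Lat B"
    then have "snd y (pr1 (fst x)) \<in> \<int>" "snd x (fst y) \<in> \<int>"
      using p1[OF x(1)] int L2_subset by (auto simp: Lat_B annih_lattice_def dual_lattice_def)
    then show "pairing (pr1 (fst x)) (snd x) y \<in> \<int>"
      using y by (simp add: pairing_def)
  qed
  ultimately show ?thesis
    using pr2_lattice[OF x(1)] by (simp add: mirror_map_def Lam_B Lat_B)
qed

text \<open>
  Evaluating the functional on \<open>V1\<^sup>*\<close> recovers the component in \<open>V1\<close>, and evaluating it on \<open>V2\<close>
  recovers the restriction of \<open>snd x\<close> to \<open>V2\<close>.
\<close>

lemma mirror_map_inj: "inj_on mirror_map (Lam A)"
proof (rule inj_onI)
  fix x y assume "x \<in> Lam A" "y \<in> Lam A" and eq: "mirror_map x = mirror_map y"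
  then have xy: "fst x \<in> V" "fst y \<in> V" "snd x \<in> dual_space V" "snd y \<in> dual_space V"
    using span_Lam_A[OF span_base] by auto
  have e2: "pr2 (fst x) = pr2 (fst y)" and ep: "pull1 (snd x) = pull1 (snd y)"
    and ea: "pairing (pr1 (fst x)) (snd x) = pairing (pr1 (fst y)) (snd y)"
    using eq by (auto simp: mirror_map_def)
  have "pr1 (fst x) - pr1 (fst y) = 0"
  proof (rule V1_separated)
    show "pr1 (fst x) - pr1 (fst y) \<in> V1" by (intro span_diff pr1(2))
    fix h assume h: "h \<in> V1_dual"
    have m: "(0, h) \<in> VS B" using h by (simp add: VS_B span_zero)
    have "pairing (pr1 (fst x)) (snd x) (0, h) = pairing (pr1 (fst y)) (snd y) (0, h)"
      by (simp only: ea)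
    then have "h (pr1 (fst x)) = h (pr1 (fst y))"
      using m by (simp add: pairing_def dual_space_zero[OF xy(3)] dual_space_zero[OF xy(4)])
    then show "h (pr1 (fst x) - pr1 (fst y)) = 0"
      using dual_space_diff[OF annihD(1)[OF h] _ pr_V(1) pr_V(1)] by (simp add: VS_def subspace_span)
  qed
  then have e1: "pr1 (fst x) = pr1 (fst y)" by simp
  have "fst x = pr1 (fst y) + pr2 (fst y)"
    unfolding e1[symmetric] e2[symmetric] by (rule pr_sum[OF xy(1), symmetric])
  also have "\<dots> = fst y" by (rule pr_sum[OF xy(2)])
  finally have "fst x = fst y" .
  moreover have "snd x = snd y"
  proof (rule dual_space_eqI[OF xy(3,4)])
    fix z assume z: "z \<in> V"
    have "(pr2 z, 0) \<in> VS B" using subspace_0[OF subspace_annih] pr2(2) by (simp add: VS_B)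
    then have "snd x (pr2 z) = snd y (pr2 z)"
      using fun_cong[OF ea, of "(pr2 z, 0)"] by (simp add: pairing_def)
    moreover have "snd x (pr1 z) = snd y (pr1 z)"
      using fun_cong[OF ep, of z] z by (simp add: pull1_apply)
    ultimately show "snd x z = snd y z"
      using dual_space_add[OF xy(3) pr_V(1) pr_V(2), of z z]
        dual_space_add[OF xy(4) pr_V(1) pr_V(2), of z z] pr_sum[OF z] by simp
  qed
  ultimately show "x = y" by (rule prod_eqI)
qed

text \<open>
  An integral functional \<open>F\<close> on \<open>\<Gamma>2 \<oplus> \<Gamma>1\<^sup>*\<close> is evaluation at some \<open>u \<in> \<Gamma>1\<close> on the second summand, by
  reflexivity. Its restriction to the first summand is the part of \<open>f\<close> on \<open>\<Gamma>2\<close>.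
\<close>

lemma mirror_map_surj: assumes "y \<in> Lam B" shows "\<exists>x\<in>Lam A. mirror_map x = y"
proof -
  obtain v g F where y: "y = ((v, g), F)" "v \<in> \<Gamma>2" "g \<in> L1_dual" "F \<in> dual_lattice (Lat B)"
    using assms by (auto simp: Lam_B Lat_B)
  have FV: "F \<in> dual_space (VS B)" and Fint: "\<And>z. z \<in> Lat B \<Longrightarrow> F z \<in> \<int>"
    using y(4) by (auto simp: dual_lattice_def VS_def)
  have gA: "g \<in> V1_dual" using y(3) L1_dual_subset by blast
  have 0: "0 \<in> V1_dual" "0 \<in> V2" "0 \<in> \<Gamma>2" "0 \<in> L1_dual"
    using subspace_0[OF subspace_annih] sub2 add_subgroup_annih_lattice
    by (auto simp: span_zero add_subgroup_def)
  have F_add: "F ((a, h) + (a', h')) = F (a, h) + F (a', h')"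
    if "a \<in> V2" "h \<in> V1_dual" "a' \<in> V2" "h' \<in> V1_dual" for a h a' h'
    using that by (intro dual_space_add[OF FV]) (auto simp: VS_B)
  have F_scale: "F (r *\<^sub>R (a, h)) = r * F (a, h)" if "a \<in> V2" "h \<in> V1_dual" for r a h
    using that by (intro dual_space_scale[OF FV]) (auto simp: VS_B)
  have "\<exists>u\<in>\<Gamma>1. \<forall>h\<in>V1_dual. F (0, h) = h u"
  proof (rule V1_reflexive)
    show "linear_on V1_dual UNIV (\<lambda>h. F (0, h))"
    proof (rule linear_onI)
      show "F (0, h + h') = F (0, h) + F (0, h')" if "h \<in> V1_dual" "h' \<in> V1_dual" for h h'
        using F_add[OF 0(2) that(1) 0(2) that(2)] by simp
      show "F (0, r *\<^sub>R h) = r *\<^sub>R F (0, h)" if "h \<in> V1_dual" for r h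
        using F_scale[OF 0(2) that, of r] by simp
    qed auto
    show "F (0, h) \<in> \<int>" if "h \<in> L1_dual" for h
      using that 0 by (intro Fint) (simp add: Lat_B)
  qed
  then obtain u where u: "u \<in> \<Gamma>1" "\<And>h. h \<in> V1_dual \<Longrightarrow> F (0, h) = h u" by blast
  define f where "f z = (if z \<in> V then g (pr1 z) + F (pr2 z, 0) else 0)" for z
  have fV: "f \<in> dual_space V"
  proof (rule dual_spaceI)
    note gV = annihD(1)[OF gA]
    show "f (a + b) = f a + f b" if "a \<in> V" "b \<in> V" for a b
      using that F_add[OF pr2(2) 0(1) pr2(2) 0(1), of a b]
      by (simp add: f_def V_add linear_add[OF pr1(1)] linear_add[OF pr2(1)]
          dual_space_add[OF gV pr_V(1) pr_V(1)])
    show "f (r *\<^sub>R a) = r * f a" if "a \<in> V" for r a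
      using that F_scale[OF pr2(2) 0(1), of r a]
      by (simp add: f_def V_scale linear_scale[OF pr1(1)] linear_scale[OF pr2(1)]
          dual_space_scale[OF gV pr_V(1)] distrib_left)
  qed (simp add: f_def)
  have "f z \<in> \<int>" if z: "z \<in> Lat A" for z
  proof -
    have "g (pr1 z) \<in> \<int>"
      using y(3) pr1_lattice[OF z] L1_subset by (auto simp: annih_lattice_def dual_lattice_def)
    moreover have "F (pr2 z, 0) \<in> \<int>"
      using pr2_lattice[OF z] 0(4) by (intro Fint) (simp add: Lat_B)
    ultimately show ?thesis by (simp add: f_def)
  qed
  then have fL: "f \<in> dual_lattice (Lat A)" using fV by (simp add: dual_lattice_def VS_def)
  have uV: "u \<in> V1" "v \<in> V2" using u(1) y(2) by (auto intro: span_base)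
  have "u + v \<in> Lat A" using u(1) y(2) unfolding L_sum by blast
  then have "(u + v, f) \<in> Lam A" using fL by (simp add: Lam_A)
  moreover have "mirror_map (u + v, f) = y"
  proof -
    have pr: "pr1 (u + v) = u" "pr2 (u + v) = v"
      using uV by (simp_all add: linear_add[OF pr1(1)] linear_add[OF pr2(1)] pr1 pr2)
    have F00: "F (0, 0) = 0" using dual_space_zero[OF FV] by (simp add: zero_prod_def)
    have "pull1 f = g"
    proof (rule dual_space_eqI[OF annihD(1)[OF pull1_annih[OF fV]] annihD(1)[OF gA]])
      fix z assume z: "z \<in> V"
      have "pull1 f z = g (pr1 (pr1 z)) + F (pr2 (pr1 z), 0)"
        using z pr_V(1) by (simp add: pull1_apply f_def)
      also have "\<dots> = g (pr1 z)"
        using F00 by (simp only: pr1(3)[OF pr1(2)] pr2(4)[OF pr1(2)] add_0_right)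
      also have "\<dots> = g z" by (rule annih_pr1_V[OF gA z])
      finally show "pull1 f z = g z" .
    qed
    moreover have "pairing u f = F"
    proof (rule dual_space_eqI[OF pairing_dual[OF fV V1_V[OF uV(1)]] FV])
      fix z assume z: "z \<in> VS B"
      then obtain w h where w: "z = (w, h)" "w \<in> V2" "h \<in> V1_dual" unfolding VS_B by blast
      have "pairing u f z = h u + (g (pr1 w) + F (pr2 w, 0))"
        using z w by (simp add: pairing_def f_def V2_V)
      also have "\<dots> = F (0, h) + F (w, 0)"
        using u(2)[OF w(3)] w(2) dual_space_zero[OF annihD(1)[OF gA]] by (simp add: pr1(4) pr2(3))
      also have "\<dots> = F z"
        using F_add[OF 0(2) w(3) w(2) 0(1)] w(1) by simp
      finally show "pairing u f z = F z" .
    qed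
    ultimately show ?thesis by (simp add: mirror_map_def pr y(1))
  qed
  ultimately show ?thesis by blast
qed

text \<open>
  \<open>Lam_form\<close> pairs each summand with its dual, and the regrouping keeps these pairs together.
\<close>

lemma mirror_map_isometry:
  assumes "x \<in> Lam A" "y \<in> Lam A"
  shows "Lam_form (mirror_map x) (mirror_map y) = Lam_form x y"
proof -
  have x: "fst x \<in> V" "snd x \<in> dual_space V" and y: "fst y \<in> V" "snd y \<in> dual_space V"
    using span_Lam_A[OF span_base] assms by auto
  have m: "(pr2 (fst x), pull1 (snd x)) \<in> VS B" "(pr2 (fst y), pull1 (snd y)) \<in> VS B"
    using pull1_annih[OF x(2)] pull1_annih[OF y(2)] pr2(2) by (auto simp: VS_B)
  have s: "snd a (pr1 (fst b)) + snd a (pr2 (fst b)) = snd a (fst b)"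
    if "snd a \<in> dual_space V" "fst b \<in> V" for a b :: "'a \<times> ('a \<Rightarrow> real)"
    using dual_space_add[OF that(1) pr_V(1) pr_V(2), of "fst b" "fst b"] pr_sum[OF that(2)] by simp
  have "Lam_form (mirror_map x) (mirror_map y) =
      (snd y (pr1 (fst x)) + snd x (pr2 (fst y))) + (snd x (pr1 (fst y)) + snd y (pr2 (fst x)))"
    using m by (simp add: Lam_form_def mirror_map_def pairing_def pull1_apply pr_V pr1(3)[OF pr1(2)])
  also have "\<dots> = Lam_form x y"
    using s[OF x(2) y(1)] s[OF y(2) x(1)] by (simp add: Lam_form_def)
  finally show ?thesis .
qed

lemma J_prod_A: "J_prod A x = (J (fst x), \<lambda>v. if v \<in> V then snd x (- J v) else 0)"
  by (simp add: J_prod_def dual_torus_def map_prod_def case_prod_beta)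

text \<open>
  In the characterisation of \<open>I\<^sub>\<theta>\<close> without inverses, both equations are checked on \<open>(w, h)\<close>. They
  reduce to \<open>J\<close> applied to \<open>w = J k - pr1 (J k)\<close> with \<open>k = J\<^sub>2\<^sub>1\<^sup>-\<^sup>1 w\<close>, and to the same identity for the
  component of \<open>x\<close> in \<open>V2\<close>.
\<close>

lemma mirror_map_J:
  assumes "x \<in> span (Lam A)"
  shows "mirror_map (J_prod A x) = I_op B mirror_form (mirror_map x)"
proof -
  obtain z f where x: "x = (z, f)" and z: "z \<in> V" and f: "f \<in> dual_space V"
    using span_Lam_A[OF assms] by (cases x) auto
  define f' where "f' v = (if v \<in> V then f (- J v) else 0)" for v
  have f'_app: "f' v = - f (J v)" if "v \<in> V" for v
    using that by (simp add: f'_def dual_space_minus[OF f J_mem])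
  have f': "f' \<in> dual_space V"
  proof (rule dual_spaceI)
    show "f' v = 0" if "v \<notin> V" for v using that by (simp add: f'_def)
  qed (simp_all add: f'_app V_add V_scale J_add J_scale dual_space_add[OF f J_mem J_mem]
      dual_space_scale[OF f J_mem])
  let ?y = "(pr2 (J z), pull1 f')" and ?x = "(pr2 z, pull1 f)"
  have yB: "?y \<in> VS B" and xB: "?x \<in> VS B"
    using pull1_annih[OF f] pull1_annih[OF f'] pr2(2) by (auto simp: VS_B)
  have rf: "hom_form mirror_re \<in> real_forms B" "hom_form mirror_im \<in> real_forms B"
    using weak_pair_forms(1,2)[OF weak_pair_B] by (simp_all add: re_mirror_form im_mirror_form)
  have FB: "pairing (pr1 z) f \<in> dual_space (VS B)" by (rule pairing_dual[OF f pr_V(1)])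
  let ?k = "J21_inv (pr2 z)"
  have k: "?k \<in> V" "?k \<in> V1" "J ?k \<in> V" using J21_inv_V J21_inv_mem J_mem pr2(2) by auto
  \<comment> \<open>The two identities for \<open>z\<close>, from applying \<open>J\<close> to \<open>pr2 z = J ?k - pr1 (J ?k)\<close>.\<close>
  have Jz: "J z = J (pr1 z) + (- ?k - J (pr1 (J ?k)))"
  proof -
    have "J z = J (pr1 z) + J (pr2 z)"
      using J_add[OF pr_V(1) pr_V(2), of z z] pr_sum[OF z] by simp
    also have "pr2 z = J ?k - pr1 (J ?k)" using J_J21_inv[OF pr2(2), of z] by (simp add: algebra_simps)
    also have "J \<dots> = - ?k - J (pr1 (J ?k))" using J_diff[OF k(3) pr_V(1)] J_J[OF k(1)] by simp
    finally show ?thesis .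
  qed
  have k2: "J21_inv (pr2 (J z)) = pr1 z - pr1 (J ?k)"
  proof (rule J21_inv_eqI)
    show "pr1 z - pr1 (J ?k) \<in> V1" by (intro span_diff pr1(2))
    have "J (pr1 z - pr1 (J ?k)) = J z + ?k" using J_diff[OF pr_V(1) pr_V(1)] Jz by simp
    then show "pr2 (J (pr1 z - pr1 (J ?k))) = pr2 (J z)"
      by (simp add: linear_add[OF pr2(1)] pr2(4)[OF k(2)])
  qed
  have im: "hom_form mirror_im ?y = hom_form mirror_re ?x - pairing (pr1 z) f"
  proof (rule dual_space_eqI)
    show "hom_form mirror_im ?y \<in> dual_space (VS B)" by (rule form_mem[OF rf(2) yB])
    show "hom_form mirror_re ?x - pairing (pr1 z) f \<in> dual_space (VS B)"
      by (intro subspace_diff[OF subspace_dual_space] form_mem[OF rf(1) xB] FB)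
    fix u assume u: "u \<in> VS B"
    obtain w h where w: "u = (w, h)" "w \<in> V2" "h \<in> V1_dual" using u unfolding VS_B by blast
    note hV = annihD(1)[OF w(3)]
    have wV: "J21_inv w \<in> V" "J21_inv w \<in> V1" "J (J21_inv w) \<in> V" using J21_inv_V J21_inv_mem J_mem w(2) by auto
    have "hom_form mirror_im ?y u = h (- J21_inv (pr2 (J z))) - pull1 f' (- J21_inv w)"
      using u yB w by (simp add: hom_form_def mirror_im_def pr2(3) pr2(3)[OF pr2(2)])
    also have "pull1 f' (- J21_inv w) = f (J (J21_inv w))"
      using wV by (simp add: pull1_apply V_minus pr1(3) span_neg f'_app J_minus
          dual_space_minus[OF f wV(3)])
    also have "f (J (J21_inv w)) = f (pr1 (J (J21_inv w))) + f w"
      using J_J21_inv[OF w(2)] dual_space_add[OF f pr_V(1) V2_V[OF w(2)], of "J (J21_inv w)"] by simp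
    also have "h (- J21_inv (pr2 (J z))) = h (pr1 (J ?k)) - h (pr1 z)"
      unfolding k2 using dual_space_diff[OF hV _ pr_V(1) pr_V(1), of "J ?k" z]
      by (simp add: VS_def subspace_span)
    finally have lhs: "hom_form mirror_im ?y u = h (pr1 (J ?k)) - h (pr1 z) - (f (pr1 (J (J21_inv w))) + f w)" .
    have "hom_form mirror_re ?x u = h (pr1 (J ?k)) - f (pr1 (J (J21_inv w)))"
      using u xB w by (simp add: hom_form_def mirror_re_def pr2(3) pr2(3)[OF pr2(2)] pull1_apply pr_V
          pr1(3)[OF pr1(2)])
    with lhs show "hom_form mirror_im ?y u = (hom_form mirror_re ?x - pairing (pr1 z) f) u"
      using u w by (simp add: pairing_def)
  qed
  have re: "pairing (pr1 (J z)) f' = hom_form mirror_im ?x + hom_form mirror_re ?y"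
  proof (rule dual_space_eqI)
    show "pairing (pr1 (J z)) f' \<in> dual_space (VS B)" by (rule pairing_dual[OF f' pr_V(1)])
    show "hom_form mirror_im ?x + hom_form mirror_re ?y \<in> dual_space (VS B)"
      by (intro subspace_add[OF subspace_dual_space] form_mem[OF rf(1) yB] form_mem[OF rf(2) xB])
    fix u assume u: "u \<in> VS B"
    obtain w h where w: "u = (w, h)" "w \<in> V2" "h \<in> V1_dual" using u unfolding VS_B by blast
    note hV = annihD(1)[OF w(3)]
    have wV: "J21_inv w \<in> V" "J21_inv w \<in> V1" "J (J21_inv w) \<in> V" using J21_inv_V J21_inv_mem J_mem w(2) by auto
    have "h (pr1 (J z)) = - h ?k + h (pr1 (J (pr1 z - pr1 (J ?k))))"
    proof -
      have "J z = J (pr1 z - pr1 (J ?k)) - ?k" using J_diff[OF pr_V(1) pr_V(1)] Jz by simp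
      then have "pr1 (J z) = pr1 (J (pr1 z - pr1 (J ?k))) - ?k"
        by (simp add: linear_diff[OF pr1(1)] pr1(3)[OF k(2)])
      then show ?thesis
        using dual_space_diff[OF hV _ pr_V(1) k(1), of "J (pr1 z - pr1 (J ?k))"]
        by (simp add: VS_def subspace_span)
    qed
    moreover have "- f (J w) = f (J21_inv w) + f (J (pr1 (J (J21_inv w))))"
    proof -
      have "w = J (J21_inv w) - pr1 (J (J21_inv w))" using J_J21_inv[OF w(2)] by (simp add: algebra_simps)
      then have "J w = - J21_inv w - J (pr1 (J (J21_inv w)))"
        using J_diff[OF wV(3) pr_V(1)] J_J[OF wV(1)] by metis
      then have "J w = - (J21_inv w + J (pr1 (J (J21_inv w))))" by simp
      then have "f (J w) = - f (J21_inv w + J (pr1 (J (J21_inv w))))"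
        using dual_space_minus[OF f V_add[OF wV(1) J_mem[OF pr_V(1)]]] by simp
      then show ?thesis using dual_space_add[OF f wV(1) J_mem[OF pr_V(1)]] by simp
    qed
    moreover have "hom_form mirror_im ?x u = - h ?k + f (J21_inv w)"
      using u xB w wV by (simp add: hom_form_def mirror_im_def pr2(3) pr2(3)[OF pr2(2)] pull1_apply V_minus
          linear_neg[OF pr1(1)] pr1(3)[OF wV(2)] dual_space_minus[OF f wV(1)] dual_space_minus[OF hV k(1)])
    moreover have "hom_form mirror_re ?y u = h (pr1 (J (pr1 z - pr1 (J ?k)))) + f (J (pr1 (J (J21_inv w))))"
      using u yB w by (simp add: hom_form_def mirror_re_def pr2(3) pr2(3)[OF pr2(2)] k2 pull1_apply pr_V
          pr1(3)[OF pr1(2)] f'_app)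
    moreover have "pairing (pr1 (J z)) f' u = h (pr1 (J z)) - f (J w)"
      using u w by (simp add: pairing_def f'_app V2_V)
    ultimately show "pairing (pr1 (J z)) f' u = (hom_form mirror_im ?x + hom_form mirror_re ?y) u" by simp
  qed
  have "I_op B mirror_form (?x, pairing (pr1 z) f) = (?y, pairing (pr1 (J z)) f')"
    by (rule I_op_eqI[OF weak_pair_B xB FB yB]) (simp_all only: re_mirror_form im_mirror_form im re)
  moreover have "J_prod A x = (J z, f')"
    by (simp add: J_prod_A x f'_def fun_eq_iff)
  ultimately show ?thesis by (simp add: mirror_map_def x)
qed

text \<open>
  The component in \<open>V2 \<oplus> V1\<^sup>*\<close> is the restriction of \<open>I\<^sub>\<omega>\<close> by isotropy. The component in the dual
  follows because \<open>I\<^sub>\<omega>\<close> is skew for the pairing of \<open>V \<oplus> V\<^sup>*\<close> with itself.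
\<close>

lemma mirror_map_I:
  assumes "x \<in> span (Lam A)"
  shows "mirror_map (I_op A \<omega> x) = J_prod B (mirror_map x)"
proof -
  obtain z f where x: "x = (z, f)" and z: "z \<in> V" and f: "f \<in> dual_space V"
    using span_Lam_A[OF assms] by (cases x) auto
  obtain a b where a: "I_op A \<omega> (z, f) = (a, b)" "a \<in> V" "b \<in> dual_space V"
    "q a = p z - f" "b = q z + p a"
    using I_op_obtain[OF weak z f] .
  have pf: "p \<in> real_forms A" and qf: "q \<in> real_forms A" using pq_iso iso_form by auto
  let ?x = "(pr2 z, pull1 f)"
  have xB: "?x \<in> VS B" using pull1_annih[OF f] pr2(2) by (auto simp: VS_B)
  have qpr: "q (pr2 c) w = q c (pr1 w)" "p (pr2 c) w = p c (pr1 w)" if c: "c \<in> V" and w: "w \<in> V" for c w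
  proof -
    have "g (pr2 c) w = g c (pr1 w)" if g: "g \<in> iso_forms" for g
    proof -
      have "g (pr2 c) w = g (pr2 c) (pr1 w)"
        using annih_pr1_V[OF iso_annih[OF g pr2(2)] w] by simp
      also have "\<dots> = g c (pr1 w)" using iso_pr2[OF g c pr1(2)] by simp
      finally show ?thesis .
    qed
    then show "q (pr2 c) w = q c (pr1 w)" "p (pr2 c) w = p c (pr1 w)" using pq_iso by auto
  qed
  have I: "Cpx B ?x = (pr2 a, pull1 b)"
  proof (rule Cpx_B_eqI)
    show "pr2 z \<in> V2" "pr2 a \<in> V2" by (rule pr2(2))+
    show "pull1 f \<in> V1_dual" by (rule pull1_annih[OF f])
    show "q (pr2 a) = p (pr2 z) - pull1 f"
    proof (rule dual_space_eqI)
      show "q (pr2 a) \<in> dual_space V" by (rule form_mem[OF qf pr_V(2)])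
      show "p (pr2 z) - pull1 f \<in> dual_space V"
        by (intro subspace_diff[OF subspace_dual_space] form_mem[OF pf pr_V(2)] annihD(1)[OF pull1_annih[OF f]])
      fix w assume w: "w \<in> V"
      show "q (pr2 a) w = (p (pr2 z) - pull1 f) w"
        using qpr(1)[OF a(2) w] qpr(2)[OF z w] w by (simp add: a(4) pull1_apply)
    qed
    show "pull1 b = q (pr2 z) + p (pr2 a)"
    proof (rule dual_space_eqI)
      show "pull1 b \<in> dual_space V" by (rule annihD(1)[OF pull1_annih[OF a(3)]])
      show "q (pr2 z) + p (pr2 a) \<in> dual_space V"
        by (intro subspace_add[OF subspace_dual_space] form_mem[OF pf pr_V(2)] form_mem[OF qf pr_V(2)])
      fix w assume w: "w \<in> V"
      show "pull1 b w = (q (pr2 z) + p (pr2 a)) w"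
        using qpr(1)[OF z w] qpr(2)[OF a(2) w] w by (simp add: a(5) pull1_apply)
    qed
  qed
  have "pairing (pr1 a) b u = (if u \<in> VS B then pairing (pr1 z) f (- Cpx B u) else 0)" for u
  proof (cases "u \<in> VS B")
    case True
    then obtain w h where w: "u = (w, h)" "w \<in> V2" "h \<in> V1_dual" unfolding VS_B by blast
    obtain a' b' where a': "Cpx B (w, h) = (a', b')" "a' \<in> V2" "b' \<in> V1_dual" "q a' = p w - h"
      "b' = q w + p a'"
      using Cpx_B_obtain[OF w(2,3)] .
    have wV: "w \<in> V" and aV: "a' \<in> V" using w a' V2_V by auto
    have mem: "(a', b') \<in> VS B" using a' by (simp add: VS_B)
    have h: "h c = p w c - q a' c" for c using a'(4) by simp
    have fa: "f c = p z c - q a c" for c using a(4) by simp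
    have "pairing (pr1 z) f (- Cpx B u) = - pairing (pr1 z) f (a', b')"
      using dual_space_minus[OF pairing_dual[OF f pr_V(1)] mem, of z] w a'(1) by simp
    also have "pairing (pr1 z) f (a', b') = b' z + f a'"
      using mem annih_pr1_V[OF a'(3) z] by (simp add: pairing_def)
    also have "- (b' z + f a') = h a + b w"
      unfolding a'(5) a(5) h fa plus_fun_apply
      using form_skew[OF qf wV z] form_skew[OF pf aV z] form_skew[OF qf a(2) aV] form_skew[OF pf a(2) wV]
      by simp
    also have "\<dots> = pairing (pr1 a) b u"
      using True w annih_pr1_V[OF w(3) a(2)] by (simp add: pairing_def)
    finally show ?thesis using True by simp
  next
    case False
    then show ?thesis by (simp add: pairing_def)
  qed
  then have "pairing (pr1 a) b = (\<lambda>u. if u \<in> VS B then pairing (pr1 z) f (- Cpx B u) else 0)"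
    by blast
  moreover have "J_prod B (mirror_map x) =
      (Cpx B ?x, \<lambda>u. if u \<in> VS B then pairing (pr1 z) f (- Cpx B u) else 0)"
    by (simp add: J_prod_def dual_torus_def mirror_map_def x)
  ultimately show ?thesis using I a(1) by (simp add: mirror_map_def x)
qed

lemma mirror_symmetric_B: "mirror_symmetric A \<omega> B mirror_form"
  unfolding mirror_symmetric_def
proof (intro conjI exI[of _ mirror_map] ballI)
  show "weak_pair A \<omega>" "weak_pair B mirror_form" using weak weak_pair_B by auto
  have "mirror_map x \<in> span (Lam B)" if "x \<in> span (Lam A)" for x
  proof -
    have "mirror_map ` span (Lam A) = span (mirror_map ` Lam A)"
      by (rule linear_span_image[OF mirror_map_linear, symmetric])
    also have "\<dots> \<subseteq> span (Lam B)" using mirror_map_Lam by (intro span_mono) blast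
    finally show ?thesis using that by blast
  qed
  then show "linear_on (span (Lam A)) (span (Lam B)) mirror_map"
    using mirror_map_linear by (intro linear_onI) (auto simp: linear_add linear_scale)
  show "bij_betw mirror_map (Lam A) (Lam B)"
    unfolding bij_betw_def
  proof (intro conjI mirror_map_inj equalityI subsetI)
    show "y \<in> Lam B" if "y \<in> mirror_map ` Lam A" for y using that mirror_map_Lam by blast
    show "y \<in> mirror_map ` Lam A" if "y \<in> Lam B" for y
      using mirror_map_surj[OF that] by blast
  qed
  show "Lam_form (mirror_map x) (mirror_map y) = Lam_form x y" if "x \<in> Lam A" "y \<in> Lam A" for x y
    using that by (rule mirror_map_isometry)
  show "mirror_map (J_prod A x) = I_op B mirror_form (mirror_map x)"
    "mirror_map (I_op A \<omega> x) = J_prod B (mirror_map x)" if "x \<in> span (Lam A)" for x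
    using mirror_map_J[OF that] mirror_map_I[OF that] by auto
qed

end

context wb_pair
begin

section \<open>A well-becoming decomposition of the mirror\<close>

lemma add_subgroup_iso_NS: "add_subgroup iso_NS"
proof -
  have "add_subgroup iso_forms"
    using subspace_0[OF subspace_iso_forms] subspace_diff[OF subspace_iso_forms]
    by (simp add: add_subgroup_def)
  then show ?thesis unfolding iso_NS_def by (intro add_subgroup_Int add_subgroup_NS)
qed

lemma q_surj:
  assumes "g \<in> V1_dual"
  shows "inv_into V q g \<in> V2" "q (inv_into V q g) = g"
proof -
  have g: "g \<in> q ` V" using q_bij annihD(1)[OF assms] by (simp add: bij_betw_def)
  then have m: "inv_into V q g \<in> V" and eq: "q (inv_into V q g) = g"
    by (auto intro: inv_into_into f_inv_into_f)
  show "q (inv_into V q g) = g" by (rule eq)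
  show "inv_into V q g \<in> V2" by (rule q_V2[OF m]) (simp add: eq assms)
qed

text \<open>
  Replacing \<open>\<phi>\<^sub>1\<close> by \<open>\<phi>\<^sub>1 - c\<close> with \<open>c\<close> integral corresponds to replacing the complement \<open>\<Gamma>2\<close>
  of \<open>\<Gamma>1\<^sup>*\<close> in the lattice of the new torus by the graph of \<open>c\<close>. Rounding the coefficients of \<open>\<phi>\<^sub>1 - N \<phi>\<^sub>2\<close> gives such a \<open>c\<close>
  for which \<open>T = \<phi>\<^sub>2\<^sup>-\<^sup>1 (\<phi>\<^sub>1 - c)\<close> differs from \<open>N\<close> by a bounded amount, so that \<open>1 + T\<^sup>2\<close> is
  injective for large \<open>N\<close>.
\<close>

lemma shearing_form_exists:
  "\<exists>c\<in>iso_NS. \<exists>T. linear_on V2 V2 T \<and> (\<forall>v\<in>V2. q (T v) = p v - c v) \<and>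
     (\<forall>v\<in>V2. v + T (T v) = 0 \<longrightarrow> v = 0)"
proof -
  have qf: "q \<in> real_forms A" using pq_iso iso_form by auto
  obtain S u w where S: "finite S" "S \<subseteq> iso_NS" and p_eq: "p = (\<Sum>a\<in>S. u a *\<^sub>R a)"
    and q_eq: "q = (\<Sum>a\<in>S. w a *\<^sub>R a)"
    using pq_span by (rule span_common_finite)
  have Sf: "a \<in> iso_forms" if "a \<in> S" for a using S(2) that by (auto simp: iso_NS_def)
  define R where "R a v = inv_into V q (a v)" for a and v :: 'a
  have R: "R a v \<in> V2" "q (R a v) = a v" if "a \<in> S" "v \<in> V2" for a v
    unfolding R_def using q_surj[OF iso_annih[OF Sf[OF that(1)] that(2)]] by auto
  have R_lin: "linear_on V2 V2 (R a)" if a: "a \<in> S" for a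
  proof (rule linear_onI)
    note af = iso_form[OF Sf[OF a]]
    show "R a v \<in> V2" if "v \<in> V2" for v using R(1)[OF a that] .
    show "R a (v + v') = R a v + R a v'" if v: "v \<in> V2" and v': "v' \<in> V2" for v v'
    proof (rule q_inj)
      show "R a (v + v') \<in> V" "R a v + R a v' \<in> V"
        using R(1)[OF a] v v' span_add[OF v v'] V2_V V_add by auto
      show "q (R a (v + v')) = q (R a v + R a v')"
        unfolding R(2)[OF a span_add[OF v v']] form_add[OF qf V2_V[OF R(1)[OF a v]] V2_V[OF R(1)[OF a v']]]
          R(2)[OF a v] R(2)[OF a v'] by (rule form_add[OF af V2_V[OF v] V2_V[OF v']])
    qed
    show "R a (r *\<^sub>R v) = r *\<^sub>R R a v" if v: "v \<in> V2" for r v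
    proof (rule q_inj)
      show "R a (r *\<^sub>R v) \<in> V" "r *\<^sub>R R a v \<in> V"
        using R(1)[OF a] v span_scale[OF v] V2_V V_scale by auto
      show "q (R a (r *\<^sub>R v)) = q (r *\<^sub>R R a v)"
        unfolding R(2)[OF a span_scale[OF v]] form_scale[OF qf V2_V[OF R(1)[OF a v]]] R(2)[OF a v]
        by (rule form_scale[OF af V2_V[OF v]])
    qed
  qed
  obtain C where C: "finite C" "independent C" "\<Gamma>2 = group_closure C"
    using lattice2 is_lattice_def by blast
  have V2C: "V2 = span C" using C(3) span_group_closure by metis
  obtain N :: nat where N: "\<And>t v w. (\<forall>a\<in>S. \<bar>t a\<bar> \<le> 1) \<Longrightarrow> v \<in> V2 \<Longrightarrow>
      w = of_nat N *\<^sub>R v + (\<Sum>a\<in>S. t a *\<^sub>R R a v) \<Longrightarrow>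
      v + (of_nat N *\<^sub>R w + (\<Sum>a\<in>S. t a *\<^sub>R R a w)) = 0 \<Longrightarrow> v = 0"
    using one_plus_square_injective[OF C(1,2) S(1), of R] R_lin unfolding V2C by blast
  define n where "n a = \<lfloor>u a - real N * w a\<rfloor>" for a
  define t where "t a = frac (u a - real N * w a)" for a
  define c where "c = (\<Sum>a\<in>S. real_of_int (n a) *\<^sub>R a)"
  define T where "T v = of_nat N *\<^sub>R v + (\<Sum>a\<in>S. t a *\<^sub>R R a v)" for v
  have "c \<in> iso_NS"
    unfolding c_def using S(2)
    by (intro add_subgroup_sum[OF add_subgroup_iso_NS] add_subgroup_scale[OF add_subgroup_iso_NS]) auto
  moreover have "linear_on V2 V2 T"
  proof (rule linear_onI)
    show "T v \<in> V2" if "v \<in> V2" for v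
      unfolding T_def using that R(1) by (intro span_add span_scale span_sum) auto
    show "T (v + v') = T v + T v'" if "v \<in> V2" "v' \<in> V2" for v v'
      unfolding T_def using that
      by (simp add: linear_on_add[OF R_lin] scaleR_right_distrib sum.distrib)
    show "T (r *\<^sub>R v) = r *\<^sub>R T v" if "v \<in> V2" for r v
      unfolding T_def using that
      by (simp add: linear_on_scale[OF R_lin] scaleR_right_distrib scaleR_sum_right mult.commute)
  qed
  moreover have "q (T v) = p v - c v" if v: "v \<in> V2" for v
  proof -
    have mem: "R a v \<in> V" "t a *\<^sub>R R a v \<in> V" if "a \<in> S" for a
      using R(1)[OF that v] V2_V V_scale by auto
    have sum_mem: "(\<Sum>a\<in>S. t a *\<^sub>R R a v) \<in> V" and NV: "real N *\<^sub>R v \<in> V"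
      using mem(2) V_scale[OF V2_V[OF v]] unfolding VS_def by (auto intro: span_sum)
    show ?thesis
    proof
      fix x
      have "q (T v) x = (real N *\<^sub>R q v + (\<Sum>a\<in>S. q (t a *\<^sub>R R a v))) x"
        unfolding T_def form_add[OF qf NV sum_mem] form_scale[OF qf V2_V[OF v]]
        by (simp only: form_sum[OF qf mem(2)])
      also have "\<dots> = real N * q v x + (\<Sum>a\<in>S. t a * a v x)"
        using form_scale[OF qf mem(1)] R(2)[OF _ v]
        by (simp add: sum_fun_apply scaleR_fun_apply)
      also have "q v x = (\<Sum>a\<in>S. w a * a v x)"
        unfolding q_eq by (simp add: sum_fun_apply scaleR_fun_apply)
      also have "real N * (\<Sum>a\<in>S. w a * a v x) + (\<Sum>a\<in>S. t a * a v x)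
          = (\<Sum>a\<in>S. u a * a v x) - (\<Sum>a\<in>S. real_of_int (n a) * a v x)"
        by (simp add: sum_distrib_left sum.distrib[symmetric] sum_subtractf[symmetric] t_def n_def
            frac_def algebra_simps)
      also have "\<dots> = (p v - c v) x"
        unfolding p_eq c_def by (simp add: sum_fun_apply scaleR_fun_apply)
      finally show "q (T v) x = (p v - c v) x" .
    qed
  qed
  moreover have "v = 0" if v: "v \<in> V2" "v + T (T v) = 0" for v
  proof (rule N[OF _ v(1)])
    show "\<forall>a\<in>S. \<bar>t a\<bar> \<le> 1" by (simp add: t_def less_imp_le[OF frac_lt_1])
    show "T v = of_nat N *\<^sub>R v + (\<Sum>a\<in>S. t a *\<^sub>R R a v)" by (simp only: T_def)
    show "v + (of_nat N *\<^sub>R T v + (\<Sum>a\<in>S. t a *\<^sub>R R a (T v))) = 0"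
      using v(2) unfolding T_def[of "T v"] .
  qed
  ultimately show ?thesis by blast
qed

text \<open>
  The decomposition consists of \<open>\<Gamma>1\<^sup>*\<close> and the graph of \<open>c\<close>. The graph is isotropic because \<open>c\<close> is
  compatible with both parts of the period matrix of \<open>J\<close>.
\<close>

lemma well_becoming_B: "well_becoming B mirror_form"
proof -
  obtain c T where c: "c \<in> iso_NS" and T: "linear_on V2 V2 T \<and> (\<forall>v\<in>V2. q (T v) = p v - c v) \<and>
      (\<forall>v\<in>V2. v + T (T v) = 0 \<longrightarrow> v = 0)"
    using shearing_form_exists by (elim bexE exE)
  have T_lin: "linear_on V2 V2 T" using T by (rule conjunct1)
  have qT: "q (T v) = p v - c v" if "v \<in> V2" for v
    using T[THEN conjunct2, THEN conjunct1] that by (rule bspec)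
  have T_inj: "v = 0" if "v \<in> V2" "v + T (T v) = 0" for v
    using bspec[OF T[THEN conjunct2, THEN conjunct2] that(1)] that(2) by (rule mp)
  have ci: "c \<in> iso_forms" using c by (simp add: iso_NS_def)
  have cf: "c \<in> real_forms A" and qf: "q \<in> real_forms A" and pf: "p \<in> real_forms A"
    using ci pq_iso iso_form by auto
  define \<Sigma>1 where "\<Sigma>1 = {0::'a} \<times> L1_dual"
  define \<Sigma>2 where "\<Sigma>2 = (\<lambda>v. (v, c v)) ` \<Gamma>2"
  have T_mem: "T v \<in> V2" if "v \<in> V2" for v by (rule linear_on_mem[OF T_lin that])
  have G2V2: "v \<in> V2" if "v \<in> \<Gamma>2" for v using that by (rule span_base)
  have zeros: "0 \<in> \<Gamma>2" "0 \<in> L1_dual" "0 \<in> V1_dual"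
    using sub2 add_subgroup_annih_lattice subspace_0[OF subspace_annih]
    by (auto simp: add_subgroup_def)
  have c_annih: "c v \<in> V1_dual" if "v \<in> V2" for v by (rule iso_annih[OF ci that])
  have sub1': "add_subgroup \<Sigma>1"
    using add_subgroup_annih_lattice by (auto simp: add_subgroup_def \<Sigma>1_def zero_prod_def)
  have sub2': "add_subgroup \<Sigma>2"
    unfolding add_subgroup_def
  proof (intro conjI ballI)
    show "0 \<in> \<Sigma>2"
      unfolding \<Sigma>2_def using zeros(1) form_0[OF cf] by (intro image_eqI[of _ _ 0]) (simp_all add: zero_prod_def)
    fix x y assume "x \<in> \<Sigma>2" "y \<in> \<Sigma>2"
    then obtain v w where v: "v \<in> \<Gamma>2" "x = (v, c v)" and w: "w \<in> \<Gamma>2" "y = (w, c w)"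
      by (auto simp: \<Sigma>2_def)
    have "c (v - w) = c v - c w" by (intro form_diff[OF cf] V2_V G2V2 v w)
    moreover have "v - w \<in> \<Gamma>2" using v w sub2 by (auto simp: add_subgroup_def)
    ultimately show "x - y \<in> \<Sigma>2"
      unfolding \<Sigma>2_def using v w by (intro image_eqI[of _ _ "v - w"]) auto
  qed
  have sum': "Lat B = {x + y |x y. x \<in> \<Sigma>1 \<and> y \<in> \<Sigma>2}"
  proof (intro equalityI subsetI)
    fix x assume "x \<in> Lat B"
    then obtain v g where x: "x = (v, g)" "v \<in> \<Gamma>2" "g \<in> L1_dual" by (auto simp: Lat_B)
    have "g - c v \<in> L1_dual"
      using add_subgroup_annih_lattice x(3) iso_NS_annih[OF c x(2)] by (simp add: add_subgroup_def)
    then have "(0, g - c v) \<in> \<Sigma>1" "(v, c v) \<in> \<Sigma>2" using x by (auto simp: \<Sigma>1_def \<Sigma>2_def)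
    moreover have "x = (0, g - c v) + (v, c v)" by (simp add: x(1) fun_eq_iff)
    ultimately show "x \<in> {x + y |x y. x \<in> \<Sigma>1 \<and> y \<in> \<Sigma>2}" by blast
  next
    fix z assume "z \<in> {x + y |x y. x \<in> \<Sigma>1 \<and> y \<in> \<Sigma>2}"
    then obtain g v where z: "z = (0, g) + (v, c v)" and "g \<in> L1_dual" "v \<in> \<Gamma>2"
      by (auto simp: \<Sigma>1_def \<Sigma>2_def)
    moreover have "g + c v \<in> L1_dual"
      using calculation iso_NS_annih[OF c] add_subgroup_add[OF add_subgroup_annih_lattice] by blast
    ultimately show "z \<in> Lat B" by (simp add: Lat_B)
  qed
  have inter': "\<Sigma>1 \<inter> \<Sigma>2 = {0}"
  proof
    show "\<Sigma>1 \<inter> \<Sigma>2 \<subseteq> {0}" using form_0[OF cf] by (auto simp: \<Sigma>1_def \<Sigma>2_def zero_prod_def)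
    show "{0} \<subseteq> \<Sigma>1 \<inter> \<Sigma>2" using sub1' sub2' by (simp add: add_subgroup_def)
  qed
  interpret S: split_lattice "Lat B" \<Sigma>1 \<Sigma>2
    using complex_torus_B sub1' sub2' sum' inter'
    by unfold_locales (auto simp: complex_torus_def)
  have W1: "span \<Sigma>1 = {0} \<times> V1_dual"
    unfolding \<Sigma>1_def using zeros by (simp add: span_Times span_L1_dual)
  have W2: "span \<Sigma>2 = (\<lambda>v. (v, c v)) ` V2"
  proof -
    define G where "G v = (pr2 v, c (pr2 v))" for v
    have "linear G"
    proof (rule linearI)
      show "G (v + w) = G v + G w" for v w
        unfolding G_def linear_add[OF pr2(1)] form_add[OF cf pr_V(2) pr_V(2)] by simp
      show "G (r *\<^sub>R v) = r *\<^sub>R G v" for r v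
        unfolding G_def linear_scale[OF pr2(1)] form_scale[OF cf pr_V(2)] by simp
    qed
    then have "span (G ` \<Gamma>2) = G ` V2" by (rule linear_span_image)
    moreover have "G ` \<Gamma>2 = \<Sigma>2"
      unfolding \<Sigma>2_def G_def using pr2(3)[OF G2V2] by (intro image_cong) auto
    moreover have "G ` V2 = (\<lambda>v. (v, c v)) ` V2"
      unfolding G_def using pr2(3) by (intro image_cong) auto
    ultimately show ?thesis by simp
  qed
  have iso_1: "mirror_form x y = 0" if "x \<in> span \<Sigma>1" "y \<in> span \<Sigma>1" for x y
  proof -
    have "hom_form d x y = 0" if d: "d \<in> homs" for d
      using \<open>x \<in> span \<Sigma>1\<close> \<open>y \<in> span \<Sigma>1\<close> linear_0[OF homsD(1)[OF d]]
      by (auto simp: W1 hom_form_def dual_space_zero[OF annihD(1)])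
    then show ?thesis using mirror_re_homs mirror_im_homs by (simp add: mirror_form_def zero_complex.code)
  qed
  have iso_2: "mirror_form x y = 0" if "x \<in> span \<Sigma>2" "y \<in> span \<Sigma>2" for x y
  proof -
    have "hom_form d x y = 0" if d: "compat c d" for d
      using \<open>x \<in> span \<Sigma>2\<close> \<open>y \<in> span \<Sigma>2\<close> d by (auto simp: W2 hom_form_def compat_def)
    then show ?thesis using compat_mirror_re[OF ci] compat_mirror_im[OF ci] by (simp add: mirror_form_def zero_complex.code)
  qed
  have diff_annih: "g - h \<in> V1_dual" if "g \<in> V1_dual" "h \<in> V1_dual" for g h
    using that by (rule subspace_diff[OF subspace_annih])
  \<comment> \<open>On \<open>\<Sigma>1\<close> the off-diagonal block is \<open>g \<mapsto> - \<phi>\<^sub>2\<^sup>-\<^sup>1 g\<close>.\<close>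
  have bij12: "bij_betw (\<lambda>x. proj_along (span \<Sigma>1) (span \<Sigma>2) (Cpx B x)) (span \<Sigma>1) (span \<Sigma>2)"
  proof -
    have blk: "proj_along (span \<Sigma>1) (span \<Sigma>2) (Cpx B (0, - q a)) = (a, c a)" if a: "a \<in> V2" for a
    proof -
      have qa: "- q a \<in> V1_dual"
        by (intro subspace_neg[OF subspace_annih] iso_annih[OF pq_iso(2) a])
      have "Cpx B (0, - q a) = (a, p a)"
        by (rule Cpx_B_eqI[OF _ qa a]) (simp_all add: span_zero form_0[OF pf] form_0[OF qf] fun_eq_iff)
      moreover have "(a, p a) - (a, c a) \<in> span \<Sigma>1"
        unfolding W1 using diff_annih[OF iso_annih[OF pq_iso(1) a] c_annih[OF a]] by simp
      moreover have "(a, c a) \<in> span \<Sigma>2" unfolding W2 using a by blast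
      ultimately show ?thesis
        using split_lattice.proj_along_unique[OF S.split_lattice_swap] by metis
    qed
    have par: "\<exists>a\<in>V2. x = (0, - q a)" if "x \<in> span \<Sigma>1" for x
    proof -
      obtain g where g: "x = (0, g)" "g \<in> V1_dual" using \<open>x \<in> span \<Sigma>1\<close> unfolding W1 by blast
      have ng: "- g \<in> V1_dual" by (rule subspace_neg[OF subspace_annih g(2)])
      have "x = (0, - q (inv_into V q (- g)))" unfolding q_surj(2)[OF ng] g(1) by simp
      then show ?thesis by (rule bexI[OF _ q_surj(1)[OF ng]])
    qed
    show ?thesis
      unfolding bij_betw_def
    proof (intro conjI inj_onI equalityI subsetI)
      fix x y assume x: "x \<in> span \<Sigma>1" and y: "y \<in> span \<Sigma>1"
        and eq: "proj_along (span \<Sigma>1) (span \<Sigma>2) (Cpx B x) = proj_along (span \<Sigma>1) (span \<Sigma>2) (Cpx B y)"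
      obtain a where a: "a \<in> V2" "x = (0, - q a)" using par[OF x] by blast
      obtain a' where a': "a' \<in> V2" "y = (0, - q a')" using par[OF y] by blast
      have "(a, c a) = (a', c a')" using eq unfolding a(2) a'(2) blk[OF a(1)] blk[OF a'(1)] .
      then show "x = y" using a a' by simp
    next
      fix y assume "y \<in> (\<lambda>x. proj_along (span \<Sigma>1) (span \<Sigma>2) (Cpx B x)) ` span \<Sigma>1"
      then obtain x where x: "x \<in> span \<Sigma>1" "y = proj_along (span \<Sigma>1) (span \<Sigma>2) (Cpx B x)" by blast
      obtain a where a: "a \<in> V2" "x = (0, - q a)" using par[OF x(1)] by blast
      show "y \<in> span \<Sigma>2" unfolding x(2) a(2) blk[OF a(1)] unfolding W2 using a(1) by blast
    next
      fix y assume "y \<in> span \<Sigma>2"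
      then obtain a where a: "a \<in> V2" "y = (a, c a)" unfolding W2 by blast
      have "(0, - q a) \<in> span \<Sigma>1"
        unfolding W1 using subspace_neg[OF subspace_annih iso_annih[OF pq_iso(2) a(1)]] by simp
      then show "y \<in> (\<lambda>x. proj_along (span \<Sigma>1) (span \<Sigma>2) (Cpx B x)) ` span \<Sigma>1"
        unfolding a(2) blk[OF a(1), symmetric] by (rule imageI)
    qed
  qed
  \<comment> \<open>On \<open>\<Sigma>2\<close> the off-diagonal block is \<open>\<phi>\<^sub>2 (1 + T\<^sup>2)\<close>.\<close>
  define M where "M v = v + T (T v)" for v
  have M_bij: "bij_betw M V2 V2"
  proof -
    obtain C where C: "finite C" "independent C" "\<Gamma>2 = group_closure C"
      using lattice2 is_lattice_def by blast
    have V2C: "V2 = span C" using C(3) span_group_closure by metis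
    have lin: "linear_on V2 V2 M"
      unfolding M_def
      by (rule linear_onI)
        (simp_all add: T_mem span_add linear_on_add[OF T_lin] linear_on_scale[OF T_lin] scaleR_right_distrib)
    show ?thesis
      unfolding V2C
    proof (rule injective_linear_on_surj[OF C(1,2,1) order_refl])
      show "linear_on (span C) (span C) M" using lin by (simp only: V2C)
      fix v assume "v \<in> span C" "M v = 0"
      then show "v = 0" using T_inj[of v] by (simp only: V2C M_def)
    qed
  qed
  have bij21: "bij_betw (\<lambda>x. proj_along (span \<Sigma>2) (span \<Sigma>1) (Cpx B x)) (span \<Sigma>2) (span \<Sigma>1)"
  proof -
    have blk: "proj_along (span \<Sigma>2) (span \<Sigma>1) (Cpx B (v, c v)) = (0, q (M v))" if v: "v \<in> V2" for v
    proof -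
      have Tv: "T v \<in> V2" "T (T v) \<in> V2" using T_mem v by auto
      have C: "Cpx B (v, c v) = (T v, q v + p (T v))"
        by (rule Cpx_B_eqI[OF v c_annih[OF v] Tv(1) qT[OF v] refl])
      have "q (M v) = q v + (p (T v) - c (T v))"
        unfolding M_def form_add[OF qf V2_V[OF v] V2_V[OF Tv(2)]] qT[OF Tv(1)] by (rule refl)
      then have "(T v, q v + p (T v)) - (0, q (M v)) = (T v, c (T v))"
        by (simp add: fun_eq_iff)
      then have "Cpx B (v, c v) - (0, q (M v)) \<in> span \<Sigma>2"
        unfolding C W2 using Tv(1) by simp
      moreover have "(0, q (M v)) \<in> span \<Sigma>1"
        unfolding W1 using iso_annih[OF pq_iso(2), of "M v"] M_bij v by (auto simp: bij_betw_def)
      ultimately show ?thesis by (intro S.proj_along_unique)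
    qed
    have M_mem: "M v \<in> V2" if "v \<in> V2" for v using M_bij that by (auto simp: bij_betw_def)
    show ?thesis
      unfolding bij_betw_def
    proof (intro conjI inj_onI equalityI subsetI)
      fix x y assume x: "x \<in> span \<Sigma>2" and y: "y \<in> span \<Sigma>2"
        and eq: "proj_along (span \<Sigma>2) (span \<Sigma>1) (Cpx B x) = proj_along (span \<Sigma>2) (span \<Sigma>1) (Cpx B y)"
      obtain v w where v: "v \<in> V2" "x = (v, c v)" and w: "w \<in> V2" "y = (w, c w)"
        using x y unfolding W2 by blast
      have "(0::'a, q (M v)) = (0, q (M w))" using eq unfolding v(2) w(2) blk[OF v(1)] blk[OF w(1)] .
      then have "M v = M w" using q_inj[OF V2_V[OF M_mem[OF v(1)]] V2_V[OF M_mem[OF w(1)]]] by simp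
      then have "v = w" using M_bij v(1) w(1) by (auto simp: bij_betw_def inj_on_def)
      then show "x = y" using v w by simp
    next
      fix y assume "y \<in> (\<lambda>x. proj_along (span \<Sigma>2) (span \<Sigma>1) (Cpx B x)) ` span \<Sigma>2"
      then obtain v where v: "v \<in> V2" "y = proj_along (span \<Sigma>2) (span \<Sigma>1) (Cpx B (v, c v))"
        unfolding W2 by blast
      show "y \<in> span \<Sigma>1"
        unfolding v(2) blk[OF v(1)] unfolding W1 using iso_annih[OF pq_iso(2) M_mem[OF v(1)]] by simp
    next
      fix y assume "y \<in> span \<Sigma>1"
      then obtain g where g: "y = (0, g)" "g \<in> V1_dual" unfolding W1 by blast
      have "inv_into V q g \<in> M ` V2" using M_bij q_surj(1)[OF g(2)] by (simp add: bij_betw_def)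
      then obtain v where v: "inv_into V q g = M v" "v \<in> V2" by (rule imageE)
      have "y = proj_along (span \<Sigma>2) (span \<Sigma>1) (Cpx B (v, c v))"
        unfolding blk[OF v(2)] v(1)[symmetric] q_surj(2)[OF g(2)] by (rule g(1))
      moreover have "(v, c v) \<in> span \<Sigma>2" unfolding W2 using v(2) by blast
      ultimately show "y \<in> (\<lambda>x. proj_along (span \<Sigma>2) (span \<Sigma>1) (Cpx B x)) ` span \<Sigma>2" by (rule image_eqI)
    qed
  qed
  have "wb_decomposition B mirror_form \<Sigma>1 \<Sigma>2"
    unfolding wb_decomposition_def
    by (intro conjI ballI sub1' sub2' sum' inter' iso_1 iso_2 bij12 bij21)
  then show ?thesis using weak_pair_B unfolding well_becoming_def by blast
qed

end

theorem theorem10p4p1: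
  fixes A :: "'a::real_vector torus"
    and \<omega> :: "'a \<Rightarrow> 'a \<Rightarrow> complex"
    and \<Gamma>1 \<Gamma>2 :: "'a set"
  assumes "weak_pair A \<omega>"
    and "wb_decomposition A \<omega> \<Gamma>1 \<Gamma>2"
  shows "\<exists>\<theta>. mirror_symmetric A \<omega> (B_torus A \<omega> \<Gamma>1 \<Gamma>2) \<theta> \<and>
             well_becoming (B_torus A \<omega> \<Gamma>1 \<Gamma>2) \<theta>"
proof -
  interpret wb_pair A \<omega> \<Gamma>1 \<Gamma>2 using assms by unfold_locales
  show ?thesis using mirror_symmetric_B well_becoming_B by blast
qed

end
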